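(* Let $n\ge 2$ and work with either the old or the new presentation of the braid group $B_n$, with corresponding fundamental braid $\mathbf D$, infimum $\inf$, supremum $\sup$, cycling operation $\mathbf c$ and decycling operation $\mathbf d$. Let $W\in B_n$. If $\inf(W)$ is not maximal among the values of $\inf$ on the conjugacy class $[W]$, then $\inf(\mathbf c^{|\mathbf D|-1}(W))>\inf(W)$. If $\sup(W)$ is not minimal among the values of $\sup$ on $[W]$, then $\sup(\mathbf d^{|\mathbf D|-1}(W))<\sup(W)$. Here $|\mathbf D|-1=\frac{n^2-n}{2}-1$ for the old presentation and $|\mathbf D|-1=n-2$ for the new presentation.
   Context: Presentations of the $n$-string braid group $B_n$. Old presentation: generators $\sigma_1,\dots,\sigma_{n-1}$; relations $\sigma_i\sigma_j=\sigma_j\sigma_i$ for $|i-j|>1$ and $\sigma_i\sigma_j\sigma_i=\sigma_j\sigma_i\sigma_j$ for $|i-j|=1$. New presentation: generators $a_{ts}$, $n\ge t>s\ge 1$; relations $a_{ts}a_{rq}=a_{rq}a_{ts}$ when $(t-r)(t-q)(s-r)(s-q)>0$, and $a_{ts}a_{sr}=a_{tr}a_{ts}=a_{sr}a_{tr}$ for $n\ge t>s>r\ge 1$. Fix one of the two presentations. $B_n^+$ is the monoid with the same generators and relations; it embeds in $B_n$, and its elements are called positive. All positive words representing a positive element $P$ have the same length, denoted $|P|$. $e$ is the identity. $[W]$ is the conjugacy class of $W$. Fundamental braid $\mathbf D$: in the old presentation $\mathbf D=\Delta=(\sigma_1\cdots\sigma_{n-1})(\sigma_1\cdots\sigma_{n-2})\cdots(\sigma_1\sigma_2)\sigma_1$,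 with $|\Delta|=n(n-1)/2$; in the new presentation $\mathbf D=\delta=a_{n(n-1)}a_{(n-1)(n-2)}\cdots a_{21}$, with $|\delta|=n-1$. $\tau$ is the automorphism of $B_n$ with $a\mathbf D=\mathbf D\tau(a)$ for all $a\in B_n$; it satisfies $\tau(\sigma_i)=\sigma_{n-i}$ (old) and $\tau(a_{ts})=a_{(t+1)(s+1)}$ with indices mod $n$ and $a_{ts}=a_{st}$ (new). Order: $W\le V$ means $V=WP$ for some $P\in B_n^+$; $V\ge W$ means $V=PW$ for some $P\in B_n^+$. $\mathbf Q=\{A\in B_n^+: \mathbf D=AB \text{ for some } B\in B_n^+\}$ and $\mathbf Q^\star=\mathbf Q\setminus\{e,\mathbf D\}$. For a positive $P$, its left-greedy decomposition is $P=A_0P_0$ with $A_0\in\mathbf Q$, $P_0\in B_n^+$, such that whenever $P=A_0'P_0'$ with $A_0'\in\mathbf Q$, $P_0'\in B_n^+$ one has $A_0'\le A_0$. Normal form: every $W\in B_n$ is uniquely $W=\mathbf D^uA_1A_2\cdots A_k$ with $u\in\mathbb Z$, $k\ge 0$, $A_i\in\mathbf Q^\star$, and each product $A_iA_{i+1}$ ($1\le i\le k-1$) left-greedy. Put $\inf(W)=u$, $\sup(W)=u+k$. For $k\ge1$, $\mathbf c(W)=\mathbf D^uA_2A_3\cdots A_k\tau^{-u}(A_1)$ (cycling) and $\mathbf d(W)=\mathbf D^u\tau^u(A_k)A_1\cdots A_{k-1}$ (decycling); for $k=0$, $\mathbf c(W)=\mathbf d(W)=W$. $\mathbf c^m,\mathbf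 d^m$ denote $m$-fold iterates (the result being put in normal form before each repetition). *)

theory Defs
  imports "HOL-Algebra.Group" "HOL-Algebra.Bij"
begin

section \<open>Monoids and groups given by generators and relations\<close>

inductive word_eq :: "'a set \<Rightarrow> ('a list \<times> 'a list) set \<Rightarrow> 'a list \<Rightarrow> 'a list \<Rightarrow> bool"
  for X R where
  rel: "(u, v) \<in> R \<Longrightarrow> x \<in> lists X \<Longrightarrow> y \<in> lists X \<Longrightarrow> word_eq X R (x @ u @ y) (x @ v @ y)"
| refl: "w \<in> lists X \<Longrightarrow> word_eq X R w w"
| sym: "word_eq X R v w \<Longrightarrow> word_eq X R w v"
| trans: "word_eq X R u v \<Longrightarrow> word_eq X R v w \<Longrightarrow> word_eq X R u w"

definition word_class :: "'a set \<Rightarrow> ('a list \<times> 'a list) set \<Rightarrow> 'a list \<Rightarrow> 'a list set" where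
  "word_class X R w = {v. word_eq X R w v}"

definition presented_monoid :: "'a set \<Rightarrow> ('a list \<times> 'a list) set \<Rightarrow> 'a list set monoid" where
  "presented_monoid X R =
    \<lparr>carrier = word_class X R ` lists X,
     mult = (\<lambda>P Q. \<Union>u\<in>P. \<Union>v\<in>Q. word_class X R (u @ v)),
     one = word_class X R []\<rparr>"

text \<open>A group presentation is a monoid presentation over signed letters: \<open>(x, True)\<close> stands for
  the generator \<open>x\<close> and \<open>(x, False)\<close> for its inverse.\<close>

definition positive_word :: "'a list \<Rightarrow> ('a \<times> bool) list" where
  "positive_word w = map (\<lambda>x. (x, True)) w"

definition signed_rels :: "'a set \<Rightarrow> ('a list \<times> 'a list) set
    \<Rightarrow> (('a \<times> bool) list \<times> ('a \<times> bool) list) set" where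
  "signed_rels X R = {(positive_word u, positive_word v) | u v. (u, v) \<in> R}
     \<union> {([(x, b), (x, \<not> b)], []) | x b. x \<in> X}"

definition presented_group :: "'a set \<Rightarrow> ('a list \<times> 'a list) set \<Rightarrow> ('a \<times> bool) list set monoid" where
  "presented_group X R = presented_monoid (X \<times> UNIV) (signed_rels X R)"

definition monoid_to_group :: "'a set \<Rightarrow> ('a list \<times> 'a list) set
    \<Rightarrow> 'a list set \<Rightarrow> ('a \<times> bool) list set" where
  "monoid_to_group X R P =
    (\<Union>w\<in>P. word_class (X \<times> UNIV) (signed_rels X R) (positive_word w))"


section \<open>The two presentations of the braid group\<close>

datatype presentation = Old | New

text \<open>\<open>Sigma i\<close> is the Artin generator \<open>\<sigma>\<^sub>i\<close>, and \<open>Band t s\<close> is the band generator \<open>a\<^sub>t\<^sub>s\<close>.\<close>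

datatype gen = Sigma nat | Band nat nat

fun gens :: "presentation \<Rightarrow> nat \<Rightarrow> gen set" where
  "gens Old n = {Sigma i | i. 1 \<le> i \<and> i \<le> n - 1}"
| "gens New n = {Band t s | t s. n \<ge> t \<and> t > s \<and> s \<ge> 1}"

fun rels :: "presentation \<Rightarrow> nat \<Rightarrow> (gen list \<times> gen list) set" where
  "rels Old n =
     {([Sigma i, Sigma j], [Sigma j, Sigma i]) | i j.
        i \<in> {1..n - 1} \<and> j \<in> {1..n - 1} \<and> \<bar>int i - int j\<bar> > 1}
   \<union> {([Sigma i, Sigma j, Sigma i], [Sigma j, Sigma i, Sigma j]) | i j.
        i \<in> {1..n - 1} \<and> j \<in> {1..n - 1} \<and> \<bar>int i - int j\<bar> = 1}"
| "rels New n =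
     {([Band t s, Band r q], [Band r q, Band t s]) | t s r q.
        n \<ge> t \<and> t > s \<and> s \<ge> 1 \<and> n \<ge> r \<and> r > q \<and> q \<ge> 1 \<and>
        (int t - int r) * (int t - int q) * (int s - int r) * (int s - int q) > 0}
   \<union> {([Band t s, Band s r], [Band t r, Band t s]) | t s r. n \<ge> t \<and> t > s \<and> s > r \<and> r \<ge> 1}
   \<union> {([Band t r, Band t s], [Band s r, Band t r]) | t s r. n \<ge> t \<and> t > s \<and> s > r \<and> r \<ge> 1}"

definition braid_monoid :: "presentation \<Rightarrow> nat \<Rightarrow> gen list set monoid" where
  "braid_monoid p n = presented_monoid (gens p n) (rels p n)"

type_synonym braid = "(gen \<times> bool) list set"

definition braid_group :: "presentation \<Rightarrow> nat \<Rightarrow> braid monoid" where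
  "braid_group p n = presented_group (gens p n) (rels p n)"

definition positive_braids :: "presentation \<Rightarrow> nat \<Rightarrow> braid set" where
  "positive_braids p n = monoid_to_group (gens p n) (rels p n) ` carrier (braid_monoid p n)"

definition braid_of_word :: "presentation \<Rightarrow> nat \<Rightarrow> gen list \<Rightarrow> braid" where
  "braid_of_word p n w =
     monoid_to_group (gens p n) (rels p n) (word_class (gens p n) (rels p n) w)"

definition braid_length :: "presentation \<Rightarrow> nat \<Rightarrow> braid \<Rightarrow> nat" where
  "braid_length p n P = (THE l. \<exists>w \<in> lists (gens p n). braid_of_word p n w = P \<and> length w = l)"


section \<open>The fundamental braid and the normal form\<close>

text \<open>\<open>(\<sigma>\<^sub>1 \<dots> \<sigma>\<^bsub>n-1\<^esub>)(\<sigma>\<^sub>1 \<dots> \<sigma>\<^bsub>n-2\<^esub>) \<dots> (\<sigma>\<^sub>1 \<sigma>\<^sub>2) \<sigma>\<^sub>1\<close>, respectively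
  \<open>a\<^bsub>n(n-1)\<^esub> a\<^bsub>(n-1)(n-2)\<^esub> \<dots> a\<^bsub>21\<^esub>\<close>.\<close>

fun fundamental_word :: "presentation \<Rightarrow> nat \<Rightarrow> gen list" where
  "fundamental_word Old n = concat (map (\<lambda>k. map Sigma [1..<Suc k]) (rev [1..<n]))"
| "fundamental_word New n = map (\<lambda>k. Band (Suc k) k) (rev [1..<n])"

definition fundamental_braid :: "presentation \<Rightarrow> nat \<Rightarrow> braid" where
  "fundamental_braid p n = braid_of_word p n (fundamental_word p n)"

text \<open>The equation \<open>a D = D \<tau>(a)\<close> determines \<open>\<tau>(a)\<close> as the following conjugate.\<close>

definition tau :: "presentation \<Rightarrow> nat \<Rightarrow> braid \<Rightarrow> braid" where
  "tau p n = (let G = braid_group p n; D = fundamental_braid p n in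
     (\<lambda>a \<in> carrier G. inv\<^bsub>G\<^esub> D \<otimes>\<^bsub>G\<^esub> a \<otimes>\<^bsub>G\<^esub> D))"

definition tau_pow :: "presentation \<Rightarrow> nat \<Rightarrow> int \<Rightarrow> braid \<Rightarrow> braid" where
  "tau_pow p n u = tau p n [^]\<^bsub>AutoGroup (braid_group p n)\<^esub> u"

definition braid_le :: "presentation \<Rightarrow> nat \<Rightarrow> braid \<Rightarrow> braid \<Rightarrow> bool" where
  "braid_le p n W V \<longleftrightarrow> (\<exists>P \<in> positive_braids p n. V = W \<otimes>\<^bsub>braid_group p n\<^esub> P)"

definition canonical_factors :: "presentation \<Rightarrow> nat \<Rightarrow> braid set" where
  "canonical_factors p n = {A \<in> positive_braids p n.
     \<exists>B \<in> positive_braids p n. fundamental_braid p n = A \<otimes>\<^bsub>braid_group p n\<^esub> B}"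

definition proper_factors :: "presentation \<Rightarrow> nat \<Rightarrow> braid set" where
  "proper_factors p n = canonical_factors p n - {\<one>\<^bsub>braid_group p n\<^esub>, fundamental_braid p n}"

text \<open>\<open>left_greedy p n A P\<close>: the product \<open>A P\<close> is the left-greedy decomposition of its value.\<close>

definition left_greedy :: "presentation \<Rightarrow> nat \<Rightarrow> braid \<Rightarrow> braid \<Rightarrow> bool" where
  "left_greedy p n A P \<longleftrightarrow>
     A \<in> canonical_factors p n \<and> P \<in> positive_braids p n \<and>
     (\<forall>A' \<in> canonical_factors p n. \<forall>P' \<in> positive_braids p n.
        A \<otimes>\<^bsub>braid_group p n\<^esub> P = A' \<otimes>\<^bsub>braid_group p n\<^esub> P' \<longrightarrow> braid_le p n A' A)"

definition braid_prod :: "presentation \<Rightarrow> nat \<Rightarrow> braid list \<Rightarrow> braid" where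
  "braid_prod p n As = foldr (mult (braid_group p n)) As \<one>\<^bsub>braid_group p n\<^esub>"

definition is_normal_form :: "presentation \<Rightarrow> nat \<Rightarrow> braid \<Rightarrow> int \<times> braid list \<Rightarrow> bool" where
  "is_normal_form p n W = (\<lambda>(u, As).
     W = fundamental_braid p n [^]\<^bsub>braid_group p n\<^esub> u \<otimes>\<^bsub>braid_group p n\<^esub> braid_prod p n As \<and>
     set As \<subseteq> proper_factors p n \<and>
     (\<forall>i. Suc i < length As \<longrightarrow> left_greedy p n (As ! i) (As ! Suc i)))"

definition normal_form :: "presentation \<Rightarrow> nat \<Rightarrow> braid \<Rightarrow> int \<times> braid list" where
  "normal_form p n W = (THE uAs. is_normal_form p n W uAs)"

definition braid_inf :: "presentation \<Rightarrow> nat \<Rightarrow> braid \<Rightarrow> int" where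
  "braid_inf p n W = fst (normal_form p n W)"

definition braid_sup :: "presentation \<Rightarrow> nat \<Rightarrow> braid \<Rightarrow> int" where
  "braid_sup p n W = fst (normal_form p n W) + int (length (snd (normal_form p n W)))"


section \<open>Cycling, decycling and conjugacy\<close>

definition cycling :: "presentation \<Rightarrow> nat \<Rightarrow> braid \<Rightarrow> braid" where
  "cycling p n W = (let (u, As) = normal_form p n W in
     if As = [] then W
     else fundamental_braid p n [^]\<^bsub>braid_group p n\<^esub> u
            \<otimes>\<^bsub>braid_group p n\<^esub> braid_prod p n (tl As @ [tau_pow p n (- u) (hd As)]))"

definition decycling :: "presentation \<Rightarrow> nat \<Rightarrow> braid \<Rightarrow> braid" where
  "decycling p n W = (let (u, As) = normal_form p n W in
     if As = [] then W
     else fundamental_braid p n [^]\<^bsub>braid_group p n\<^esub> u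
            \<otimes>\<^bsub>braid_group p n\<^esub> braid_prod p n (tau_pow p n u (last As) # butlast As))"

definition conj_class :: "presentation \<Rightarrow> nat \<Rightarrow> braid \<Rightarrow> braid set" where
  "conj_class p n W = {g \<otimes>\<^bsub>braid_group p n\<^esub> W \<otimes>\<^bsub>braid_group p n\<^esub> inv\<^bsub>braid_group p n\<^esub> g | g.
     g \<in> carrier (braid_group p n)}"

end

theory Submission
  imports Defs "HOL-Combinatorics.Transposition"
begin

text \<open>Both presentations are treated through one criterion. Let \<open>u = inf W\<close> and suppose that some
  conjugate \<open>V = K W K\<^sup>-\<^sup>1\<close> with \<open>K\<close> positive satisfies \<open>D\<^bsup>u+1\<^esup> \<le> V\<close>; choose \<open>K\<close> of minimal length. If \<open>Z\<^sub>l\<close> is the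
  product of the conjugators of the first \<open>l\<close> cyclings, then \<open>K\<^sub>l = K Z\<^sub>l D\<^bsup>-l\<^esup>\<close> satisfies
  \<open>K\<^bsub>l+1\<^esub> = K\<^sub>l \<and> V K\<^sub>l D\<^bsup>-u-1\<^esup>\<close>. The heads \<open>D \<and> K\<^sub>l\<close> obey the same recursion on their own, so they decrease
  strictly until they are stationary, and by minimality of \<open>K\<close> the stationary value is \<open>1\<close>. Since
  \<open>D \<and> K \<noteq> D\<close>, this takes at most \<open>|D| - 1\<close> steps, and \<open>K\<^sub>l = 1\<close> means that \<open>l\<close> cyclings have raised the
  infimum. Decycling is cycling of the inverse up to conjugation by \<open>D\<close>.

  The lattice structure needed for this comes from a permutation model in which the divisors of \<open>D\<close>
  are permutations (all of them, respectively the noncrossing ones): there two generators dividing an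
  element have an explicit common multiple dividing it. The passage from divisors of \<open>D\<close> to all
  positive elements of the group uses an action of the group on infinite normal forms.\<close>

section \<open>Groups as a type class, and the group of bijections of a type\<close>

text \<open>The heads obey the same recursion because \<open>V D^(-u-1)\<close> is positive, so that
  \<open>V D D^(-u-1)\<close> is a multiple of \<open>D\<close>; hence meeting with \<open>D\<close>
  commutes with a step. A stationary value \<open>F\<close> divides \<open>K\<close>, say
  \<open>K = F K'\<close>, and \<open>F^(-1) V F\<close> is still above \<open>D^(u+1)\<close>. Thus
  \<open>K'\<close> is as good a conjugator as \<open>K\<close>, and minimality leaves only
  \<open>F = 1\<close>.

  The obstacle is that equality of positive words means equality in the group: a derivation may pass
  through negative letters, and no embedding of the monoid is assumed. Whatever is inferred from
  such an equality therefore comes from a map defined on the whole group: the exponent sum for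
  lengths, permutations for reduced words, and bijections of infinite normal forms for heads. The
  last one is what produces gcds beyond the divisors of \<open>D\<close>. The two presentations
  differ only in the length function on permutations (inversions, or \<open>n\<close> minus the
  number of cycles) and in the set of permutations below \<open>D\<close>.\<close>

class mult_group = monoid_mult + inverse +
  assumes left_inv: "inverse a * a = 1"
begin

sublocale grp: Groups.group times 1 inverse
  by unfold_locales (simp_all add: left_inv)

lemma right_inv: "a * inverse a = 1"
  by (rule grp.right_inverse)

lemma inv_cancel: "inverse a * (a * b) = b" "a * (inverse a * b) = b"
  by (simp_all add: mult.assoc[symmetric] left_inv right_inv)

lemma inv_mult: "inverse (a * b) = inverse b * inverse a"
  by (rule grp.inverse_distrib_swap)

lemmas grp_simps = mult.assoc left_inv right_inv inv_cancel inv_mult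
  grp.inverse_inverse grp.inverse_neutral

lemma mult_left_cancel': "a * b = a * c \<longleftrightarrow> b = c"
  by (rule grp.left_cancel)

lemma mult_right_cancel': "b * a = c * a \<longleftrightarrow> b = c"
  by (rule grp.right_cancel)

lemma inverse_unique': "a * b = 1 \<Longrightarrow> inverse a = b"
  by (rule grp.inverse_unique)

end

definition zpow :: "'a::mult_group \<Rightarrow> int \<Rightarrow> 'a" where
  "zpow x k = (if k \<ge> 0 then x ^ nat k else inverse x ^ nat (- k))"

lemma zpow_0 [simp]: "zpow x 0 = 1"
  and zpow_1 [simp]: "zpow x 1 = x"
  by (simp_all add: zpow_def)

lemma zpow_Suc: "zpow x (k + 1) = x * zpow x k"
proof (cases k)
  case (nonneg m)
  then have "nat (k + 1) = Suc m" by simp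
  then show ?thesis using nonneg by (simp add: zpow_def)
next
  case (neg m)
  then have "nat (- k) = Suc m" "nat (- (k + 1)) = m" "\<not> k \<ge> 0"
    by simp_all
  then show ?thesis
    by (cases m) (auto simp: zpow_def inv_cancel right_inv)
qed

lemma zpow_Suc': "x * zpow x k = zpow x (1 + k)"
  by (metis zpow_Suc add.commute)

lemma zpow_pred: "zpow x (k - 1) = inverse x * zpow x k"
  using zpow_Suc[of x "k - 1"] by (simp add: grp_simps)

lemma zpow_add: "zpow x (j + k) = zpow x j * zpow x k"
proof (induction j rule: int_induct[where k = 0])
  case (step1 i)
  have "zpow x (i + 1 + k) = x * zpow x (i + k)"
    using zpow_Suc[of x "i + k"] by (simp add: algebra_simps)
  then show ?case using step1 by (simp add: zpow_Suc mult.assoc)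
next
  case (step2 i)
  have "zpow x (i - 1 + k) = inverse x * zpow x (i + k)"
    using zpow_pred[of x "i + k"] by (simp add: algebra_simps)
  then show ?case using step2 by (simp add: zpow_pred mult.assoc)
qed simp

lemma zpow_minus: "zpow x (- k) = inverse (zpow x k)"
proof -
  have "zpow x k * zpow x (- k) = 1"
    by (simp flip: zpow_add)
  then show ?thesis by (metis inverse_unique')
qed

lemma zpow_cancel [simp]: "zpow x j * zpow x k = zpow x (j + k)" 
  "zpow x j * (zpow x k * y) = zpow x (j + k) * y"
  by (simp_all add: zpow_add mult.assoc)

lemma zpow_comm: "x * zpow x k = zpow x k * x" "x * (zpow x k * y) = zpow x k * (x * y)"
  using zpow_add[of x 1 k] zpow_add[of x k 1] by (simp_all add: add.commute flip: mult.assoc)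

lemma zpow_minus_1: "zpow x (- 1) = inverse x"
  using zpow_minus[of x 1] by simp

text \<open>A single group type serves three ends: the permutation model, the action on infinite
  normal forms, and the regular representation, which moves the braid group from a carrier set into
  a type.\<close>

typedef 'a bij = "{f :: 'a \<Rightarrow> 'a. bij f}" morphisms app mk_bij
  by (rule exI[of _ id]) simp

setup_lifting type_definition_bij

instantiation bij :: (type) mult_group
begin
lift_definition one_bij :: "'a bij" is id by simp
lift_definition times_bij :: "'a bij \<Rightarrow> 'a bij \<Rightarrow> 'a bij" is "\<lambda>f g. f \<circ> g"
  by (rule bij_comp)
lift_definition inverse_bij :: "'a bij \<Rightarrow> 'a bij" is "\<lambda>f. inv_into UNIV f"
  by (rule bij_imp_bij_inv)
definition divide_bij :: "'a bij \<Rightarrow> 'a bij \<Rightarrow> 'a bij" where "divide_bij a b = a * inverse b"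
instance
proof
  fix a b c :: "'a bij"
  show "a * b * c = a * (b * c)" by transfer (simp add: o_assoc)
  show "1 * a = a" by transfer simp
  show "a * 1 = a" by transfer simp
  show "inverse a * a = 1" by transfer (simp add: bij_is_inj)
qed
end

lemma app_1 [simp]: "app 1 x = x"
  by transfer simp

lemma app_mult [simp]: "app (f * g) x = app f (app g x)"
  by transfer simp

lemma app_inverse [simp]: "app (inverse f) (app f x) = x" "app f (app (inverse f) x) = x"
  by (simp_all flip: app_mult add: left_inv right_inv)

lemma app_inj [simp]: "app f x = app f y \<longleftrightarrow> x = y"
  by (metis app_inverse(1))

lemma app_inverse_eq: "app (inverse f) x = y \<longleftrightarrow> x = app f y"
  by (metis app_inverse)

lemma bij_eqI: "(\<And>x. app f x = app g x) \<Longrightarrow> f = g"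
  by (metis app_inject ext)

lemma app_mk_bij: "bij f \<Longrightarrow> app (mk_bij f) = f"
  by (simp add: mk_bij_inverse)

section \<open>Evaluation of words\<close>

definition weval :: "('a \<Rightarrow> 'g::monoid_mult) \<Rightarrow> 'a list \<Rightarrow> 'g" where
  "weval f w = prod_list (map f w)"

lemma weval_simps [simp]:
  "weval f [] = 1" "weval f (a # w) = f a * weval f w"
  by (simp_all add: weval_def)

lemma weval_append [simp]: "weval f (v @ w) = weval f v * weval f w"
  by (simp add: weval_def)

lemma positive_word_lists: "w \<in> lists X \<Longrightarrow> positive_word w \<in> lists (X \<times> UNIV)"
  by (auto simp: positive_word_def)

definition sgn_ext :: "('a \<Rightarrow> 'g::mult_group) \<Rightarrow> 'a \<times> bool \<Rightarrow> 'g" where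
  "sgn_ext f x = (if snd x then f (fst x) else inverse (f (fst x)))"

lemma weval_sgn_positive [simp]: "weval (sgn_ext f) (positive_word w) = weval f w"
  by (induction w) (simp_all add: positive_word_def sgn_ext_def)

lemma word_eq_weval:
  assumes "word_eq Y S v w" and "\<And>v w. (v, w) \<in> S \<Longrightarrow> weval f v = weval f w"
  shows "weval f v = weval f w"
  using assms(1) by induction (simp_all add: assms(2))

text \<open>The universal property of the presented group. Only the positive relations have to be
  checked, as cancelling pairs are trivial in any group. It yields the permutation of a braid and
  later the action on infinite normal forms.\<close>

lemma signed_word_eq_weval:
  fixes f :: "'a \<Rightarrow> 'g::mult_group"
  assumes "word_eq (X \<times> UNIV) (signed_rels X R) v w"
    and "\<And>v w. (v, w) \<in> R \<Longrightarrow> weval f v = weval f w"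
  shows "weval (sgn_ext f) v = weval (sgn_ext f) w"
proof (rule word_eq_weval[OF assms(1)])
  fix v w assume "(v, w) \<in> signed_rels X R"
  then show "weval (sgn_ext f) v = weval (sgn_ext f) w"
    by (auto simp: signed_rels_def assms(2)) (auto simp: sgn_ext_def grp_simps)
qed

text \<open>The exponent sum is a length that survives negative letters. It makes the length of a
  positive element well defined.\<close>

definition expsum :: "('a \<times> bool) list \<Rightarrow> int" where
  "expsum w = sum_list (map (\<lambda>x. if snd x then 1 else - 1) w)"

lemma expsum_simps [simp]:
  "expsum [] = 0" "expsum (x # w) = (if snd x then 1 else - 1) + expsum w"
  "expsum (v @ w) = expsum v + expsum w"
  by (simp_all add: expsum_def)

lemma expsum_positive [simp]: "expsum (positive_word w) = int (length w)"
  by (induction w) (simp_all add: positive_word_def)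

lemma signed_word_eq_expsum:
  assumes "word_eq (X \<times> UNIV) (signed_rels X R) v w"
    and "\<And>v w. (v, w) \<in> R \<Longrightarrow> length v = length w"
  shows "expsum v = expsum w"
  using assms(1)
proof induction
  case (rel u v x y)
  then show ?case by (auto simp: signed_rels_def assms(2))
qed simp_all

section \<open>Garside groups\<close>

text \<open>What can be said before greatest common divisors are available: \<open>germ\<close>
  starts from here in order to construct them, \<open>garside\<close> assumes them. The last two
  axioms say that \<open>D\<close> normalizes \<open>P\<close>.\<close>

locale positive_cone =
  fixes P :: "'g::mult_group set" and D :: 'g and len :: "'g \<Rightarrow> nat"
  assumes one_P [simp, intro]: "1 \<in> P"
    and mult_P [simp, intro]: "x \<in> P \<Longrightarrow> y \<in> P \<Longrightarrow> x * y \<in> P"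
    and len_mult: "x \<in> P \<Longrightarrow> y \<in> P \<Longrightarrow> len (x * y) = len x + len y"
    and len_0: "x \<in> P \<Longrightarrow> len x = 0 \<Longrightarrow> x = 1"
    and D_P [simp, intro]: "D \<in> P"
    and conj_D: "x \<in> P \<Longrightarrow> D * x * inverse D \<in> P"
    and conj_D': "x \<in> P \<Longrightarrow> inverse D * x * D \<in> P"
begin

section \<open>Left divisibility and powers of \<open>D\<close>\<close>

definition le :: "'g \<Rightarrow> 'g \<Rightarrow> bool" (infix "\<preceq>" 50) where
  "x \<preceq> y \<longleftrightarrow> inverse x * y \<in> P"

abbreviation "Dp k \<equiv> zpow D k"

definition simples :: "'g set" where
  "simples = {x \<in> P. x \<preceq> D}"

lemma simplesD: "x \<in> simples \<Longrightarrow> x \<in> P" "x \<in> simples \<Longrightarrow> x \<preceq> D"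
  by (auto simp: simples_def)

lemma len_1 [simp]: "len 1 = 0"
  using len_mult[of 1 1] by simp

lemma le_refl [simp, intro]: "x \<preceq> x"
  by (simp add: le_def left_inv)

lemma le_trans [trans]: "x \<preceq> y \<Longrightarrow> y \<preceq> z \<Longrightarrow> x \<preceq> z"
  unfolding le_def using mult_P[of "inverse x * y" "inverse y * z"] by (simp add: grp_simps)

lemma P_antisym: "x \<in> P \<Longrightarrow> inverse x \<in> P \<Longrightarrow> x = 1"
  using len_mult[of x "inverse x"] len_0[of x] by (simp add: grp_simps)

lemma le_antisym: "x \<preceq> y \<Longrightarrow> y \<preceq> x \<Longrightarrow> x = y"
proof -
  assume a: "x \<preceq> y" "y \<preceq> x"
  have "inverse x * y = 1"
    by (rule P_antisym) (use a in \<open>simp_all add: le_def grp_simps\<close>)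
  then show "x = y"
    by (metis inv_cancel(2) mult_1_right)
qed

lemma le_left [simp]: "z * x \<preceq> z * y \<longleftrightarrow> x \<preceq> y"
  by (simp add: le_def grp_simps)

lemma le_1 [simp]: "1 \<preceq> x \<longleftrightarrow> x \<in> P"
  by (simp add: le_def)

lemma le_mult [simp]: "x \<preceq> x * y \<longleftrightarrow> y \<in> P"
  by (simp add: le_def grp_simps)

lemma le_mult_trans: "x \<preceq> y \<Longrightarrow> z \<in> P \<Longrightarrow> x \<preceq> y * z"
  by (meson le_mult le_trans)

lemma leE: assumes "x \<preceq> y" obtains z where "z \<in> P" "y = x * z"
  using assms by (metis le_def inv_cancel(2))

lemma len_le: "x \<in> P \<Longrightarrow> x \<preceq> y \<Longrightarrow> len x \<le> len y"
  by (metis leE le_add1 len_mult)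

lemma len_eq: "x \<in> P \<Longrightarrow> x \<preceq> y \<Longrightarrow> len x = len y \<Longrightarrow> x = y"
  by (metis leE add_cancel_right_right len_0 len_mult mult_1_right)

lemma conj_Dp_imp: "x \<in> P \<Longrightarrow> Dp k * x * Dp (- k) \<in> P"
proof (induction k rule: int_induct[where k = 0])
  case (step1 i)
  have "Dp (- (i + 1)) = Dp (- i) * inverse D"
    using zpow_add[of D "- i" "- 1"] by (simp add: zpow_minus_1)
  then have "Dp (i + 1) * x * Dp (- (i + 1)) = D * (Dp i * x * Dp (- i)) * inverse D"
    by (simp only: zpow_Suc mult.assoc)
  then show ?case using step1 conj_D by simp
next
  case (step2 i)
  have "Dp (- (i - 1)) = Dp (- i) * D"
    using zpow_add[of D "- i" "1"] by simp
  then have "Dp (i - 1) * x * Dp (- (i - 1)) = inverse D * (Dp i * x * Dp (- i)) * D"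
    by (simp only: zpow_pred mult.assoc)
  then show ?case using step2 conj_D' by simp
qed simp

lemma conj_Dp: "Dp k * x * Dp (- k) \<in> P \<longleftrightarrow> x \<in> P"
proof
  assume "Dp k * x * Dp (- k) \<in> P"
  from conj_Dp_imp[OF this, of "- k"] show "x \<in> P"
    by (simp add: grp_simps)
qed (rule conj_Dp_imp)

lemma conj_Dp' [simp]: "Dp k * (x * Dp (- k)) \<in> P \<longleftrightarrow> x \<in> P" 
  "Dp (- k) * (x * Dp k) \<in> P \<longleftrightarrow> x \<in> P"
  using conj_Dp[of k x] conj_Dp[of "- k" x] by (simp_all add: mult.assoc)

lemma Dp_mult_comm: "x * Dp k \<in> P \<longleftrightarrow> Dp k * x \<in> P"
  using conj_Dp'(1)[of k "x * Dp k"] by (simp add: grp_simps)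

lemma le_right [simp]: "x * Dp k \<preceq> y * Dp k \<longleftrightarrow> x \<preceq> y"
  using conj_Dp'(2)[of k "inverse x * y"] by (simp add: le_def inv_mult mult.assoc zpow_minus[symmetric])

lemma Dp_P: "k \<ge> 0 \<Longrightarrow> Dp k \<in> P"
proof (induction k rule: int_ge_induct)
  case (step i)
  then show ?case by (simp add: zpow_Suc)
qed simp

text \<open>\<open>p D = D (D^(-1) p D)\<close>, and the second factor is positive.\<close>

lemma D_le_mult_D: "p \<in> P \<Longrightarrow> D \<preceq> p * D"
  by (simp add: le_def conj_D' flip: mult.assoc)

lemma star_simple: assumes "x \<in> simples" shows "inverse x * D \<in> simples"
  using assms conj_D'[of x] by (auto simp: simples_def le_def grp_simps)

lemma conj_simple: assumes "x \<in> simples" shows "Dp k * x * Dp (- k) \<in> simples"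
proof -
  have "Dp k * x * Dp (- k) \<preceq> Dp k * D * Dp (- k)"
    using simplesD[OF assms] by simp
  also have "Dp k * D * Dp (- k) = D"
    by (simp flip: zpow_comm add: mult.assoc)
  finally show ?thesis using conj_Dp[of k x] simplesD[OF assms] by (auto simp: simples_def)
qed

text \<open>The left fractions \<open>D^(-k) p\<close>. The ambient type is in general larger than
  the group generated by \<open>P\<close> (it will consist of all bijections of some type), so meets
  can only be expected among these elements.\<close>

definition fractions :: "'g set" where
  "fractions = {g. \<exists>k\<ge>0. Dp k * g \<in> P}"

lemma P_fractions: "p \<in> P \<Longrightarrow> p \<in> fractions"
  by (auto simp: fractions_def intro: exI[of _ 0])

lemma fractions_ge: assumes "g \<in> fractions"
  obtains k where "k \<ge> 0" "\<And>j. j \<ge> k \<Longrightarrow> Dp j * g \<in> P"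
proof -
  from assms obtain k where k: "k \<ge> 0" "Dp k * g \<in> P" by (auto simp: fractions_def)
  have "Dp j * g \<in> P" if "j \<ge> k" for j
    using mult_P[OF Dp_P[of "j - k"] k(2)] that by simp
  with k that show ?thesis by blast
qed

lemma mult_fractions [simp]: assumes "g \<in> fractions" "h \<in> fractions" shows "g * h \<in> fractions"
proof -
  obtain j k where j: "j \<ge> 0" "Dp j * g \<in> P" and k: "k \<ge> 0" "Dp k * h \<in> P"
    using assms by (auto simp: fractions_def)
  have "(Dp k * (Dp j * g) * Dp (- k)) * (Dp k * h) \<in> P"
    by (rule mult_P[OF conj_Dp_imp[OF j(2)] k(2)])
  then have "Dp (k + j) * (g * h) \<in> P" by (simp add: mult.assoc)
  then show ?thesis using j k unfolding fractions_def by (intro CollectI exI[of _ "k + j"]) auto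
qed

lemma Dp_fractions [simp]: "Dp k \<in> fractions"
  unfolding fractions_def by (intro CollectI exI[of _ "\<bar>k\<bar>"]) (auto intro: Dp_P)

lemma D_fractions [simp]: "D \<in> fractions"
  using Dp_fractions[of 1] by simp

end

locale garside = positive_cone P D len
  for P :: "'g::mult_group set" and D :: 'g and len :: "'g \<Rightarrow> nat" +
  assumes D_neq_1: "D \<noteq> 1"
    and le_Dp: "x \<in> P \<Longrightarrow> \<exists>k. x \<preceq> zpow D k"
    and ex_gcd: "x \<in> P \<Longrightarrow> y \<in> P \<Longrightarrow> \<exists>d\<in>P. \<forall>z\<in>P. z \<preceq> d \<longleftrightarrow> z \<preceq> x \<and> z \<preceq> y"
begin

lemma inverse_fractions [simp]: assumes "g \<in> fractions" shows "inverse g \<in> fractions"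
proof -
  obtain k where k: "Dp k * g \<in> P" using assms by (auto simp: fractions_def)
  obtain m where "Dp k * g \<preceq> Dp m" using le_Dp[OF k] by blast
  then have "inverse g * Dp (m - k) \<in> P" by (simp add: le_def grp_simps flip: zpow_minus)
  then have "inverse g * Dp (m - k) * Dp (- (m - k)) \<in> fractions"
    using P_fractions mult_fractions Dp_fractions by blast
  then show ?thesis by (simp add: mult.assoc)
qed

text \<open>\<open>c\<close> is a common divisor of \<open>c x\<close> and \<open>c y\<close>, so it
  divides their gcd; cancelling it leaves a common divisor of \<open>x\<close> and
  \<open>y\<close>.\<close>

lemma gcd_scale:
  assumes "x \<in> P" "y \<in> P" "c \<in> P" and d: "d \<in> P" "\<forall>z\<in>P. z \<preceq> d \<longleftrightarrow> z \<preceq> x \<and> z \<preceq> y"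
  shows "\<forall>z\<in>P. z \<preceq> c * d \<longleftrightarrow> z \<preceq> c * x \<and> z \<preceq> c * y"
proof -
  obtain e where e: "e \<in> P" "\<forall>z\<in>P. z \<preceq> e \<longleftrightarrow> z \<preceq> c * x \<and> z \<preceq> c * y"
    using ex_gcd[of "c * x" "c * y"] assms by auto
  have "c \<preceq> e" using e assms by simp
  then obtain f where f: "f \<in> P" "e = c * f" by (elim leE)
  have "f \<preceq> x \<and> f \<preceq> y" using e f by (metis le_left le_refl)
  then have "e \<preceq> c * d" using f d by simp
  moreover have "c * d \<preceq> e" using e assms by (metis le_left le_refl mult_P)
  ultimately show ?thesis using e le_antisym by blast
qed

lemma ex_meet:
  assumes "x \<in> fractions" "y \<in> fractions"
  shows "\<exists>d\<in>fractions. \<forall>z\<in>fractions. z \<preceq> d \<longleftrightarrow> z \<preceq> x \<and> z \<preceq> y"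
proof -
  obtain k where k: "k \<ge> 0" "Dp k * x \<in> P" "Dp k * y \<in> P"
    using assms by (meson fractions_ge max.cobounded1 max.cobounded2 le_max_iff_disj)
  obtain d where d: "d \<in> P" "\<forall>z\<in>P. z \<preceq> d \<longleftrightarrow> z \<preceq> Dp k * x \<and> z \<preceq> Dp k * y"
    using ex_gcd[OF k(2,3)] by blast
  have "z \<preceq> Dp (- k) * d \<longleftrightarrow> z \<preceq> x \<and> z \<preceq> y" if z: "z \<in> fractions" for z
  proof -
    \<comment> \<open>\<open>D^k z\<close> need not be positive, so a further factor
      \<open>D^i\<close> is put in front; by \<open>gcd_scale\<close> the gcd property of
      \<open>d\<close> survives this.\<close>
    obtain i where i: "i \<ge> 0" "\<And>j. j \<ge> i \<Longrightarrow> Dp j * z \<in> P" using fractions_ge[OF z] by blast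
    define j where "j = i + k"
    have "\<forall>w\<in>P. w \<preceq> Dp i * d \<longleftrightarrow> w \<preceq> Dp i * (Dp k * x) \<and> w \<preceq> Dp i * (Dp k * y)"
      by (rule gcd_scale) (use k d i Dp_P in auto)
    then have "Dp (i + k) * z \<preceq> Dp i * d \<longleftrightarrow> Dp (i + k) * z \<preceq> Dp (i + k) * x \<and> Dp (i + k) * z \<preceq> Dp (i + k) * y"
      using i k by simp
    moreover have "Dp i * d = Dp (i + k) * (Dp (- k) * d)" by simp
    ultimately show ?thesis by (simp only: le_left)
  qed
  moreover have "Dp (- k) * d \<in> fractions" using P_fractions[OF d(1)] by simp
  ultimately show ?thesis by blast
qed

section \<open>Meets of fractions and heads of positive elements\<close>

definition meet :: "'g \<Rightarrow> 'g \<Rightarrow> 'g" where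
  "meet x y = (SOME d. d \<in> fractions \<and> (\<forall>z\<in>fractions. z \<preceq> d \<longleftrightarrow> z \<preceq> x \<and> z \<preceq> y))"

lemma meet:
  assumes "x \<in> fractions" "y \<in> fractions"
  shows meet_fractions [simp]: "meet x y \<in> fractions"
    and le_meet: "z \<in> fractions \<Longrightarrow> z \<preceq> meet x y \<longleftrightarrow> z \<preceq> x \<and> z \<preceq> y"
  using someI_ex[of "\<lambda>d. d \<in> fractions \<and> (\<forall>z\<in>fractions. z \<preceq> d \<longleftrightarrow> z \<preceq> x \<and> z \<preceq> y)"]
    ex_meet[OF assms] unfolding meet_def by blast+

lemma meet_eqI:
  assumes "x \<in> fractions" "y \<in> fractions" "d \<in> fractions"
    and "\<And>z. z \<in> fractions \<Longrightarrow> z \<preceq> d \<longleftrightarrow> z \<preceq> x \<and> z \<preceq> y"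
  shows "meet x y = d"
  by (rule le_antisym) (metis assms le_refl meet_fractions le_meet)+

lemma meet_le:
  assumes "x \<in> fractions" "y \<in> fractions" shows "meet x y \<preceq> x" "meet x y \<preceq> y"
  using le_meet[OF assms meet_fractions[OF assms]] by auto

lemma meet_P: "x \<in> P \<Longrightarrow> y \<in> P \<Longrightarrow> meet x y \<in> P"
  using le_meet[of x y 1] P_fractions[of x] P_fractions[of y] P_fractions[OF one_P] by simp

lemma le_shift: "z \<preceq> c * x * Dp k \<longleftrightarrow> inverse c * z * Dp (- k) \<preceq> x"
  by (metis (no_types, lifting) inv_cancel(1) le_left le_right mult.assoc mult_1_right right_inv zpow_minus)

text \<open>Left translations and right multiplications by powers of \<open>D\<close> are both
  automorphisms of the order, the latter because \<open>D\<close> normalizes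
  \<open>P\<close>.\<close>

lemma meet_shift:
  assumes "x \<in> fractions" "y \<in> fractions" "c \<in> fractions"
  shows "meet (c * x * Dp k) (c * y * Dp k) = c * meet x y * Dp k"
  by (rule meet_eqI) (use assms in \<open>simp_all add: le_shift le_meet\<close>)

lemma meet_shift_left:
  assumes "x \<in> fractions" "y \<in> fractions" "c \<in> fractions"
  shows "meet (c * x) (c * y) = c * meet x y"
  using meet_shift[OF assms, of 0] by simp

lemma meet_absorb: "x \<in> fractions \<Longrightarrow> y \<in> fractions \<Longrightarrow> x \<preceq> y \<Longrightarrow> meet x y = x"
  by (rule meet_eqI) (auto intro: le_trans)

lemma meet_assoc:
  assumes "x \<in> fractions" "y \<in> fractions" "z \<in> fractions"
  shows "meet x (meet y z) = meet (meet x y) z"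
  by (rule meet_eqI) (use assms in \<open>simp_all add: le_meet\<close>)

lemma meet_comm:
  assumes "x \<in> fractions" "y \<in> fractions"
  shows "meet x y = meet y x"
  by (rule meet_eqI) (use assms in \<open>auto simp add: le_meet\<close>)

text \<open>Distributing \<open>p\<close> leaves \<open>D\<close>, \<open>p D\<close> and
  \<open>p q\<close> under the meet, and \<open>p D\<close> drops out as a multiple of
  \<open>D\<close>.\<close>

lemma head_mult:
  assumes "p \<in> P" "q \<in> P"
  shows "meet D (p * meet D q) = meet D (p * q)"
proof -
  have "meet D (p * meet D q) = meet D (meet (p * D) (p * q))"
    using assms P_fractions by (simp add: meet_shift_left)
  also have "\<dots> = meet D (p * q)"
    using assms P_fractions D_le_mult_D[of p] by (simp add: meet_assoc meet_absorb)
  finally show ?thesis .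
qed

lemma head_simple: "p \<in> P \<Longrightarrow> meet D p \<in> simples"
  using meet_P[of D p] meet_le[of D p] P_fractions[of p] by (simp add: simples_def)

text \<open>If \<open>p\<close> divides \<open>D^(j+1)\<close>, then it divides both
  \<open>D^j D\<close> and \<open>p D^j = D^j p'\<close>, hence \<open>D^j\<close> times the head of
  \<open>p'\<close>. As \<open>p'\<close> is a conjugate of \<open>p\<close> by a power of
  \<open>D\<close>, its head is \<open>1\<close> too, so \<open>p\<close> already divides
  \<open>D^j\<close>.\<close>

lemma head_eq_1: assumes "p \<in> P" "meet D p = 1" shows "p = 1"
proof -
  have *: "p \<preceq> Dp (int k) \<Longrightarrow> p = 1" for k
  proof (induction k)
    case 0
    then show ?case using assms by (simp add: le_antisym)
  next
    case (Suc k)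
    define j where "j = int k"
    define p' where "p' = Dp (- j) * p * Dp j"
    have fr: "p \<in> fractions" "p' \<in> fractions" using assms P_fractions by (simp_all add: p'_def)
    have "p * Dp j = Dp j * p'" by (simp add: p'_def mult.assoc)
    then have 1: "p \<preceq> Dp j * p'" using Dp_P[of j] by (metis j_def le_mult of_nat_0_le_iff)
    have "Dp (- j) * D * Dp j = D"
      by (simp add: mult.assoc flip: zpow_comm)
    then have "meet D p' = Dp (- j) * meet D p * Dp j"
      using meet_shift[of D p "Dp (- j)" j] fr by (simp add: p'_def)
    then have "meet D p' = 1" using assms by simp
    then have "meet (Dp j * D) (Dp j * p') = Dp j"
      using fr by (simp add: meet_shift_left)
    moreover have "p \<preceq> Dp j * D" using Suc.prems zpow_Suc[of D j] by (simp add: j_def add.commute zpow_comm)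
    ultimately have "p \<preceq> Dp j"
      using 1 fr by (metis D_fractions Dp_fractions le_meet mult_fractions)
    then show ?case using Suc.IH j_def by simp
  qed
  obtain k where k: "p \<preceq> Dp k" using le_Dp assms by blast
  \<comment> \<open>The exponent may be negative; enlarging it to \<open>nat k\<close> brings it
    into the range of the induction.\<close>
  have "p \<preceq> Dp k * Dp (int (nat k) - k)"
    by (rule le_mult_trans[OF k]) (simp add: Dp_P)
  then show ?thesis using *[of "nat k"] by simp
qed

section \<open>Raising the infimum\<close>

text \<open>Cycling without normal forms: when \<open>u\<close> is the infimum of \<open>W\<close>,
  the head of \<open>W D^(-u)\<close> is the first factor conjugated by \<open>D^u\<close>, which is
  the conjugator used by cycling (\<open>gcycling_eq\<close>). With \<open>u\<close> as a parameter
  it can be iterated at a fixed level.\<close>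

definition cyc :: "int \<Rightarrow> 'g \<Rightarrow> 'g" where
  "cyc u W = inverse (meet D (W * Dp (- u))) * W * meet D (W * Dp (- u))"

lemma cyc_fractions [simp]: "W \<in> fractions \<Longrightarrow> cyc u W \<in> fractions"
  by (simp add: cyc_def)

lemma funpow_cyc_fractions [simp]: "W \<in> fractions \<Longrightarrow> (cyc u ^^ l) W \<in> fractions"
  by (induction l) auto

lemma Dp_le_iff: "Dp u \<preceq> W \<longleftrightarrow> W * Dp (- u) \<in> P"
  by (simp add: le_def Dp_mult_comm flip: zpow_minus)

text \<open>With \<open>W = Y r D^u\<close> for the conjugator \<open>Y\<close>, the result is
  \<open>r D^u Y\<close>, and \<open>Y\<close> can be moved across \<open>D^u\<close> as a positive
  element.\<close>

lemma cyc_ge: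
  assumes "W \<in> fractions" "Dp u \<preceq> W"
  shows "Dp u \<preceq> cyc u W"
proof -
  define Y where "Y = meet D (W * Dp (- u))"
  have p: "W * Dp (- u) \<in> P" using assms by (simp add: Dp_le_iff)
  then have "Y \<preceq> W * Dp (- u)" "Y \<in> P"
    using meet_le(2)[of D "W * Dp (- u)"] meet_P assms by (simp_all add: Y_def)
  then obtain r where r: "r \<in> P" "W * Dp (- u) = Y * r" by (elim leE)
  then have "W = Y * r * Dp u" by (metis add.inverse_inverse mult.assoc mult_1_right right_inv zpow_minus)
  moreover have "cyc u W = inverse Y * W * Y" by (simp add: cyc_def Y_def)
  ultimately have "cyc u W = r * Dp u * Y" by (simp add: grp_simps)
  then have "cyc u W * Dp (- u) = r * (Dp u * Y * Dp (- u))" by (simp add: mult.assoc)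
  then show ?thesis using r \<open>Y \<in> P\<close> conj_Dp_imp[of Y u] by (simp add: Dp_le_iff)
qed

text \<open>One cycling replaces the positive conjugator \<open>g\<close> by \<open>descend V u g\<close>.\<close>

definition descend :: "'g \<Rightarrow> int \<Rightarrow> 'g \<Rightarrow> 'g" where
  "descend V u g = meet g (V * g * Dp (- u))"

lemma descend_aux:
  assumes "V \<in> fractions" "Dp u \<preceq> V" "g \<in> P"
  shows "V * g * Dp (- u) \<in> P" 
proof -
  have "V * Dp (- u) \<in> P" using assms by (simp add: Dp_le_iff)
  then have "(V * Dp (- u)) * (Dp u * g * Dp (- u)) \<in> P" using conj_Dp_imp assms(3) by blast
  then show ?thesis by (simp add: mult.assoc)
qed

lemma descend_P:
  assumes "V \<in> fractions" "Dp u \<preceq> V" "g \<in> P"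
  shows "descend V u g \<in> P" "descend V u g \<preceq> g"
  using descend_aux[OF assms] assms P_fractions meet_P meet_le(1) by (simp_all add: descend_def)

text \<open>Replacing \<open>g\<close> by its head adds \<open>D\<close> and
  \<open>V D D^(-u)\<close> to the meet, and the latter is a multiple of \<open>D\<close>. In
  \<open>raise_inf\<close> this is used with \<open>u + 1\<close> in place of
  \<open>u\<close>.\<close>

lemma head_descend:
  assumes V: "V \<in> fractions" "Dp u \<preceq> V" and g: "g \<in> P"
  shows "descend V u (meet D g) = meet D (descend V u g)"
proof -
  have gf: "g \<in> fractions" using g P_fractions by simp
  have "D \<preceq> V * D * Dp (- u)"
  proof -
    have "V * D * Dp (- u) = (V * Dp (- u)) * D" by (simp add: mult.assoc zpow_comm)
    then show ?thesis using V D_le_mult_D by (simp add: Dp_le_iff)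
  qed
  then have D: "meet D (V * D * Dp (- u)) = D" using V by (simp add: meet_absorb)
  have "descend V u (meet D g) = meet (meet D g) (meet (V * D * Dp (- u)) (V * g * Dp (- u)))"
    using V gf by (simp add: descend_def meet_shift)
  also have "\<dots> = meet (meet D (V * D * Dp (- u))) (meet g (V * g * Dp (- u)))"
    by (rule meet_eqI) (use V gf in \<open>auto simp: le_meet\<close>)
  finally show ?thesis by (simp add: D descend_def)
qed

text \<open>A step that changes \<open>g\<close> passes to a proper divisor and lowers the length,
  and once a step does nothing, neither do the later ones.\<close>

lemma descend_stationary:
  assumes V: "V \<in> fractions" "Dp u \<preceq> V" and "g \<in> P" "len g \<le> l"
  shows "descend V u ((descend V u ^^ l) g) = (descend V u ^^ l) g"
  using assms(3,4)
proof (induction l arbitrary: g)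
  case 0
  then have "g = 1" using len_0 by simp
  then have "descend V u g \<preceq> 1" "1 \<preceq> descend V u g"
    using descend_P[OF V] by auto
  then show ?case using le_antisym \<open>g = 1\<close> by simp
next
  case (Suc l)
  let ?g = "descend V u g"
  have g: "?g \<in> P" "?g \<preceq> g" using descend_P[OF V Suc.prems(1)] by auto
  show ?case
  proof (cases "?g = g")
    case True
    then have "(descend V u ^^ l) g = g" for l by (induction l) auto
    then show ?thesis using True by simp
  next
    case False
    then have "len ?g < len g" using len_le[OF g] len_eq[OF g] by linarith
    then show ?thesis using Suc g by (simp add: funpow_swap1)
  qed
qed

lemma funpow_descend_P:
  assumes "V \<in> fractions" "Dp u \<preceq> V" "g \<in> P"
  shows "(descend V u ^^ l) g \<in> P \<and> (descend V u ^^ l) g \<preceq> g"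
proof (induction l)
  case (Suc l)
  then show ?case using descend_P[OF assms(1,2)] le_trans by (metis comp_apply funpow.simps(2))
qed (use assms in simp)

lemma head_funpow_descend:
  assumes V: "V \<in> fractions" "Dp u \<preceq> V" and g: "g \<in> P"
  shows "(descend V u ^^ l) (meet D g) = meet D ((descend V u ^^ l) g)"
proof (induction l)
  case (Suc l)
  then show ?case using head_descend[OF V] funpow_descend_P[OF V g] by simp
qed simp

theorem raise_inf:
  assumes W: "W \<in> fractions" and X: "X \<in> fractions" "Dp (u + 1) \<preceq> inverse X * W * X"
  shows "Dp (u + 1) \<preceq> (cyc u ^^ (len D - 1)) W"
proof -
  define good where "good K \<longleftrightarrow> K \<in> P \<and> Dp (u + 1) \<preceq> K * W * inverse K" for K
  have "\<exists>K. good K"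
  proof -
    \<comment> \<open>A large power of \<open>D\<close> makes the given conjugator positive; its
      only effect is a conjugation by that power, which preserves the bound
      \<open>D^(u+1)\<close>.\<close>
    obtain k where k: "Dp k * inverse X \<in> P"
      using inverse_fractions[OF X(1)] by (auto simp: fractions_def)
    have "inverse X * W * X * Dp (- (u + 1)) \<in> P" using X(2) by (simp only: Dp_le_iff)
    then have "Dp k * (inverse X * W * X * Dp (- (u + 1))) * Dp (- k) \<in> P"
      by (rule conj_Dp_imp)
    then have "(Dp k * inverse X) * W * inverse (Dp k * inverse X) * Dp (- (u + 1)) \<in> P"
      by (simp add: grp_simps add.commute flip: zpow_minus)
    then have "good (Dp k * inverse X)" using k by (simp only: good_def Dp_le_iff simp_thms)
    then show ?thesis ..
  qed
  then obtain K where K: "good K" and minK: "\<And>K'. good K' \<Longrightarrow> len K \<le> len K'"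
    using ex_has_least_nat[of good _ len] by blast
  define V where "V = K * W * inverse K"
  have KP: "K \<in> P" and V: "V \<in> fractions" "Dp (u + 1) \<preceq> V"
    using K W P_fractions by (auto simp: good_def V_def)
  have Kf: "K \<in> fractions" using KP P_fractions by simp
  \<comment> \<open>Cancelling a \<open>D\<close> from \<open>K\<close> conjugates \<open>V\<close>
    by \<open>D\<close>, so the shorter element would be good as well.\<close>
  have not_D: "\<not> D \<preceq> K"
  proof
    assume "D \<preceq> K"
    then obtain K' where K': "K' \<in> P" "K = D * K'" by (elim leE)
    have "K' * W * inverse K' * Dp (- (u + 1)) = inverse D * (V * Dp (- (u + 1))) * D"
      by (simp add: V_def K' grp_simps flip: zpow_comm)
    moreover have "V * Dp (- (u + 1)) \<in> P" using V(2) by (simp only: Dp_le_iff)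
    ultimately have "good K'" using K' conj_D' by (simp add: good_def Dp_le_iff)
    then have "len D = 0" using minK[of K'] K' len_mult[of D K'] by simp
    then show False using len_0 D_neq_1 by blast
  qed
  let ?f = "descend V (u + 1)"
  define F where "F l = (?f ^^ l) K" for l
  have F1: "F l = 1" if "l \<ge> len K" for l
  proof -
    have fix1: "?f (F l) = F l" using descend_stationary[OF V KP that] by (simp add: F_def)
    have F: "F l \<in> P" "F l \<preceq> K" using funpow_descend_P[OF V KP] by (simp_all add: F_def)
    then obtain K' where K': "K' \<in> P" "K = F l * K'" by (elim leE)
    have Ff: "F l \<in> fractions" using F P_fractions by simp
    have "F l \<preceq> V * F l * Dp (- (u + 1))"
      using fix1 meet_le(2)[of "F l" "V * F l * Dp (- (u + 1))"] V Ff by (simp add: descend_def)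
    then have "Dp (u + 1) \<preceq> inverse (F l) * V * F l"
      by (simp add: Dp_le_iff) (simp add: le_def mult.assoc)
    also have "inverse (F l) * V * F l = K' * W * inverse K'"
      by (simp add: V_def K' grp_simps)
    finally have "good K'" using K' by (simp add: good_def)
    then have "len (F l) = 0" using minK[of K'] K' F len_mult[of "F l" K'] by simp
    then show ?thesis using len_0 F by blast
  qed
  define N where "N = len D - 1"
  define B where "B = meet D K"
  have B: "B \<in> P" "B \<preceq> D" using head_simple[OF KP] by (simp_all add: B_def simples_def)
  have "B \<noteq> D" using not_D meet_le(2)[of D K] Kf by (auto simp: B_def)
  then have "len B < len D" using len_le[OF B] len_eq[OF B] by fastforce
  then have "len B \<le> N" by (simp add: N_def)
  have "(?f ^^ N) B = 1"
  proof -
    have fix1: "?f ((?f ^^ N) B) = (?f ^^ N) B"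
      using descend_stationary[OF V B(1) \<open>len B \<le> N\<close>] .
    \<comment> \<open>\<open>F1\<close> speaks only of indices from \<open>len K\<close> on. The
      heads are constant from \<open>N\<close> on, so their value at \<open>N\<close> is the one at
      \<open>len K + N\<close>.\<close>
    have "(?f ^^ (k + N)) B = (?f ^^ N) B" for k
      by (induction k) (use fix1 in auto)
    then have "(?f ^^ N) B = (?f ^^ (len K + N)) B" by metis
    also have "\<dots> = meet D (F (len K + N))"
      using head_funpow_descend[OF V KP] by (simp only: B_def F_def)
    also have "\<dots> = 1" using F1 meet_comm[of D 1] meet_absorb[of 1 D] P_fractions[OF one_P] by simp
    finally show ?thesis .
  qed
  then have "meet D (F N) = 1" using head_funpow_descend[OF V KP] by (simp only: B_def F_def)
  then have "F N = 1" using head_eq_1 funpow_descend_P[OF V KP] by (simp add: F_def)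
  \<comment> \<open>\<open>Z\<close> is the product of the conjugators so far and is extended by the
    next one, \<open>Y\<close>. Multiplying the meet that defines \<open>Y\<close> by
    \<open>K Z\<close> on the left and by \<open>D^(-l-1)\<close> on the right turns it into the
    meet that defines \<open>descend\<close>.\<close>
  have "\<exists>Z\<in>fractions. W * Z = Z * (cyc u ^^ l) W \<and> F l = K * Z * Dp (- int l)" for l
  proof (induction l)
    case 0
    show ?case by (rule bexI[of _ 1]) (simp_all add: F_def P_fractions)
  next
    case (Suc l)
    then obtain Z where Z: "Z \<in> fractions" "W * Z = Z * (cyc u ^^ l) W" "F l = K * Z * Dp (- int l)"
      by blast
    define Wl where "Wl = (cyc u ^^ l) W"
    have Wl: "Wl \<in> fractions" using W by (simp add: Wl_def)
    define Y where "Y = meet D (Wl * Dp (- u))"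
    have Y: "Y \<in> fractions" using Wl by (simp add: Y_def)
    have cyc: "(cyc u ^^ Suc l) W = inverse Y * Wl * Y"
      by (simp add: Y_def Wl_def cyc_def)
    have 1: "W * (Z * Y) = (Z * Y) * (cyc u ^^ Suc l) W"
      unfolding cyc using Z(2) by (simp add: grp_simps Wl_def[symmetric]) (metis mult.assoc)
    have a: "K * Z * D * Dp (- int (Suc l)) = F l"
    proof -
      have "- int l = 1 + - int (Suc l)" by simp
      then have "Dp (- int l) = D * Dp (- int (Suc l))" by (metis zpow_add zpow_1)
      then show ?thesis by (simp only: Z(3) mult.assoc)
    qed
    have "V * (K * Z * Dp (- int l)) * Dp (- (u + 1)) = K * (W * Z) * (Dp (- int l) * Dp (- (u + 1)))"
      by (simp only: V_def mult.assoc inv_cancel)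
    also have "Dp (- int l) * Dp (- (u + 1)) = Dp (- u) * Dp (- int (Suc l))"
      by (simp add: algebra_simps)
    finally have b: "K * Z * (Wl * Dp (- u)) * Dp (- int (Suc l)) = V * F l * Dp (- (u + 1))"
      by (simp only: Z Wl_def mult.assoc)
    have "K * (Z * Y) * Dp (- int (Suc l)) = (K * Z) * Y * Dp (- int (Suc l))"
      by (simp only: mult.assoc)
    also have "\<dots> = meet (K * Z * D * Dp (- int (Suc l))) (K * Z * (Wl * Dp (- u)) * Dp (- int (Suc l)))"
      unfolding Y_def by (subst meet_shift) (use Z Kf Wl in simp_all)
    also have "\<dots> = F (Suc l)" unfolding a b by (simp add: F_def descend_def)
    finally show ?case using 1 Z Y by (intro bexI[of _ "Z * Y"]) auto
  qed
  then obtain Z where Z: "W * Z = Z * (cyc u ^^ N) W" "1 = K * Z * Dp (- int N)"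
    unfolding \<open>F N = 1\<close>[symmetric] by blast
  \<comment> \<open>Hence the \<open>N\<close>-fold cycling of \<open>W\<close> is a conjugate of
    \<open>V\<close> by \<open>D^N\<close> and inherits its lower bound.\<close>
  have KZ: "K * Z = Dp (int N)"
  proof -
    have "K * Z * Dp (- int N) * Dp (int N) = Dp (int N)" using Z(2) by simp
    then show ?thesis by (simp add: mult.assoc)
  qed
  have "Dp (int N) * (cyc u ^^ N) W = V * Dp (int N)"
    using Z(1) by (simp add: V_def mult.assoc inv_cancel flip: KZ)
  then have "Dp (- int N) * (V * Dp (int N)) = (cyc u ^^ N) W"
    by (metis add.left_inverse mult_1 zpow_0 zpow_cancel(2))
  moreover have "Dp (- int N) * (V * Dp (- (u + 1))) * Dp (int N)
      = Dp (- int N) * (V * Dp (int N)) * Dp (- (u + 1))"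
    by (simp add: mult.assoc add.commute)
  ultimately have "(cyc u ^^ N) W * Dp (- (u + 1)) = Dp (- int N) * (V * Dp (- (u + 1))) * Dp (int N)"
    by simp
  moreover have "V * Dp (- (u + 1)) \<in> P" using V(2) by (simp only: Dp_le_iff)
  ultimately have "(cyc u ^^ N) W * Dp (- (u + 1)) \<in> P"
    using conj_Dp_imp[of _ "- int N"] by simp
  then show ?thesis by (simp only: Dp_le_iff N_def)
qed

section \<open>Normal forms\<close>

definition greedy_pair :: "'g \<Rightarrow> 'g \<Rightarrow> bool" where
  "greedy_pair A B \<longleftrightarrow> (\<forall>A'\<in>simples. A' \<preceq> A * B \<longrightarrow> A' \<preceq> A)"

fun greedy :: "'g list \<Rightarrow> bool" where
  "greedy [] = True"
| "greedy [A] = True"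
| "greedy (A # B # As) = (greedy_pair A B \<and> greedy (B # As))"

definition proper :: "'g set" where
  "proper = simples - {1, D}"

definition is_nf :: "'g \<Rightarrow> int \<times> 'g list \<Rightarrow> bool" where
  "is_nf W = (\<lambda>(u, As). W = Dp u * prod_list As \<and> set As \<subseteq> proper \<and> greedy As)"

lemma greedy_nth: "greedy As \<longleftrightarrow> (\<forall>i. Suc i < length As \<longrightarrow> greedy_pair (As ! i) (As ! Suc i))"
proof (induction As rule: greedy.induct)
  case (3 A B As)
  have *: "(\<forall>i. Q i) \<longleftrightarrow> Q 0 \<and> (\<forall>i. Q (Suc i))" for Q :: "nat \<Rightarrow> bool"
    by (metis not0_implies_Suc)
  have "(\<forall>i. Suc i < length (A # B # As) \<longrightarrow> greedy_pair ((A # B # As) ! i) ((A # B # As) ! Suc i))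
    \<longleftrightarrow> greedy_pair A B \<and> (\<forall>i. Suc i < length (B # As) \<longrightarrow> greedy_pair ((B # As) ! i) ((B # As) ! Suc i))"
    by (subst *) auto
  then show ?case using 3 by simp
qed auto

lemma proper_P: "set As \<subseteq> proper \<Longrightarrow> prod_list As \<in> P"
  by (induction As) (auto simp: proper_def simples_def)

lemma greedy_pair_iff:
  assumes "A \<in> simples" "B \<in> P"
  shows "greedy_pair A B \<longleftrightarrow> meet D (A * B) = A"
proof
  have AB: "A * B \<in> P" "A \<in> P" "A \<preceq> D" using assms by (auto simp: simples_def)
  then have f: "A * B \<in> fractions" "A \<in> fractions" using P_fractions by auto
  {
    assume g: "greedy_pair A B"
    have "meet D (A * B) \<preceq> A"
      using g head_simple[OF AB(1)] meet_le(2)[of D "A * B"] f by (simp add: greedy_pair_def)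
    moreover have "A \<preceq> meet D (A * B)"
      using f AB assms by (simp add: le_meet)
    ultimately show "meet D (A * B) = A" by (rule le_antisym)
  }
  {
    assume "meet D (A * B) = A"
    then show "greedy_pair A B"
      using f le_meet[of D "A * B"] P_fractions by (auto simp: greedy_pair_def simples_def)
  }
qed

lemma head_simple_id: "A \<in> simples \<Longrightarrow> meet D A = A"
  by (metis meet_absorb meet_comm P_fractions simplesD D_fractions)

text \<open>By \<open>head_mult\<close> everything after the first factor may be replaced by its
  head, which is the second factor by induction.\<close>

lemma head_greedy:
  assumes "greedy (A # As)" "set (A # As) \<subseteq> simples"
  shows "meet D (prod_list (A # As)) = A"
  using assms
proof (induction As arbitrary: A)
  case (Cons B As)
  have P: "set Bs \<subseteq> simples \<Longrightarrow> prod_list Bs \<in> P" for Bs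
    by (induction Bs) (auto simp: simples_def)
  have "meet D (prod_list (A # B # As)) = meet D (A * meet D (prod_list (B # As)))"
    using head_mult[of A "prod_list (B # As)"] Cons.prems P[of "B # As"] by (simp add: simples_def)
  also have "\<dots> = A" using Cons greedy_pair_iff[of A B] by (simp add: simples_def)
  finally show ?case .
qed (simp add: head_simple_id)

lemma nf_head:
  assumes "set As \<subseteq> proper" "greedy As"
  shows "meet D (prod_list As) = (if As = [] then 1 else hd As)"
proof (cases As)
  case Nil
  then show ?thesis using meet_comm[of D 1] meet_absorb[of 1 D] P_fractions[OF one_P] by simp
next
  case (Cons A As')
  then show ?thesis using head_greedy[of A As'] assms by (auto simp: proper_def)
qed

lemma prod_list_unique:
  assumes "set As \<subseteq> proper" "greedy As" "set Bs \<subseteq> proper" "greedy Bs" "prod_list As = prod_list Bs"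
  shows "As = Bs"
  using assms
proof (induction As arbitrary: Bs)
  case Nil
  then show ?case using nf_head[of Bs] nf_head[of "[]"] by (cases Bs) (auto simp: proper_def)
next
  case (Cons A As)
  have "A \<noteq> 1" using Cons.prems(1) by (auto simp: proper_def)
  moreover have "(if Bs = [] then 1 else hd Bs) = A"
    using nf_head[OF Cons.prems(1,2)] nf_head[OF Cons.prems(3,4)] Cons.prems(5) by simp
  ultimately obtain Bs' where Bs: "Bs = A # Bs'" by (cases Bs) auto
  have "greedy As" "greedy Bs'" using Cons.prems(2,4) Bs by (cases As; cases Bs'; simp)+
  moreover have "prod_list As = prod_list Bs'" using Cons.prems(5) Bs by (simp add: mult_left_cancel')
  ultimately show ?case using Cons.IH[of Bs'] Cons.prems Bs by simp
qed

text \<open>Split off the head \<open>A\<close>. The remainder is again not divisible by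
  \<open>D\<close>, since \<open>A D r\<close> is a multiple of \<open>D\<close> for positive
  \<open>r\<close>.\<close>

lemma ex_greedy:
  assumes "p \<in> P" "\<not> D \<preceq> p"
  shows "\<exists>As. set As \<subseteq> proper \<and> greedy As \<and> prod_list As = p"
  using assms
proof (induction "len p" arbitrary: p rule: less_induct)
  case less
  show ?case
  proof (cases "p = 1")
    case True
    then show ?thesis by (intro exI[of _ "[]"]) simp
  next
    case False
    have pf: "p \<in> fractions" using less.prems P_fractions by simp
    define A where "A = meet D p"
    have A: "A \<in> simples" "A \<noteq> 1" "A \<preceq> p" "A \<noteq> D"
      using head_simple[of p] head_eq_1[of p] False less.prems meet_le[of D p] pf by (auto simp: A_def)
    obtain q where q: "q \<in> P" "p = A * q" using A(3) by (elim leE)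
    have AP: "A \<in> P" using A simplesD by blast
    have "len A \<noteq> 0" using A(2) len_0 AP by blast
    then have "len q < len p" using q AP by (simp add: len_mult)
    moreover have "\<not> D \<preceq> q"
    proof
      assume "D \<preceq> q"
      then obtain r where r: "r \<in> P" "q = D * r" by (elim leE)
      have "D \<preceq> A * D * r" using D_le_mult_D[OF AP] r(1) by (rule le_mult_trans)
      then show False using less.prems q r by (simp add: mult.assoc)
    qed
    ultimately obtain Bs where Bs: "set Bs \<subseteq> proper" "greedy Bs" "prod_list Bs = q"
      using less.hyps q by blast
    have "greedy (A # Bs)"
    proof (cases Bs)
      case (Cons B Bs')
      have B: "B \<in> P" "B \<in> fractions" "prod_list Bs' \<in> P" using Bs Cons proper_P[of Bs'] P_fractions
        by (auto simp: proper_def simples_def)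
      have "A' \<preceq> A" if A': "A' \<in> simples" "A' \<preceq> A * B" for A'
      proof -
        have "A' \<preceq> A * B * prod_list Bs'" using A' B by (blast intro: le_mult_trans)
        then have "A' \<preceq> p" using q Bs Cons by (simp add: mult.assoc)
        then show ?thesis using A' pf by (auto simp: A_def le_meet simples_def P_fractions)
      qed
      then show ?thesis using Bs Cons by (simp add: greedy_pair_def)
    qed simp
    then show ?thesis using A Bs q by (intro exI[of _ "A # Bs"]) (auto simp: proper_def)
  qed
qed

lemma Dp_le_Dp: "Dp j \<preceq> Dp k \<longleftrightarrow> j \<le> k"
proof
  assume a: "Dp j \<preceq> Dp k"
  show "j \<le> k"
  proof (rule ccontr)
    assume "\<not> j \<le> k"
    have "Dp (k - j) \<in> P" using a by (simp add: le_def flip: zpow_minus)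
    moreover have "Dp (j - k) \<in> P" using \<open>\<not> j \<le> k\<close> by (simp add: Dp_P)
    ultimately have "Dp (j - k) = 1"
      using P_antisym[of "Dp (j - k)"] zpow_minus[of D "j - k"] by simp
    have "Dp (j - k) = D * Dp (j - k - 1)" using zpow_Suc[of D "j - k - 1"] by simp
    then have "D * Dp (j - k - 1) = 1" using \<open>Dp (j - k) = 1\<close> by simp
    moreover have "Dp (j - k - 1) \<in> P" using \<open>\<not> j \<le> k\<close> by (simp add: Dp_P)
    ultimately have "len D = 0" using len_mult[of D "Dp (j - k - 1)"] by simp
    then show False using len_0 D_neq_1 by blast
  qed
next
  assume "j \<le> k"
  then show "Dp j \<preceq> Dp k" using Dp_P[of "k - j"] by (simp add: le_def flip: zpow_minus)
qed

lemma nf_Dp_le: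
  assumes "is_nf W (u, As)"
  shows "Dp m \<preceq> W \<longleftrightarrow> m \<le> u"
proof
  have W: "W = Dp u * prod_list As" "set As \<subseteq> proper" "greedy As" using assms by (auto simp: is_nf_def)
  have p: "prod_list As \<in> P" using proper_P W by blast
  {
    assume "m \<le> u"
    then have "Dp m \<preceq> Dp u" by (simp add: Dp_le_Dp)
    then show "Dp m \<preceq> W" using p W le_mult_trans by blast
  }
  {
    assume "Dp m \<preceq> W"
    show "m \<le> u"
    proof (rule ccontr)
      assume "\<not> m \<le> u"
      then have "Dp (u + 1) \<preceq> W" using le_trans[OF _ \<open>Dp m \<preceq> W\<close>] Dp_le_Dp by simp
      then have "D \<preceq> prod_list As" using W(1) zpow_add[of D u 1] by simp
      then have "meet D (prod_list As) = D" using p P_fractions by (simp add: meet_absorb)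
      then show False using nf_head[OF W(2,3)] W(2) D_neq_1
        by (cases As) (auto simp: proper_def)
    qed
  }
qed

lemma nf_unique:
  assumes "is_nf W (u, As)" "is_nf W (v, Bs)"
  shows "u = v \<and> As = Bs"
proof -
  have "u = v" using nf_Dp_le[OF assms(1), of v] nf_Dp_le[OF assms(2), of u]
      nf_Dp_le[OF assms(1), of u] nf_Dp_le[OF assms(2), of v] by simp
  then show ?thesis using assms prod_list_unique[of As Bs]
    by (simp add: is_nf_def) (metis mult_left_cancel')
qed

lemma nf_exists:
  assumes W: "W \<in> fractions" shows "\<exists>u As. is_nf W (u, As)"
proof -
  obtain k where k: "Dp k * W \<in> P" using W by (auto simp: fractions_def)
  then obtain m where m: "Dp k * W \<preceq> Dp m" using le_Dp by blast
  have "Dp m = Dp k * Dp (m - k)" by simp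
  then have ub: "W \<preceq> Dp (m - k)" using m by (metis le_left)
  have lb: "Dp (- k) \<preceq> W" using k by (simp add: le_def flip: zpow_minus)
  \<comment> \<open>The largest power of \<open>D\<close> below \<open>W\<close>. The bound
    \<open>- k \<le> u\<close> together with \<open>ub\<close> makes the set finite, and
    \<open>- k\<close> belongs to it.\<close>
  define u where "u = Max {u. - k \<le> u \<and> Dp u \<preceq> W}"
  have fin: "finite {u. - k \<le> u \<and> Dp u \<preceq> W}"
  proof (rule finite_subset[of _ "{- k..m - k}"])
    have "v \<le> m - k" if "Dp v \<preceq> W" for v
      using le_trans[OF that ub] Dp_le_Dp by simp
    then show "{u. - k \<le> u \<and> Dp u \<preceq> W} \<subseteq> {- k..m - k}" by auto
  qed simp
  have u: "Dp u \<preceq> W"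
    using Max_in[OF fin] lb unfolding u_def by fastforce
  have "\<not> Dp (u + 1) \<preceq> W"
  proof
    assume a: "Dp (u + 1) \<preceq> W"
    have "- k \<le> u" using Max_ge[OF fin, of "- k"] lb by (simp add: u_def)
    then have "u + 1 \<le> u" using Max_ge[OF fin, of "u + 1"] a by (simp add: u_def)
    then show False by simp
  qed
  moreover obtain p where p: "p \<in> P" "W = Dp u * p" using u by (elim leE)
  ultimately have "\<not> D \<preceq> p" using zpow_add[of D u 1] by simp
  then obtain As where "set As \<subseteq> proper \<and> greedy As \<and> prod_list As = p" using ex_greedy p by blast
  then have "is_nf W (u, As)" using p by (simp add: is_nf_def)
  then show ?thesis by blast
qed

section \<open>Cycling and decycling of abstract normal forms\<close>

definition nf :: "'g \<Rightarrow> int \<times> 'g list" where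
  "nf W = (THE x. is_nf W x)"

lemma nf_eq: "is_nf W x \<Longrightarrow> nf W = x"
  unfolding nf_def by (rule the_equality) (metis nf_unique surj_pair)+

lemma is_nf_nf: "W \<in> fractions \<Longrightarrow> is_nf W (nf W)"
  using nf_exists[of W] nf_eq by metis

definition ginf :: "'g \<Rightarrow> int" where "ginf W = fst (nf W)"

definition gsup :: "'g \<Rightarrow> int" where "gsup W = fst (nf W) + int (length (snd (nf W)))"

lemma Dp_le_iff_ginf: "W \<in> fractions \<Longrightarrow> Dp m \<preceq> W \<longleftrightarrow> m \<le> ginf W"
  using is_nf_nf[of W] nf_Dp_le[of W "fst (nf W)" "snd (nf W)" m] by (simp add: ginf_def)

definition gcycling :: "'g \<Rightarrow> 'g" where
  "gcycling W = (let (u, As) = nf W in if As = [] then W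
     else Dp u * prod_list (tl As @ [Dp u * hd As * Dp (- u)]))"

definition gdecycling :: "'g \<Rightarrow> 'g" where
  "gdecycling W = (let (u, As) = nf W in if As = [] then W
     else Dp u * prod_list ((Dp (- u) * last As * Dp u) # butlast As))"

lemma conj_D_Dp: "Dp k * D * Dp (- k) = D"
  by (simp flip: zpow_comm add: mult.assoc)

lemma meet_conj:
  assumes "x \<in> fractions"
  shows "meet D (Dp k * x * Dp (- k)) = Dp k * meet D x * Dp (- k)"
  using meet_shift[of D x "Dp k" "- k"] assms by (simp add: conj_D_Dp)

lemma gcycling_eq:
  assumes W: "W \<in> fractions" shows "gcycling W = cyc (ginf W) W"
proof -
  obtain u As where nf: "nf W = (u, As)" by fastforce
  have ginf_W: "ginf W = u" by (simp add: ginf_def nf)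
  have gcycling: "gcycling W = (if As = [] then W else Dp u * prod_list (tl As @ [Dp u * hd As * Dp (- u)]))"
    by (simp add: gcycling_def nf)
  have "is_nf W (u, As)" using is_nf_nf[OF W] nf by simp
  then have W: "W = Dp u * prod_list As" "set As \<subseteq> proper" "greedy As" by (auto simp: is_nf_def)
  have "meet D (W * Dp (- u)) = Dp u * meet D (prod_list As) * Dp (- u)"
    unfolding W(1) using proper_P[OF W(2)] P_fractions by (intro meet_conj) auto
  also have "\<dots> = Dp u * (if As = [] then 1 else hd As) * Dp (- u)"
    using nf_head[OF W(2,3)] by simp
  finally have c: "cyc u W = (let Y = Dp u * (if As = [] then 1 else hd As) * Dp (- u) in inverse Y * W * Y)"
    by (simp only: cyc_def Let_def)
  show ?thesis
  proof (cases As)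
    case Nil
    then show ?thesis using c by (simp add: gcycling ginf_W)
  next
    case (Cons A As')
    then show ?thesis unfolding gcycling ginf_W c
      by (simp add: W(1) grp_simps zpow_minus Let_def)
  qed
qed

text \<open>The factors of the normal form of the inverse, up to a power of \<open>D\<close> on the right.\<close>

fun dual :: "'g list \<Rightarrow> 'g list" where
  "dual [] = []"
| "dual (A # As) = dual As @ [Dp (- int (length As)) * (inverse A * D) * Dp (int (length As))]"

lemma length_dual [simp]: "length (dual As) = length As"
  by (induction As) auto

lemma dual_eq_Nil [simp]: "dual As = [] \<longleftrightarrow> As = []"
  by (metis length_dual length_0_conv)

lemma prod_dual: "prod_list (dual As) = inverse (prod_list As) * Dp (int (length As))"
proof (induction As)
  case (Cons A As)
  have "int (length (A # As)) = 1 + int (length As)" by simp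
  then have "Dp (int (length (A # As))) = D * Dp (int (length As))" by (metis zpow_add zpow_1)
  then show ?case using Cons by (simp add: inv_mult mult.assoc del: of_nat_Suc)
qed simp

lemma star_proper:
  assumes "A \<in> proper" shows "inverse A * D \<in> proper"
proof -
  have "inverse A * D \<noteq> 1" using assms inverse_unique'[of "inverse A" D]
    by (auto simp: proper_def)
  moreover have "inverse A * D \<noteq> D"
  proof
    assume "inverse A * D = D"
    then have "A * D = D" by (metis inv_cancel(2))
    then show False using assms mult_right_cancel'[of A D 1] by (simp add: proper_def)
  qed
  ultimately show ?thesis using assms star_simple by (simp add: proper_def)
qed

lemma conj_proper:
  assumes "A \<in> proper" shows "Dp k * A * Dp (- k) \<in> proper"
proof -
  have "A = Dp (- k) * (Dp k * A * Dp (- k)) * Dp k" by (simp add: mult.assoc)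
  then have "Dp k * A * Dp (- k) \<noteq> 1 \<and> Dp k * A * Dp (- k) \<noteq> D"
    using assms conj_D_Dp[of "- k"] by (auto simp: proper_def)
  then show ?thesis using assms conj_simple by (simp add: proper_def)
qed

lemma dual_proper: "set As \<subseteq> proper \<Longrightarrow> set (dual As) \<subseteq> proper"
proof (induction As)
  case (Cons A As)
  then show ?case using conj_proper[of "inverse A * D" "- int (length As)"] star_proper[of A] by simp
qed simp

lemma greedy_conj_pair:
  assumes "A \<in> simples" "B \<in> P" "greedy_pair A B"
  shows "greedy_pair (Dp k * A * Dp (- k)) (Dp k * B * Dp (- k))"
proof -
  have "A * B \<in> P" using assms by (simp add: simples_def)
  then have "meet D (Dp k * (A * B) * Dp (- k)) = Dp k * A * Dp (- k)"
    using greedy_pair_iff[OF assms(1,2)] assms(3) by (subst meet_conj) (auto simp: P_fractions)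
  then show ?thesis
    using conj_simple[OF assms(1), of k] conj_Dp_imp[OF assms(2), of k]
    by (subst greedy_pair_iff) (simp_all add: mult.assoc)
qed

text \<open>Greediness says that the meet of \<open>D\<close> and \<open>A B\<close> is
  \<open>A\<close>. Multiplying by \<open>(A B)^(-1)\<close> on the left and by \<open>D\<close> on
  the right turns this into the statement that the meet of \<open>(A B)^(-1) D D\<close> and
  \<open>D\<close> is \<open>B^(-1) D\<close>.\<close>

lemma greedy_dual_pair:
  assumes "A \<in> simples" "B \<in> simples" "greedy_pair A B"
  shows "greedy_pair (inverse B * D) (inverse D * (inverse A * D) * D)"
proof -
  have AB: "A * B \<in> P" using assms by (simp add: simples_def)
  then have ABf: "A * B \<in> fractions" by (rule P_fractions)
  have star: "inverse A * D \<in> P" "inverse B * D \<in> simples"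
    using star_simple assms(1,2) by (auto simp: simples_def)
  have h: "meet D (A * B) = A" using greedy_pair_iff[OF assms(1)] assms by (simp add: simples_def)
  define C where "C = inverse (A * B)"
  have C: "C \<in> fractions" using ABf by (simp add: C_def)
  have "meet (C * (A * B) * Dp 1) (C * D * Dp 1) = C * meet (A * B) D * Dp 1"
    using C ABf by (intro meet_shift) auto
  then have "meet D (C * D * D) = C * A * D"
    using h meet_comm[OF ABf, of D] by (simp add: C_def left_inv)
  then have "meet D ((inverse B * D) * (inverse D * (inverse A * D) * D)) = inverse B * D"
    by (simp add: C_def grp_simps)
  then show ?thesis using star conj_D' by (subst greedy_pair_iff) auto
qed

lemma greedy_snoc: "greedy (As @ [A, B]) \<longleftrightarrow> greedy (As @ [A]) \<and> greedy_pair A B"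
  by (induction As rule: greedy.induct) auto

lemma greedy_dual:
  assumes "set As \<subseteq> proper" "greedy As" shows "greedy (dual As)"
  using assms
proof (induction As rule: greedy.induct)
  case (3 A B As)
  let ?k = "int (length As)"
  have AB: "A \<in> simples" "B \<in> simples" "inverse A * D \<in> P" "inverse B * D \<in> simples"
    using 3 star_simple by (auto simp: proper_def simples_def)
  then have "greedy_pair (inverse B * D) (inverse D * (inverse A * D) * D)"
    using greedy_dual_pair 3 by simp
  then have "greedy_pair (Dp (- ?k) * (inverse B * D) * Dp (- (- ?k)))
      (Dp (- ?k) * (inverse D * (inverse A * D) * D) * Dp (- (- ?k)))"
    by (rule greedy_conj_pair[rotated 2]) (use AB conj_D' in auto)
  moreover have "- ?k + - 1 = - int (length (B # As))" by simp
  then have "Dp (- ?k) * inverse D = Dp (- int (length (B # As)))"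
    by (metis zpow_add zpow_minus_1)
  then have "Dp (- ?k) * (inverse D * (inverse A * D) * D) * Dp (- (- ?k))
     = Dp (- int (length (B # As))) * (inverse A * D) * Dp (int (length (B # As)))"
    using zpow_add[of D 1 ?k] by (simp only: mult.assoc[symmetric]) (simp add: mult.assoc)
  ultimately have "greedy_pair (Dp (- ?k) * (inverse B * D) * Dp ?k)
      (Dp (- int (length (B # As))) * (inverse A * D) * Dp (int (length (B # As))))"
    by (simp only: add.inverse_inverse)
  moreover have "greedy (dual (B # As))" using 3 by simp
  ultimately show ?case by (simp add: greedy_snoc del: of_nat_Suc)
qed auto

lemma greedy_map_conj:
  "set As \<subseteq> proper \<Longrightarrow> greedy As \<Longrightarrow> greedy (map (\<lambda>A. Dp k * A * Dp (- k)) As)"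
proof (induction As rule: greedy.induct)
  case (3 A B As)
  then show ?case using greedy_conj_pair[of A B k] by (simp add: proper_def simples_def)
qed auto

lemma prod_map_conj: "prod_list (map (\<lambda>A. Dp k * A * Dp (- k)) As) = Dp k * prod_list As * Dp (- k)"
  by (induction As) (simp_all add: mult.assoc)

text \<open>The inverse is the product of \<open>dual As\<close> followed by a power of
  \<open>D\<close>; bringing that power to the front conjugates every factor.\<close>

lemma nf_inverse:
  assumes "is_nf W (u, As)"
  shows "is_nf (inverse W) (- (u + int (length As)),
    map (\<lambda>A. Dp (u + int (length As)) * A * Dp (- (u + int (length As)))) (dual As))"
proof -
  let ?k = "int (length As)"
  have W: "W = Dp u * prod_list As" "set As \<subseteq> proper" "greedy As" using assms by (auto simp: is_nf_def)
  have "Dp (- (u + ?k)) * (Dp (u + ?k) * prod_list (dual As) * Dp (- (u + ?k)))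
      = inverse (prod_list As) * (Dp ?k * Dp (- (u + ?k)))"
    by (simp add: prod_dual mult.assoc)
  also have "\<dots> = inverse W" by (simp add: W(1) inv_mult zpow_minus)
  finally have "inverse W = Dp (- (u + ?k)) * (Dp (u + ?k) * prod_list (dual As) * Dp (- (u + ?k)))"
    by metis
  moreover have "set (map (\<lambda>A. Dp (u + ?k) * A * Dp (- (u + ?k))) (dual As)) \<subseteq> proper"
    using dual_proper[OF W(2)] conj_proper[of _ "u + ?k"] by auto
  moreover have "greedy (map (\<lambda>A. Dp (u + ?k) * A * Dp (- (u + ?k))) (dual As))"
    using greedy_map_conj dual_proper[OF W(2)] greedy_dual[OF W(2,3)] by blast
  ultimately show ?thesis unfolding is_nf_def prod.case prod_map_conj by blast
qed

lemma gsup_eq: assumes "W \<in> fractions" shows "gsup W = - ginf (inverse W)"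
  using nf_eq[OF nf_inverse[of W "fst (nf W)" "snd (nf W)"]] is_nf_nf[OF assms]
  by (simp add: gsup_def ginf_def)

text \<open>With \<open>A\<close> the last factor of \<open>W\<close>, the first factor in the dual
  form of the inverse is \<open>A^(-1) D\<close>. Cycling the inverse thus conjugates by
  \<open>A^(-1) D\<close>, decycling by \<open>A\<close> alone; the difference is one conjugation by
  \<open>D\<close>.\<close>

lemma gdecycling_eq:
  assumes Wf: "W \<in> fractions"
  shows "inverse (gdecycling W) = D * cyc (- gsup W) (inverse W) * inverse D"
proof -
  obtain u As where nf: "nf W = (u, As)" by fastforce
  have gdecycling: "gdecycling W = (if As = [] then W
      else Dp u * prod_list ((Dp (- u) * last As * Dp u) # butlast As))"
    by (simp add: gdecycling_def nf)
  have "is_nf W (u, As)" using is_nf_nf[OF Wf] nf by simp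
  then have W: "W = Dp u * prod_list As" "set As \<subseteq> proper" "greedy As" by (auto simp: is_nf_def)
  let ?k = "int (length As)"
  have gsup: "gsup W = u + ?k" by (simp add: gsup_def nf)
  have "inverse W * Dp (u + ?k) = prod_list (dual As)"
    by (simp add: W(1) prod_dual inv_mult mult.assoc flip: zpow_minus)
  then have "meet D (inverse W * Dp (u + ?k)) = (if dual As = [] then 1 else hd (dual As))"
    using nf_head[OF dual_proper greedy_dual] W by simp
  also have "\<dots> = (if As = [] then 1 else inverse (last As) * D)"
  proof -
    have "As \<noteq> [] \<Longrightarrow> hd (dual As) = inverse (last As) * D"
    proof (induction As)
      case (Cons A As)
      then show ?case by (cases "As = []") (auto simp: hd_append)
    qed simp
    then show ?thesis by auto
  qed
  finally have c: "cyc (- gsup W) (inverse W) = (let Y = (if As = [] then 1 else inverse (last As) * D)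
      in inverse Y * inverse W * Y)"
    by (simp only: cyc_def gsup Let_def minus_minus)
  show ?thesis
  proof (cases "As = []")
    case True
    have "inverse W = D * inverse W * inverse D"
    proof -
      have "inverse W * D = D * inverse W" using W(1) True by (simp add: zpow_comm flip: zpow_minus)
      then show ?thesis by (metis mult.assoc mult_1_right right_inv)
    qed
    then show ?thesis unfolding c using True by (simp add: gdecycling)
  next
    case False
    then have "prod_list As = prod_list (butlast As) * last As"
      by (metis append_butlast_last_id prod_list.append prod_list.Cons prod_list.Nil mult_1_right)
    then have "inverse W = inverse (last As) * (inverse (prod_list (butlast As)) * inverse (Dp u))"
      by (simp add: W(1) grp_simps)
    then show ?thesis unfolding c gdecycling using False
      by (simp add: grp_simps zpow_minus)
  qed
qed

lemma ginf_conj_Dp: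
  assumes "W \<in> fractions" shows "ginf (Dp k * W * Dp (- k)) = ginf W"
proof -
  have f: "Dp k * W * Dp (- k) \<in> fractions" using assms by simp
  have "m \<le> ginf (Dp k * W * Dp (- k)) \<longleftrightarrow> m \<le> ginf W" for m
  proof -
    have "Dp k * W * Dp (- k) * Dp (- m) = Dp k * (W * Dp (- m)) * Dp (- k)"
      by (simp add: mult.assoc add.commute)
    then have "Dp m \<preceq> Dp k * W * Dp (- k) \<longleftrightarrow> Dp m \<preceq> W"
      by (simp only: Dp_le_iff conj_Dp)
    then show ?thesis using Dp_le_iff_ginf f assms by simp
  qed
  then show ?thesis by (meson order_antisym order_refl)
qed

lemma gcycling_fractions [simp]: "W \<in> fractions \<Longrightarrow> gcycling W \<in> fractions"
  by (simp add: gcycling_eq)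

lemma gdecycling_fractions [simp]:
  assumes "W \<in> fractions" shows "gdecycling W \<in> fractions"
proof -
  have "inverse (inverse (gdecycling W)) \<in> fractions"
    unfolding gdecycling_eq[OF assms] using assms by (intro inverse_fractions mult_fractions) auto
  then show ?thesis by (simp add: grp.inverse_inverse)
qed

theorem cycling_raises_inf:
  assumes W: "W \<in> fractions" and X: "X \<in> fractions" "ginf W < ginf (X * W * inverse X)"
  shows "ginf W < ginf ((gcycling ^^ (len D - 1)) W)"
proof -
  let ?u = "ginf W"
  have f: "(gcycling ^^ m) W \<in> fractions" for m by (induction m) (use W in auto)
  \<comment> \<open>As long as the infimum has not risen, cycling is \<open>cyc\<close> at the fixed
    level \<open>?u\<close>. If it has risen earlier there is nothing to show, because it never
    drops.\<close>
  have *: "ginf W \<le> ginf ((gcycling ^^ m) W) \<and>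
    (ginf ((gcycling ^^ m) W) = ?u \<longrightarrow> (gcycling ^^ m) W = (cyc ?u ^^ m) W)" for m
  proof (induction m)
    case (Suc m)
    let ?V = "(gcycling ^^ m) W"
    have "Dp (ginf ?V) \<preceq> gcycling ?V"
      using cyc_ge[OF f[of m]] Dp_le_iff_ginf[OF f[of m]] by (simp add: gcycling_eq f)
    then have le: "ginf ?V \<le> ginf (gcycling ?V)" using f[of "Suc m"] Dp_le_iff_ginf by simp
    have "gcycling ?V = cyc ?u ((cyc ?u ^^ m) W)" if "ginf (gcycling ?V) = ?u"
    proof -
      have "ginf ?V = ?u" using that le Suc by simp
      then show ?thesis using Suc gcycling_eq[OF f[of m]] by simp
    qed
    then show ?case using Suc le by auto
  qed simp
  have "Dp (?u + 1) \<preceq> X * W * inverse X" using X W by (subst Dp_le_iff_ginf) auto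
  then have "Dp (?u + 1) \<preceq> (cyc ?u ^^ (len D - 1)) W"
    using raise_inf[OF W, of "inverse X" ?u] X by (simp add: grp.inverse_inverse)
  then have "?u < ginf ((cyc ?u ^^ (len D - 1)) W)"
    using Dp_le_iff_ginf[of "(cyc ?u ^^ (len D - 1)) W" "?u + 1"] W by simp
  then show ?thesis using *[of "len D - 1"] by (metis order_less_le)
qed

lemma cyc_conj_D:
  assumes "W \<in> fractions"
  shows "cyc u (Dp k * W * Dp (- k)) = Dp k * cyc u W * Dp (- k)"
proof -
  have "Dp k * W * Dp (- k) * Dp (- u) = Dp k * (W * Dp (- u)) * Dp (- k)"
    by (simp add: mult.assoc add.commute)
  then have "meet D (Dp k * W * Dp (- k) * Dp (- u)) = Dp k * meet D (W * Dp (- u)) * Dp (- k)"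
    using assms by (simp only: meet_conj mult_fractions Dp_fractions)
  then show ?thesis unfolding cyc_def by (simp add: grp_simps zpow_minus)
qed

theorem decycling_lowers_sup:
  assumes W: "W \<in> fractions" and X: "X \<in> fractions" "gsup (X * W * inverse X) < gsup W"
  shows "gsup ((gdecycling ^^ (len D - 1)) W) < gsup W"
proof -
  let ?v = "gsup W"
  have f: "(gdecycling ^^ m) W \<in> fractions" for m by (induction m) (use W in auto)
  have W': "inverse W \<in> fractions" using W by simp
  \<comment> \<open>Each decycling contributes one conjugation by \<open>D\<close> compared with
    cycling the inverse; these accumulate to \<open>D^m\<close> and leave the infimum
    unchanged.\<close>
  have *: "gsup ((gdecycling ^^ m) W) \<le> ?v \<and>
    (gsup ((gdecycling ^^ m) W) = ?v \<longrightarrow>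
       inverse ((gdecycling ^^ m) W) = Dp (int m) * (cyc (- ?v) ^^ m) (inverse W) * Dp (- int m))" for m
  proof (induction m)
    case (Suc m)
    let ?V = "(gdecycling ^^ m) W"
    let ?c = "cyc (- gsup ?V) (inverse ?V)"
    have cf: "?c \<in> fractions" using f by simp
    have e: "inverse (gdecycling ?V) = Dp 1 * ?c * Dp (- 1)"
      using gdecycling_eq[OF f[of m]] by (simp add: zpow_minus_1)
    have "- gsup ?V \<le> ginf ?c"
      using cyc_ge[of "inverse ?V" "- gsup ?V"] f Dp_le_iff_ginf[OF cf] Dp_le_iff_ginf[of "inverse ?V"]
      by (simp add: gsup_eq)
    also have "\<dots> = ginf (inverse (gdecycling ?V))"
      unfolding e using ginf_conj_Dp[OF cf, of 1] by simp
    finally have le: "gsup (gdecycling ?V) \<le> gsup ?V" using f[of "Suc m"] by (simp add: gsup_eq)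
    have "inverse (gdecycling ?V) = Dp (int (Suc m)) * (cyc (- ?v) ^^ Suc m) (inverse W) * Dp (- int (Suc m))"
      if "gsup (gdecycling ?V) = ?v"
    proof -
      have eq: "gsup ?V = ?v" using that le Suc by simp
      have "?c = Dp (int m) * (cyc (- ?v) ^^ Suc m) (inverse W) * Dp (- int m)"
        using Suc eq W' by (simp add: cyc_conj_D)
      then show ?thesis unfolding e
        by (simp add: mult.assoc add.commute) (simp flip: mult.assoc zpow_Suc')
    qed
    then show ?case using Suc le by simp
  qed simp
  have "ginf (inverse W) < ginf (X * inverse W * inverse X)"
    using X W gsup_eq[of W] gsup_eq[of "X * W * inverse X"] by (simp add: grp_simps)
  then have "Dp (- ?v + 1) \<preceq> X * inverse W * inverse X"
    using X W gsup_eq by (subst Dp_le_iff_ginf) auto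
  then have r: "Dp (- ?v + 1) \<preceq> (cyc (- ?v) ^^ (len D - 1)) (inverse W)"
    using raise_inf[OF W', of "inverse X" "- ?v"] X by (simp add: grp.inverse_inverse)
  show ?thesis
  proof (rule ccontr)
    let ?m = "len D - 1"
    let ?C = "(cyc (- ?v) ^^ ?m) (inverse W)"
    assume "\<not> ?thesis"
    then have eq: "gsup ((gdecycling ^^ ?m) W) = ?v" using *[of ?m] by simp
    then have "ginf (inverse ((gdecycling ^^ ?m) W)) = ginf ?C"
      using *[of ?m] ginf_conj_Dp[of ?C "int ?m"] W' by simp
    moreover have "- ?v + 1 \<le> ginf ?C" using r Dp_le_iff_ginf[of ?C] W' by simp
    ultimately show False using eq gsup_eq[OF f[of ?m]] by simp
  qed
qed

end

section \<open>From a presentation to a Garside group\<close>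

text \<open>Hypotheses that can be checked below \<open>D\<close>: a common multiple of two atoms is
  tested only against simple elements, and the relations have simple values. The Garside structure
  on all of \<open>P\<close> is derived from them.\<close>

locale germ = positive_cone P D len
  for P :: "'g::mult_group set" and D :: 'g and len :: "'g \<Rightarrow> nat" +
  fixes X :: "'a set" and R :: "('a list \<times> 'a list) set" and \<iota> :: "'a \<Rightarrow> 'g"
  assumes P_words: "P = weval \<iota> ` lists X"
    and faithful: "u \<in> lists X \<Longrightarrow> v \<in> lists X \<Longrightarrow> weval \<iota> u = weval \<iota> v \<Longrightarrow>
      word_eq (X \<times> UNIV) (signed_rels X R) (positive_word u) (positive_word v)"
    and rel_words: "(u, v) \<in> R \<Longrightarrow> u \<in> lists X \<and> v \<in> lists X \<and> weval \<iota> u = weval \<iota> v"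
    and rel_simple: "(u, v) \<in> R \<Longrightarrow> weval \<iota> u \<in> simples"
    and atom_simple: "a \<in> X \<Longrightarrow> \<iota> a \<in> simples"
    and atom_neq_1: "a \<in> X \<Longrightarrow> \<iota> a \<noteq> 1"
    and atom_lcm: "a \<in> X \<Longrightarrow> b \<in> X \<Longrightarrow>
      \<exists>m\<in>P. \<iota> a \<preceq> m \<and> \<iota> b \<preceq> m \<and> (\<forall>x\<in>simples. \<iota> a \<preceq> x \<longrightarrow> \<iota> b \<preceq> x \<longrightarrow> m \<preceq> x)"
    and D_not_1: "D \<noteq> 1"
begin

lemma atom_P: "a \<in> X \<Longrightarrow> \<iota> a \<in> P"
  using atom_simple simplesD by blast

lemma P_cases:
  assumes "p \<in> P" "p \<noteq> 1" obtains a q where "a \<in> X" "q \<in> P" "p = \<iota> a * q"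
proof -
  obtain w where w: "w \<in> lists X" "p = weval \<iota> w" using assms P_words by blast
  then obtain a w' where "w = a # w'" using assms(2) by (cases w) auto
  then show ?thesis using that[of a "weval \<iota> w'"] w P_words by auto
qed

text \<open>If atoms have least common multiples inside a set \<open>Q\<close> that is closed under removing left factors,
  then \<open>Q\<close> has greatest common divisors: by a diamond argument, two common divisors of \<open>x\<close> and
  \<open>y\<close> have a common multiple that still divides \<open>x\<close> and \<open>y\<close>.\<close>

lemma common_divisors_directed:
  assumes Q: "Q \<subseteq> P" "\<And>x y. x \<in> P \<Longrightarrow> x * y \<in> Q \<Longrightarrow> y \<in> P \<Longrightarrow> y \<in> Q"
    and lcm: "\<And>a b. a \<in> X \<Longrightarrow> b \<in> X \<Longrightarrow>
      \<exists>m\<in>P. \<iota> a \<preceq> m \<and> \<iota> b \<preceq> m \<and> (\<forall>x\<in>Q. \<iota> a \<preceq> x \<longrightarrow> \<iota> b \<preceq> x \<longrightarrow> m \<preceq> x)"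
    and "x \<in> Q" "y \<in> Q" "c \<in> P" "d \<in> P" "c \<preceq> x" "c \<preceq> y" "d \<preceq> x" "d \<preceq> y"
  shows "\<exists>e\<in>P. c \<preceq> e \<and> d \<preceq> e \<and> e \<preceq> x \<and> e \<preceq> y"
  using assms(4-)
proof (induction "len x" arbitrary: x y c d rule: less_induct)
  case less
  show ?case
  proof (cases "c = 1 \<or> d = 1")
    case True
    then show ?thesis using less.prems by auto
  next
    case False
    obtain a c' where c: "a \<in> X" "c' \<in> P" "c = \<iota> a * c'" using P_cases less.prems False by metis
    obtain b d' where d: "b \<in> X" "d' \<in> P" "d = \<iota> b * d'" using P_cases less.prems False by metis
    obtain m where m: "m \<in> P" "\<iota> a \<preceq> m" "\<iota> b \<preceq> m"
      "\<And>x. x \<in> Q \<Longrightarrow> \<iota> a \<preceq> x \<Longrightarrow> \<iota> b \<preceq> x \<Longrightarrow> m \<preceq> x"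
      using lcm[OF c(1) d(1)] by blast
    have ab: "\<iota> a \<in> P" "\<iota> b \<in> P" using atom_P c d by auto
    have div: "\<iota> a \<preceq> z \<and> \<iota> b \<preceq> z \<and> m \<preceq> z" if "z \<in> Q" "c \<preceq> z" "d \<preceq> z" for z
      using that c d m by (metis le_mult le_trans)
    obtain u where u: "u \<in> P" "m = \<iota> a * u" using m(2) by (elim leE)
    obtain v where v: "v \<in> P" "m = \<iota> b * v" using m(3) by (elim leE)
    have quot: "\<exists>z'. z' \<in> Q \<and> z = \<iota> s * z'" if "z \<in> Q" "\<iota> s \<preceq> z" "s \<in> X" for z s
      using that Q by (metis atom_P leE)
    have dx: "\<iota> a \<preceq> x" "\<iota> b \<preceq> x" "\<iota> a \<preceq> y" "\<iota> b \<preceq> y" and mxy: "m \<preceq> x" "m \<preceq> y"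
      using div[of x] div[of y] less.prems by auto
    obtain xa where xa: "xa \<in> Q" "x = \<iota> a * xa" using quot[OF _ dx(1) c(1)] less.prems by blast
    obtain xb where xb: "xb \<in> Q" "x = \<iota> b * xb" using quot[OF _ dx(2) d(1)] less.prems by blast
    obtain ya where ya: "ya \<in> Q" "y = \<iota> a * ya" using quot[OF _ dx(3) c(1)] less.prems by blast
    obtain yb where yb: "yb \<in> Q" "y = \<iota> b * yb" using quot[OF _ dx(4) d(1)] less.prems by blast
    note q = xa(2) ya(2) xb(2) yb(2)
    have QP: "z \<in> Q \<Longrightarrow> z \<in> P" for z using Q(1) by blast
    have len_pos: "len (\<iota> s) > 0" if "s \<in> X" for s
      using len_0[OF atom_P[OF that]] atom_neq_1[OF that] by auto
    have "len x = len (\<iota> a) + len xa" "len x = len (\<iota> b) + len xb"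
      using len_mult[OF ab(1) QP[OF xa(1)]] len_mult[OF ab(2) QP[OF xb(1)]] xa(2) xb(2) by metis+
    then have less': "len xa < len x" "len xb < len x"
      using len_pos[OF c(1)] len_pos[OF d(1)] by simp_all
    have cd: "c' \<preceq> xa" "c' \<preceq> ya" "d' \<preceq> xb" "d' \<preceq> yb" "u \<preceq> xa" "u \<preceq> ya"
      using less.prems(5-8) mxy c(3) d(3) u(2) xa(2) xb(2) ya(2) yb(2) by (metis le_left)+
    \<comment> \<open>First corner of the diamond, after removing \<open>a\<close>:
      \<open>c'\<close> is joined with the complement \<open>u\<close> of \<open>a\<close> in
      \<open>m\<close>. The result \<open>a e1\<close> is a multiple of \<open>c\<close> and,
      through \<open>m\<close>, of \<open>b\<close>.\<close>
    obtain e1 where e1: "e1 \<in> P" "c' \<preceq> e1" "u \<preceq> e1" "e1 \<preceq> xa" "e1 \<preceq> ya"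
      using less.hyps[OF less'(1) xa(1) ya(1) c(2) u(1) cd(1,2,5,6)] by blast
    obtain f where f: "f \<in> P" "e1 = u * f" using e1(3) by (elim leE)
    have eq: "\<iota> a * e1 = \<iota> b * (v * f)" using u v f by (metis mult.assoc)
    have "\<iota> a * e1 \<preceq> x" "\<iota> a * e1 \<preceq> y" using e1 q by (metis le_left)+
    then have "v * f \<preceq> xb" "v * f \<preceq> yb" unfolding eq using q by (metis le_left)+
    moreover have "v * f \<in> P" using v f by simp
    \<comment> \<open>Second corner, after removing \<open>b\<close>: what remains of
      \<open>a e1\<close>, namely \<open>v f\<close>, is joined with \<open>d'\<close>.\<close>
    ultimately obtain e2 where e2: "e2 \<in> P" "v * f \<preceq> e2" "d' \<preceq> e2" "e2 \<preceq> xb" "e2 \<preceq> yb"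
      using less.hyps[OF less'(2) xb(1) yb(1) _ d(2) _ _ cd(3,4)] by blast
    have "c \<preceq> \<iota> b * e2" using e1(2) e2(2) c(3) eq by (metis le_left le_trans)
    moreover have "d \<preceq> \<iota> b * e2" using e2(3) d(3) by simp
    moreover have "\<iota> b * e2 \<preceq> x" "\<iota> b * e2 \<preceq> y" using e2(4,5) xb(2) yb(2) by (metis le_left)+
    moreover have "\<iota> b * e2 \<in> P" using ab e2 by simp
    ultimately show ?thesis by blast
  qed
qed

lemma gcd_exists:
  assumes Q: "Q \<subseteq> P" "\<And>x y. x \<in> P \<Longrightarrow> x * y \<in> Q \<Longrightarrow> y \<in> P \<Longrightarrow> y \<in> Q"
    and lcm: "\<And>a b. a \<in> X \<Longrightarrow> b \<in> X \<Longrightarrow>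
      \<exists>m\<in>P. \<iota> a \<preceq> m \<and> \<iota> b \<preceq> m \<and> (\<forall>x\<in>Q. \<iota> a \<preceq> x \<longrightarrow> \<iota> b \<preceq> x \<longrightarrow> m \<preceq> x)"
    and xy: "x \<in> Q" "y \<in> Q"
  shows "\<exists>d\<in>P. \<forall>z\<in>P. z \<preceq> d \<longleftrightarrow> z \<preceq> x \<and> z \<preceq> y"
proof -
  let ?C = "\<lambda>d. d \<in> P \<and> d \<preceq> x \<and> d \<preceq> y"
  have "?C 1" using xy Q by auto
  moreover have "\<And>d. ?C d \<Longrightarrow> len d < len x + 1" using len_le[of _ x] by fastforce
  \<comment> \<open>A longest common divisor absorbs every other one: a join of the two that still
    divides \<open>x\<close> and \<open>y\<close> cannot be longer.\<close>
  ultimately obtain d where d: "?C d" "\<And>e. ?C e \<Longrightarrow> len e \<le> len d"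
    using ex_has_greatest_nat[of ?C 1 len "len x + 1"] by blast
  have "z \<preceq> d" if z: "?C z" for z
  proof -
    obtain e where e: "e \<in> P" "z \<preceq> e" "d \<preceq> e" "e \<preceq> x" "e \<preceq> y"
    proof -
      have "\<exists>e\<in>P. z \<preceq> e \<and> d \<preceq> e \<and> e \<preceq> x \<and> e \<preceq> y"
      proof (rule common_divisors_directed[of Q])
        show "Q \<subseteq> P" by (rule Q(1))
        show "\<And>x y. x \<in> P \<Longrightarrow> x * y \<in> Q \<Longrightarrow> y \<in> P \<Longrightarrow> y \<in> Q" by (rule Q(2))
        show "\<And>a b. a \<in> X \<Longrightarrow> b \<in> X \<Longrightarrow>
          \<exists>m\<in>P. \<iota> a \<preceq> m \<and> \<iota> b \<preceq> m \<and> (\<forall>x\<in>Q. \<iota> a \<preceq> x \<longrightarrow> \<iota> b \<preceq> x \<longrightarrow> m \<preceq> x)"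
          by (rule lcm)
      qed (use xy z d(1) in simp_all)
      then show thesis using that by blast
    qed
    then have "d = e" using d len_le[of d e] by (intro len_eq) (auto intro: antisym)
    then show ?thesis using e by simp
  qed
  then show ?thesis using d(1) le_trans by metis
qed

section \<open>Simple elements, their gcds, and the transducer\<close>

lemma simple_mult_le: "s \<in> simples \<Longrightarrow> s * m \<preceq> D \<longleftrightarrow> m \<preceq> inverse s * D"
  by (simp add: le_def grp_simps)

text \<open>For the right factor: \<open>x y r = D\<close> implies
  \<open>y r (D^(-1) x D) = D\<close>, so \<open>x\<close> reappears at the right end, conjugated by
  \<open>D\<close>.\<close>

lemma simple_factors:
  assumes "x * y \<in> simples" "x \<in> P" "y \<in> P"
  shows "x \<in> simples" "y \<in> simples"
proof -
  have 1: "x * y \<preceq> D" using assms simplesD by blast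
  then show "x \<in> simples" using assms le_mult[of x y] le_trans unfolding simples_def by blast
  obtain r where r: "r \<in> P" "D = x * y * r" using 1 by (elim leE)
  have "D = y * (r * (inverse D * x * D))"
  proof -
    have "y * r = inverse x * D" by (simp add: r(2) grp_simps)
    then have "y * (r * (inverse D * x * D)) = inverse x * D * (inverse D * x * D)"
      by (metis mult.assoc)
    then show ?thesis by (simp add: grp_simps)
  qed
  moreover have "r * (inverse D * x * D) \<in> P" using r assms conj_D' by simp
  ultimately have "y \<preceq> D" by (metis le_mult)
  then show "y \<in> simples" using assms by (simp add: simples_def)
qed

lemma one_simple [simp]: "1 \<in> simples" and D_simple [simp]: "D \<in> simples"
  by (simp_all add: simples_def)

text \<open>Gcds of simple elements come from \<open>gcd_exists\<close> with
  \<open>Q = simples\<close>. The operation \<open>meet\<close> belongs to \<open>garside\<close>,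
  which is reached only at the end of this locale.\<close>

definition smeet :: "'g \<Rightarrow> 'g \<Rightarrow> 'g" where
  "smeet x y = (SOME d. d \<in> P \<and> (\<forall>z\<in>P. z \<preceq> d \<longleftrightarrow> z \<preceq> x \<and> z \<preceq> y))"

lemma smeet:
  assumes "x \<in> simples" "y \<in> simples"
  shows smeet_P: "smeet x y \<in> P" and le_smeet: "z \<in> P \<Longrightarrow> z \<preceq> smeet x y \<longleftrightarrow> z \<preceq> x \<and> z \<preceq> y"
proof -
  have "\<exists>d\<in>P. \<forall>z\<in>P. z \<preceq> d \<longleftrightarrow> z \<preceq> x \<and> z \<preceq> y"
  proof (rule gcd_exists[of simples])
    show "simples \<subseteq> P" using simplesD by auto
    show "\<And>x y. x \<in> P \<Longrightarrow> x * y \<in> simples \<Longrightarrow> y \<in> P \<Longrightarrow> y \<in> simples"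
      using simple_factors by blast
  qed (fact assms atom_lcm)+
  then show "smeet x y \<in> P" "z \<in> P \<Longrightarrow> z \<preceq> smeet x y \<longleftrightarrow> z \<preceq> x \<and> z \<preceq> y"
    using someI_ex[of "\<lambda>d. d \<in> P \<and> (\<forall>z\<in>P. z \<preceq> d \<longleftrightarrow> z \<preceq> x \<and> z \<preceq> y)"]
    unfolding smeet_def by blast+
qed

lemma smeet_le: "x \<in> simples \<Longrightarrow> y \<in> simples \<Longrightarrow> smeet x y \<preceq> x"
  "x \<in> simples \<Longrightarrow> y \<in> simples \<Longrightarrow> smeet x y \<preceq> y"
  using le_smeet[of x y "smeet x y"] smeet_P[of x y] by auto

lemma smeet_eqI:
  assumes "x \<in> simples" "y \<in> simples" "d \<in> P" "d \<preceq> x" "d \<preceq> y"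
    and "\<And>z. z \<in> P \<Longrightarrow> z \<preceq> x \<Longrightarrow> z \<preceq> y \<Longrightarrow> z \<preceq> d"
  shows "smeet x y = d"
  by (rule le_antisym) (use assms smeet_P smeet_le le_smeet in auto)

abbreviation star :: "'g \<Rightarrow> 'g" where "star s \<equiv> inverse s * D"

text \<open>Multiplying a sequence of factors by a simple element \<open>s\<close> from the left is done by a transducer:
  in state \<open>s\<close> it reads \<open>h\<close>, writes the head of \<open>s * h\<close>, and passes to the remaining factor.\<close>

definition out :: "'g \<Rightarrow> 'g \<Rightarrow> 'g" where "out s h = s * smeet h (star s)"

definition carry :: "'g \<Rightarrow> 'g \<Rightarrow> 'g" where "carry s h = inverse (smeet h (star s)) * h"

lemma out_simple: assumes "s \<in> simples" "h \<in> simples" shows "out s h \<in> simples"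
  using smeet_le(2)[OF assms(2) star_simple[OF assms(1)]] smeet_P[OF assms(2) star_simple[OF assms(1)]]
    simplesD[OF assms(1)] simple_mult_le[OF assms(1)] by (auto simp: out_def simples_def)

lemma carry_simple: assumes "s \<in> simples" "h \<in> simples" shows "carry s h \<in> simples"
proof (rule simple_factors(2))
  show "smeet h (star s) * carry s h \<in> simples" using assms by (simp add: carry_def inv_cancel)
  show "smeet h (star s) \<in> P" "carry s h \<in> P"
    using smeet_le(1)[OF assms(2) star_simple[OF assms(1)]] smeet_P[OF assms(2) star_simple[OF assms(1)]]
    by (auto simp: carry_def le_def)
qed

lemma le_out:
  assumes "s \<in> simples" "h \<in> simples" "z \<in> P" "z \<preceq> h" "s * z \<preceq> D"
  shows "s * z \<preceq> out s h"
  using le_smeet[OF assms(2) star_simple[OF assms(1)] assms(3)] assms simple_mult_le by (simp add: out_def)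

lemma out_ge: "s \<in> simples \<Longrightarrow> h \<in> simples \<Longrightarrow> s \<preceq> out s h"
  using smeet_P star_simple by (simp add: out_def)

lemma out_le: "s \<in> simples \<Longrightarrow> h \<in> simples \<Longrightarrow> out s h \<preceq> s * h"
  using smeet_le star_simple by (simp add: out_def)

text \<open>As \<open>b\<close> divides \<open>star a\<close>, the gcd of \<open>b m\<close> with
  \<open>star a\<close> is \<open>b\<close> times the gcd of \<open>h\<close> with
  \<open>star (a * b)\<close>. Two passes of the transducer thus amount to a single one, which makes
  the action multiplicative.\<close>

lemma out_carry:
  assumes a: "a \<in> simples" and b: "b \<in> simples" and ab: "a * b \<in> simples" and h: "h \<in> simples"
  shows "out a (out b h) = out (a * b) h" "carry a (out b h) * carry b h = carry (a * b) h"
proof -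
  define m where "m = smeet h (star b)"
  define n where "n = smeet h (star (a * b))"
  note st = star_simple[OF a] star_simple[OF b] star_simple[OF ab]
  have m: "m \<in> P" "m \<preceq> h" "m \<preceq> star b"
    using smeet_P[OF h st(2)] smeet_le[OF h st(2)] by (simp_all add: m_def)
  have n: "n \<in> P" "n \<preceq> h" "n \<preceq> star (a * b)"
    using smeet_P[OF h st(3)] smeet_le[OF h st(3)] by (simp_all add: n_def)
  have s1: "x \<preceq> star (a * b) \<longleftrightarrow> b * x \<preceq> star a" for x
    by (simp add: le_def grp_simps)
  have "b * n \<preceq> D" using n(3) st(1) simplesD(2) le_trans unfolding s1 by blast
  then have "n \<preceq> m" using n h st simple_mult_le[OF b] by (simp add: m_def le_smeet)
  have bm: "b * m \<in> simples" using out_simple[OF b h] by (simp add: out_def m_def)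
  have key: "smeet (b * m) (star a) = b * n"
  proof (rule smeet_eqI[OF bm st(1)])
    show "b * n \<in> P" using b n simplesD by simp
    show "b * n \<preceq> b * m" "b * n \<preceq> star a" using \<open>n \<preceq> m\<close> n s1 by auto
    fix z assume z: "z \<in> P" "z \<preceq> b * m" "z \<preceq> star a"
    let ?t = "smeet (b * m) (star a)"
    have "b \<preceq> star a" using ab simple_mult_le[OF a] simplesD by blast
    then have "b \<preceq> ?t" using b m simplesD le_smeet[OF bm st(1)] by simp
    then obtain t' where t': "t' \<in> P" "?t = b * t'" by (elim leE)
    have "?t \<preceq> b * m" "?t \<preceq> star a" using smeet_le[OF bm st(1)] by auto
    then have "t' \<preceq> m" "t' \<preceq> star (a * b)" using t' s1 by auto
    then have "t' \<preceq> n" using t' m le_trans le_smeet[OF h st(3)] by (metis n_def)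
    then have "?t \<preceq> b * n" using t' by simp
    moreover have "z \<preceq> ?t" using z le_smeet[OF bm st(1)] by simp
    ultimately show "z \<preceq> b * n" using le_trans by blast
  qed
  show "out a (out b h) = out (a * b) h"
    using key by (simp add: out_def mult.assoc flip: m_def n_def)
  show "carry a (out b h) * carry b h = carry (a * b) h"
    using key by (simp add: out_def carry_def grp_simps flip: m_def n_def)
       (simp add: grp_simps m_def n_def)?
qed

text \<open>Greediness phrased through the complement: no nontrivial part of \<open>y\<close> can be
  moved into \<open>x\<close> without leaving the divisors of \<open>D\<close>. This avoids the head
  of \<open>x * y\<close>, whose existence is still open here.\<close>

definition gpair :: "'g \<Rightarrow> 'g \<Rightarrow> bool" where "gpair x y \<longleftrightarrow> smeet y (star x) = 1"

lemma gpair_out: "gpair x y \<Longrightarrow> out x y = x" "gpair x y \<Longrightarrow> carry x y = y"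
  by (simp_all add: gpair_def out_def carry_def grp_simps)

text \<open>Let \<open>m\<close> be the part of \<open>x\<close> absorbed into \<open>s\<close>. If
  \<open>z\<close> could be moved between the outputs, \<open>m z\<close> would divide
  \<open>star s\<close> and also \<open>x\<close>, because \<open>x\<close> absorbs nothing from
  \<open>y\<close> and two passes amount to one. So \<open>m z\<close> divides
  \<open>m\<close>.\<close>

lemma gpair_out_carry:
  assumes x: "x \<in> simples" and y: "y \<in> simples" and s: "s \<in> simples" and g: "gpair x y"
  shows "gpair (out s x) (out (carry s x) y)"
proof -
  let ?c = "carry s x" let ?o = "out s x"
  define m where "m = smeet x (star s)"
  have m: "m \<in> P" using smeet_P[OF x star_simple[OF s]] by (simp add: m_def)
  have c: "?c \<in> simples" and o: "?o \<in> simples" "out ?c y \<in> simples"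
    using carry_simple out_simple s x y by auto
  have mc: "m * ?c = x" by (simp add: carry_def m_def grp_simps)
  then have ms: "m \<in> simples" using simple_factors[of m ?c] x m c simplesD by auto
  show ?thesis unfolding gpair_def
  proof (rule smeet_eqI[OF o(2) star_simple[OF o(1)]])
    fix z assume z: "z \<in> P" "z \<preceq> out ?c y" "z \<preceq> star ?o"
    have mz: "m * z \<preceq> star s" using z(3) by (simp add: out_def le_def grp_simps flip: m_def)
    then have "m * z \<preceq> D" using star_simple[OF s] simplesD le_trans by blast
    then have "m * z \<preceq> out m (out ?c y)" using z ms o by (intro le_out) auto
    also have "\<dots> = x" using out_carry(1)[OF ms c _ y] mc x g gpair_out by simp
    finally have "m * z \<preceq> m" using mz z m by (simp add: m_def le_smeet x star_simple s)
    then show "z \<preceq> 1" using le_left[of m z 1] by simp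
  qed (use o(2) star_simple[OF o(1)] simplesD in \<open>auto\<close>)
qed

lemma smeet_absorb: "x \<in> simples \<Longrightarrow> y \<in> simples \<Longrightarrow> x \<preceq> y \<Longrightarrow> smeet x y = x"
  "x \<in> simples \<Longrightarrow> y \<in> simples \<Longrightarrow> y \<preceq> x \<Longrightarrow> smeet x y = y"
  by (rule smeet_eqI; use simplesD in auto)+

lemma out_D: assumes "s \<in> simples" shows "out s D = D" "carry s D = inverse D * s * D"
proof -
  have "smeet D (star s) = star s"
    using assms star_simple simplesD by (intro smeet_absorb(2)) auto
  then show "out s D = D" "carry s D = inverse D * s * D" by (simp_all add: out_def carry_def grp_simps)
qed

section \<open>The action of the group on sequences of simple factors\<close>

text \<open>An element of the group is recorded by its infinite normal form, a greedy sequence of simple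
  elements indexed by the integers that is constantly \<open>D\<close> far to the left; multiplication by \<open>D\<close>
  becomes a shift, so simple elements act by bijections.\<close>

definition valid :: "(int \<Rightarrow> 'g) \<Rightarrow> bool" where
  "valid x \<longleftrightarrow> (\<forall>i. x i \<in> simples) \<and> (\<forall>i. gpair (x i) (x (i + 1))) \<and> (\<exists>N. \<forall>i<N. x i = D)"

text \<open>A sequence without beginning offers no initial state. Reading \<open>D\<close>
  conjugates the state by \<open>D\<close> (\<open>out_D\<close>), so where all entries are
  \<open>D\<close> the states \<open>D^(-i) s D^i\<close> are consistent, and they are normalized so
  that index \<open>0\<close> would carry \<open>s\<close>.\<close>

definition track :: "'g \<Rightarrow> (int \<Rightarrow> 'g) \<Rightarrow> (int \<Rightarrow> 'g) \<Rightarrow> bool" where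
  "track s x \<sigma> \<longleftrightarrow> (\<exists>N. \<forall>i\<le>N. \<sigma> i = Dp (- i) * s * Dp i) \<and> (\<forall>i. \<sigma> (i + 1) = carry (\<sigma> i) (x i))"

lemma track_unique: assumes "track s x \<sigma>" "track s x \<rho>" shows "\<sigma> = \<rho>"
proof
  fix i
  obtain M N where MN: "\<forall>i\<le>M. \<sigma> i = Dp (- i) * s * Dp i" "\<forall>i\<le>N. \<rho> i = Dp (- i) * s * Dp i"
    using assms by (auto simp: track_def)
  show "\<sigma> i = \<rho> i"
  proof (cases "i \<le> min M N")
    case False
    then have "min M N \<le> i" by linarith
    then show ?thesis
      by (induction i rule: int_ge_induct) (use MN assms in \<open>auto simp: track_def\<close>)
  qed (use MN in auto)
qed

lemma track_exists:
  assumes s: "s \<in> simples" and N: "\<forall>i<N. x i = D"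
  shows "\<exists>\<sigma>. track s x \<sigma> \<and> (\<forall>i\<le>N. \<sigma> i = Dp (- i) * s * Dp i)"
proof -
  define f where "f = rec_nat (Dp (- N) * s * Dp N) (\<lambda>k r. carry r (x (N + int k)))"
  define \<sigma> where "\<sigma> i = (if i \<le> N then Dp (- i) * s * Dp i else f (nat (i - N)))" for i
  have "\<sigma> (i + 1) = carry (\<sigma> i) (x i)" for i
  proof (cases "i < N")
    case True
    have "Dp (- i) * s * Dp i \<in> simples" using conj_simple[OF s, of "- i"] by simp
    then have "carry (\<sigma> i) (x i) = inverse D * (Dp (- i) * s * Dp i) * D"
      using True N out_D by (simp add: \<sigma>_def)
    also have "\<dots> = \<sigma> (i + 1)"
      using True zpow_add[of D i 1] zpow_add[of D "- 1" "- i"]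
      by (simp add: \<sigma>_def mult.assoc zpow_minus_1) 
         (metis mult.assoc minus_add_distrib add.commute diff_conv_add_uminus)
    finally show ?thesis by simp
  next
    case False
    then have "nat (i + 1 - N) = Suc (nat (i - N))" "N + int (nat (i - N)) = i" by auto
    then show ?thesis using False by (auto simp: \<sigma>_def f_def)
  qed
  then have "track s x \<sigma> \<and> (\<forall>i\<le>N. \<sigma> i = Dp (- i) * s * Dp i)"
    unfolding track_def by (auto intro!: exI[of _ N] simp: \<sigma>_def)
  then show ?thesis by blast
qed

definition state :: "'g \<Rightarrow> (int \<Rightarrow> 'g) \<Rightarrow> int \<Rightarrow> 'g" where
  "state s x = (THE \<sigma>. track s x \<sigma>)"

lemma state_eqI: "track s x \<sigma> \<Longrightarrow> state s x = \<sigma>"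
  unfolding state_def using track_unique by (metis the_equality)

lemma state_initial:
  assumes "s \<in> simples" "\<forall>i<N. x i = D" "i \<le> N"
  shows "state s x i = Dp (- i) * s * Dp i"
  using track_exists[OF assms(1,2)] assms(3) state_eqI by metis

lemma track_state: "s \<in> simples \<Longrightarrow> valid x \<Longrightarrow> track s x (state s x)"
  using track_exists state_eqI unfolding valid_def by metis

lemma state_simple:
  assumes s: "s \<in> simples" and x: "valid x" shows "state s x i \<in> simples"
proof -
  obtain N where N: "\<forall>i<N. x i = D" using x by (auto simp: valid_def)
  have init: "state s x i \<in> simples" if "i \<le> N" for i
    using state_initial[OF s N that] conj_simple[OF s, of "- i"] by simp
  show ?thesis
  proof (cases "i \<le> N")
    case False
    then have "N \<le> i" by simp
    then show ?thesis
    proof (induction i rule: int_ge_induct)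
      case (step i)
      then show ?case using track_state[OF s x] carry_simple x by (auto simp: track_def valid_def)
    qed (simp add: init)
  qed (rule init)
qed

definition act :: "'g \<Rightarrow> (int \<Rightarrow> 'g) \<Rightarrow> int \<Rightarrow> 'g" where
  "act s x i = out (state s x i) (x i)"

lemma state_step: "s \<in> simples \<Longrightarrow> valid x \<Longrightarrow> state s x (i + 1) = carry (state s x i) (x i)"
  using track_state by (auto simp: track_def)

lemma act_initial:
  assumes "s \<in> simples" "valid x" "\<forall>i<N. x i = D" "i < N" shows "act s x i = D"
  using assms out_D state_simple by (simp add: act_def)

lemma act_valid: assumes s: "s \<in> simples" and x: "valid x" shows "valid (act s x)"
proof -
  obtain N where N: "\<forall>i<N. x i = D" using x by (auto simp: valid_def)
  have "gpair (act s x i) (act s x (i + 1))" for i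
    using gpair_out_carry[OF _ _ state_simple[OF s x]] x state_step[OF s x]
    by (simp add: act_def valid_def)
  moreover have "act s x i \<in> simples" for i
    using out_simple state_simple s x by (simp add: act_def valid_def)
  ultimately show ?thesis using act_initial[OF s x N] unfolding valid_def by blast
qed

text \<open>By \<open>out_carry\<close> the pointwise product of the two state sequences is a track
  for \<open>a * b\<close>. The products stay simple: far to the left they are conjugates of
  \<open>a * b\<close>, and \<open>carry\<close> preserves simplicity.\<close>

lemma act_mult:
  assumes a: "a \<in> simples" and b: "b \<in> simples" and ab: "a * b \<in> simples" and x: "valid x"
  shows "act (a * b) x = act a (act b x)"
proof -
  let ?\<sigma> = "state b x" let ?y = "act b x" let ?\<rho> = "state a ?y"
  have y: "valid ?y" using act_valid b x by blast
  obtain N where N: "\<forall>i<N. x i = D" using x by (auto simp: valid_def)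
  have N': "\<forall>i<N. ?y i = D" using act_initial[OF b x N] by blast
  have init: "?\<rho> i * ?\<sigma> i = Dp (- i) * (a * b) * Dp i" if "i \<le> N" for i
    using state_initial[OF a N' that] state_initial[OF b N that] by (simp add: mult.assoc)
  have sx: "\<And>i. x i \<in> simples" using x by (simp add: valid_def)
  have advance: "?\<rho> (i + 1) * ?\<sigma> (i + 1) = carry (?\<rho> i * ?\<sigma> i) (x i) \<and>
      act a ?y i = out (?\<rho> i * ?\<sigma> i) (x i)" if "?\<rho> i * ?\<sigma> i \<in> simples" for i
    using out_carry[OF state_simple[OF a y] state_simple[OF b x] that sx]
      state_step[OF a y] state_step[OF b x] by (simp add: act_def)
  have simple: "?\<rho> i * ?\<sigma> i \<in> simples" for i
  proof (cases "i \<le> N")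
    case True
    then show ?thesis using init conj_simple[OF ab, of "- i"] by simp
  next
    case False
    then have "N \<le> i" by simp
    then show ?thesis
    proof (induction i rule: int_ge_induct)
      case base
      then show ?case using init[of N] conj_simple[OF ab, of "- N"] by simp
    next
      case (step i)
      then show ?case using advance[of i] carry_simple sx by simp
    qed
  qed
  have "track (a * b) x (\<lambda>i. ?\<rho> i * ?\<sigma> i)"
    unfolding track_def using init advance[OF simple] by blast
  then have "state (a * b) x = (\<lambda>i. ?\<rho> i * ?\<sigma> i)" by (rule state_eqI)
  then show ?thesis using advance[OF simple] by (auto simp: act_def[of "a * b"])
qed

text \<open>In a greedy sequence the state just remembers the previous entry and writes it out: a
  delay by one index.\<close>

lemma act_D: assumes x: "valid x" shows "act D x = (\<lambda>i. x (i - 1))"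
proof -
  obtain N where N: "\<forall>i<N. x i = D" using x by (auto simp: valid_def)
  have gp: "gpair (x (i - 1)) (x i)" for i using x unfolding valid_def by (metis diff_add_cancel)
  have "x (i - 1) = Dp (- i) * D * Dp i" if "i \<le> N" for i
  proof -
    have "Dp (- i) * D * Dp i = D" by (simp add: mult.assoc flip: zpow_comm)
    then show ?thesis using that N by simp
  qed
  then have "track D x (\<lambda>i. x (i - 1))"
    unfolding track_def using gp gpair_out by auto
  then have "state D x = (\<lambda>i. x (i - 1))" by (rule state_eqI)
  then show ?thesis using gp gpair_out by (auto simp: act_def)
qed

lemma valid_shift: "valid x \<Longrightarrow> valid (\<lambda>i. x (i + k))"
  unfolding valid_def by (metis add.assoc add.commute less_diff_eq)

text \<open>Sequences that are not valid stay fixed, so that one obtains a bijection of the whole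
  function type.\<close>

definition vact :: "'g \<Rightarrow> (int \<Rightarrow> 'g) bij" where
  "vact s = mk_bij (\<lambda>x. if valid x then act s x else x)"

text \<open>\<open>D\<close> acts by a shift, and \<open>s\<close> is both a right and a left factor
  of \<open>D\<close>: the first gives injectivity, the second surjectivity.\<close>

lemma bij_act: assumes s: "s \<in> simples" shows "bij_betw (act s) {x. valid x} {x. valid x}"
proof -
  have star: "star s \<in> simples" "s * star s = D" using s star_simple by (auto simp: inv_cancel)
  have D1: "D * s * inverse D \<in> simples" using conj_simple[OF s, of 1] by (simp add: zpow_minus_1)
  have s': "D * inverse s \<in> simples" "D * inverse s * s = D"
    using star_simple[OF D1] by (auto simp: grp_simps)
  show ?thesis
  proof (rule bij_betw_imageI)
    show "inj_on (act s) {x. valid x}"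
    proof (rule inj_onI)
      fix x y assume xy: "x \<in> {x. valid x}" "y \<in> {x. valid x}" "act s x = act s y"
      then have "act D x = act D y" using act_mult[OF s'(1) s] s'(2) by simp
      then have "(\<lambda>i. x (i - 1)) = (\<lambda>i. y (i - 1))" using xy act_D by simp
      then show "x = y" by (metis (no_types) add_diff_cancel ext)
    qed
    show "act s ` {x. valid x} = {x. valid x}"
    proof
      show "{x. valid x} \<subseteq> act s ` {x. valid x}"
      proof
        fix y assume "y \<in> {x. valid x}"
        then have z: "valid (\<lambda>i. y (i + 1))" by (simp add: valid_shift)
        have "act s (act (star s) (\<lambda>i. y (i + 1))) = act D (\<lambda>i. y (i + 1))"
          using act_mult[OF s star(1) _ z] star(2) by simp
        also have "\<dots> = y" using act_D[OF z] by simp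
        finally show "y \<in> act s ` {x. valid x}" using act_valid[OF star(1) z] by (metis image_eqI mem_Collect_eq)
      qed
    qed (use act_valid s in auto)
  qed
qed

lemma app_vact: assumes "s \<in> simples" shows "app (vact s) x = (if valid x then act s x else x)"
proof -
  have "bij_betw (\<lambda>x. if valid x then act s x else x) ({x. valid x} \<union> {x. \<not> valid x}) ({x. valid x} \<union> {x. \<not> valid x})"
  proof (rule bij_betw_combine)
    show "bij_betw (\<lambda>x. if valid x then act s x else x) {x. valid x} {x. valid x}"
      using bij_act[OF assms] by (subst bij_betw_cong[of _ _ "act s"]) auto
    show "bij_betw (\<lambda>x. if valid x then act s x else x) {x. \<not> valid x} {x. \<not> valid x}"
      by (subst bij_betw_cong[of _ _ "\<lambda>x. x"]) (auto simp: bij_betw_def)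
  qed auto
  moreover have "{x. valid x} \<union> {x. \<not> valid x} = UNIV" by auto
  ultimately show ?thesis unfolding vact_def by (simp add: app_mk_bij)
qed

lemma vact_mult:
  assumes "a \<in> simples" "b \<in> simples" "a * b \<in> simples"
  shows "vact (a * b) = vact a * vact b"
  by (rule bij_eqI) (use assms act_mult act_valid in \<open>auto simp: app_vact\<close>)

lemma vact_1: "vact 1 = 1"
  using vact_mult[of 1 1] mult_left_cancel'[of "vact 1" "vact 1" 1] by simp

lemma weval_P: "w \<in> lists X \<Longrightarrow> weval \<iota> w \<in> P"
  using P_words by blast

lemma weval_vact:
  assumes "w \<in> lists X" "weval \<iota> w \<in> simples"
  shows "weval (\<lambda>a. vact (\<iota> a)) w = vact (weval \<iota> w)"
  using assms
proof (induction w)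
  case (Cons a w)
  then have "weval \<iota> w \<in> simples" "\<iota> a \<in> simples"
    using simple_factors[of "\<iota> a" "weval \<iota> w"] weval_P[of w] atom_P by auto
  then show ?case using Cons vact_mult[of "\<iota> a" "weval \<iota> w"] by simp
qed (simp add: vact_1)

text \<open>Generators act by bijections, so derivations through negative letters are covered. The
  two sides of a relation have the same simple value, and a word with simple value acts as that
  value does.\<close>

lemma vact_well_defined:
  assumes "u \<in> lists X" "v \<in> lists X" "weval \<iota> u = weval \<iota> v"
  shows "weval (\<lambda>a. vact (\<iota> a)) u = weval (\<lambda>a. vact (\<iota> a)) v"
proof -
  have "weval (sgn_ext (\<lambda>a. vact (\<iota> a))) (positive_word u) = weval (sgn_ext (\<lambda>a. vact (\<iota> a))) (positive_word v)"
  proof (rule signed_word_eq_weval[OF faithful[OF assms]])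
    fix v w assume "(v, w) \<in> R"
    then show "weval (\<lambda>a. vact (\<iota> a)) v = weval (\<lambda>a. vact (\<iota> a)) w"
      using rel_words rel_simple by (metis weval_vact)
  qed
  then show ?thesis by simp
qed

text \<open>The infinite normal form of \<open>1\<close>.\<close>

definition base :: "int \<Rightarrow> 'g" where "base i = (if i < 0 then D else 1)"

lemma valid_base: "valid base"
proof -
  have "smeet x y = 1" if "x \<in> simples" "y \<in> simples" "x = 1 \<or> y = 1" for x y
    using that smeet_absorb simplesD by (metis le_1 one_simple)
  then have "gpair (base i) (base (i + 1))" for i
    using star_simple[of "base i"] by (auto simp: gpair_def base_def left_inv)
  then show ?thesis unfolding valid_def by (auto simp: base_def intro: exI[of _ 0])
qed

text \<open>Entry \<open>0\<close> will turn out to be the head of the element; this is the half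
  saying that it divides the element. Since the entries left of \<open>0\<close> remain
  \<open>D\<close>, a generator is in its own state when it arrives at index
  \<open>0\<close>.\<close>

lemma nonneg_weval:
  assumes "w \<in> lists X"
  shows "valid (app (weval (\<lambda>a. vact (\<iota> a)) w) base) \<and>
    (\<forall>i<0. app (weval (\<lambda>a. vact (\<iota> a)) w) base i = D) \<and>
    app (weval (\<lambda>a. vact (\<iota> a)) w) base 0 \<preceq> weval \<iota> w"
  using assms
proof (induction w)
  case Nil
  have "base 0 = 1" "\<forall>i<0. base i = D" by (simp_all add: base_def)
  then show ?case using valid_base by simp
next
  case (Cons a w)
  let ?y = "app (weval (\<lambda>a. vact (\<iota> a)) w) base"
  have a: "\<iota> a \<in> simples" using Cons.hyps atom_simple by simp
  have y: "valid ?y" "\<forall>i<0. ?y i = D" "?y 0 \<preceq> weval \<iota> w" "?y 0 \<in> simples"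
    using Cons by (auto simp: valid_def)
  have "act (\<iota> a) ?y 0 = out (\<iota> a) (?y 0)"
    using state_initial[OF a y(2), of 0] by (simp add: act_def)
  also have "\<dots> \<preceq> \<iota> a * ?y 0" using out_le a y by blast
  also have "\<iota> a * ?y 0 \<preceq> \<iota> a * weval \<iota> w" using y by simp
  finally show ?case using a y act_valid act_initial[OF a y(1,2)] by (simp add: app_vact)
qed

text \<open>If \<open>s\<close> divides \<open>p\<close>, the word for \<open>p\<close> may be
  exchanged for one that begins with a word for \<open>s\<close> without changing the action. Then
  \<open>s\<close> acts last, is in state \<open>s\<close> at index \<open>0\<close>, and writes a
  multiple of \<open>s\<close>.\<close>

lemma head_exists:
  assumes "p \<in> P"
  shows "\<exists>h\<in>simples. h \<preceq> p \<and> (\<forall>s\<in>simples. s \<preceq> p \<longrightarrow> s \<preceq> h)"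
proof -
  obtain w where w: "w \<in> lists X" "p = weval \<iota> w" using assms P_words by blast
  let ?h = "app (weval (\<lambda>a. vact (\<iota> a)) w) base 0"
  have "s \<preceq> ?h" if s: "s \<in> simples" "s \<preceq> p" for s
  proof -
    obtain p' where p': "p' \<in> P" "p = s * p'" using s by (elim leE)
    obtain u v where uv: "u \<in> lists X" "s = weval \<iota> u" "v \<in> lists X" "p' = weval \<iota> v"
      using s p' simplesD P_words by blast
    let ?y = "app (weval (\<lambda>a. vact (\<iota> a)) v) base"
    have y: "valid ?y" "\<forall>i<0. ?y i = D" "?y 0 \<in> simples"
      using nonneg_weval[OF uv(3)] by (auto simp: valid_def)
    have "weval (\<lambda>a. vact (\<iota> a)) w = vact s * weval (\<lambda>a. vact (\<iota> a)) v"
      using vact_well_defined[of w "u @ v"] w uv p' weval_vact[OF uv(1)] s by simp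
    then have "?h = out s (?y 0)"
      using s y state_initial[OF s(1) y(2), of 0] by (simp add: app_vact act_def)
    then show ?thesis using out_ge s y by simp
  qed
  moreover have "?h \<preceq> p" "?h \<in> simples" using nonneg_weval[OF w(1)] w by (auto simp: valid_def)
  ultimately show ?thesis by blast
qed

lemma garside: "garside P D len"
proof
  show "D \<noteq> 1" by (rule D_not_1)
  show "\<exists>k. x \<preceq> Dp k" if "x \<in> P" for x
  proof -
    have "w \<in> lists X \<Longrightarrow> \<exists>k. weval \<iota> w \<preceq> Dp k" for w
    proof (induction w)
      case Nil
      then show ?case by (intro exI[of _ 0]) simp
    next
      case (Cons a w)
      then obtain k where k: "weval \<iota> w \<preceq> Dp k" by auto
      have "weval \<iota> (a # w) \<preceq> \<iota> a * Dp k" using k by simp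
      also have "\<dots> \<preceq> D * Dp k" using Cons.prems atom_simple simplesD by simp
      also have "\<dots> = Dp (k + 1)" by (simp add: zpow_Suc)
      finally show ?case ..
    qed
    then show ?thesis using that P_words by blast
  qed
  show "\<exists>d\<in>P. \<forall>z\<in>P. (z \<preceq> d) = (z \<preceq> x \<and> z \<preceq> y)" if "x \<in> P" "y \<in> P" for x y
  proof (rule gcd_exists[of P])
    fix a b assume ab: "a \<in> X" "b \<in> X"
    obtain m where m: "m \<in> P" "\<iota> a \<preceq> m" "\<iota> b \<preceq> m"
      "\<forall>x\<in>simples. \<iota> a \<preceq> x \<longrightarrow> \<iota> b \<preceq> x \<longrightarrow> m \<preceq> x"
      using atom_lcm[OF ab] by blast
    \<comment> \<open>Two atoms dividing \<open>x\<close> divide its head, and the head is simple,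
      so \<open>atom_lcm\<close> applies to it.\<close>
    have "m \<preceq> x" if x: "x \<in> P" "\<iota> a \<preceq> x" "\<iota> b \<preceq> x" for x
    proof -
      obtain h where "h \<in> simples" "h \<preceq> x" "\<iota> a \<preceq> h" "\<iota> b \<preceq> h"
        using head_exists[OF x(1)] x atom_simple ab by blast
      then show ?thesis using m(4) le_trans by blast
    qed
    then show "\<exists>m\<in>P. \<iota> a \<preceq> m \<and> \<iota> b \<preceq> m \<and> (\<forall>x\<in>P. \<iota> a \<preceq> x \<longrightarrow> \<iota> b \<preceq> x \<longrightarrow> m \<preceq> x)"
      using m by blast
  qed (use that in auto)
qed

end

section \<open>Presentations with a permutation model\<close>

text \<open>The letters of \<open>u\<close> are stripped from the left of \<open>w\<close>, each
  lowering \<open>e\<close>. For \<open>w\<close> in \<open>N\<close> this makes \<open>u\<close>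
  the beginning of a reduced word of \<open>w\<close> (\<open>descends_reduced\<close>).\<close>

fun descends :: "('a \<Rightarrow> 'h::mult_group) \<Rightarrow> ('h \<Rightarrow> nat) \<Rightarrow> 'h \<Rightarrow> 'a list \<Rightarrow> bool" where
  "descends \<rho> e w [] = True"
| "descends \<rho> e w (a # u) = (e (\<rho> a * w) < e w \<and> descends \<rho> e (\<rho> a * w) u)"

text \<open>\<open>\<rho>\<close> represents the generators by involutions, \<open>e\<close> is a length function on the represented group, and
  \<open>N\<close> is the set of elements below the image of the fundamental word \<open>dw\<close>.\<close>

locale braid_model =
  fixes X :: "'a set" and R :: "('a list \<times> 'a list) set" and \<iota> :: "'a \<Rightarrow> 'g::mult_group"
    and \<rho> :: "'a \<Rightarrow> 'h::mult_group" and e :: "'h \<Rightarrow> nat" and N :: "'h set" and dw :: "'a list"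
  assumes presents: "x \<in> lists (X \<times> UNIV) \<Longrightarrow> y \<in> lists (X \<times> UNIV) \<Longrightarrow>
      weval (sgn_ext \<iota>) x = weval (sgn_ext \<iota>) y \<longleftrightarrow> word_eq (X \<times> UNIV) (signed_rels X R) x y"
    and rel_lists: "(u, v) \<in> R \<Longrightarrow> u \<in> lists X \<and> v \<in> lists X \<and> length u = length v"
    and rho_rel: "(u, v) \<in> R \<Longrightarrow> weval \<rho> u = weval \<rho> v"
    and rho_inv: "a \<in> X \<Longrightarrow> \<rho> a * \<rho> a = 1"
    and e_1: "e 1 = 0"
    and e_step: "a \<in> X \<Longrightarrow> e (\<rho> a * w) \<le> e w + 1"
    and N_descent: "w \<in> N \<Longrightarrow> w \<noteq> 1 \<Longrightarrow> \<exists>a\<in>X. e (\<rho> a * w) < e w"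
    and N_closed: "w \<in> N \<Longrightarrow> a \<in> X \<Longrightarrow> e (\<rho> a * w) < e w \<Longrightarrow> \<rho> a * w \<in> N"
    and lcm_words: "a \<in> X \<Longrightarrow> b \<in> X \<Longrightarrow> \<exists>u\<in>lists X. \<exists>v\<in>lists X.
      weval \<iota> (a # u) = weval \<iota> (b # v) \<and>
      (\<forall>w\<in>N. e (\<rho> a * w) < e w \<longrightarrow> e (\<rho> b * w) < e w \<longrightarrow>
         descends \<rho> e w (a # u) \<and> descends \<rho> e w (b # v))"
    and rel_descends: "(u, v) \<in> R \<Longrightarrow> descends \<rho> e (weval \<rho> dw) u"
    and dw: "dw \<in> lists X" "dw \<noteq> []" "weval \<rho> dw \<in> N" "e (weval \<rho> dw) = length dw"
    and dw_descends: "a \<in> X \<Longrightarrow> e (\<rho> a * weval \<rho> dw) < e (weval \<rho> dw)"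
    and dw_conj: "a \<in> X \<Longrightarrow> \<exists>b\<in>X. \<rho> a * weval \<rho> dw = weval \<rho> dw * \<rho> b"
    and dw_conj': "b \<in> X \<Longrightarrow> \<exists>a\<in>X. \<rho> a * weval \<rho> dw = weval \<rho> dw * \<rho> b"
begin

abbreviation "c \<equiv> weval \<rho> dw"
abbreviation "D \<equiv> weval \<iota> dw"

definition P :: "'g set" where "P = weval \<iota> ` lists X"

lemma weval_P [simp]: "w \<in> lists X \<Longrightarrow> weval \<iota> w \<in> P"
  by (simp add: P_def)

lemma faithful:
  assumes "u \<in> lists X" "v \<in> lists X" "weval \<iota> u = weval \<iota> v"
  shows "word_eq (X \<times> UNIV) (signed_rels X R) (positive_word u) (positive_word v)"
  using presents[OF positive_word_lists positive_word_lists, of u v] assms by simp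

lemma weval_eq:
  assumes "u \<in> lists X" "v \<in> lists X" "weval \<iota> u = weval \<iota> v"
  shows rho_eq: "weval \<rho> u = weval \<rho> v" and length_eq: "length u = length v"
proof -
  have "weval (sgn_ext \<rho>) (positive_word u) = weval (sgn_ext \<rho>) (positive_word v)"
    by (rule signed_word_eq_weval[OF faithful[OF assms]]) (rule rho_rel)
  then show "weval \<rho> u = weval \<rho> v" by simp
  have "expsum (positive_word u) = expsum (positive_word v)"
    by (rule signed_word_eq_expsum[OF faithful[OF assms]]) (use rel_lists in blast)
  then show "length u = length v" by simp
qed

lemma rel_weval: assumes "(u, v) \<in> R" shows "weval \<iota> u = weval \<iota> v"
proof -
  have uv: "u \<in> lists X" "v \<in> lists X" using rel_lists[OF assms] by auto
  have "word_eq (X \<times> UNIV) (signed_rels X R) ([] @ positive_word u @ []) ([] @ positive_word v @ [])"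
    by (rule word_eq.rel) (use assms in \<open>auto simp: signed_rels_def\<close>)
  then show ?thesis using presents[OF positive_word_lists[OF uv(1)] positive_word_lists[OF uv(2)]] by simp
qed

definition len :: "'g \<Rightarrow> nat" where
  "len p = length (SOME w. w \<in> lists X \<and> weval \<iota> w = p)"

lemma len_weval: assumes "w \<in> lists X" shows "len (weval \<iota> w) = length w"
proof -
  have "\<exists>v. v \<in> lists X \<and> weval \<iota> v = weval \<iota> w" using assms by blast
  from someI_ex[OF this] show ?thesis using length_eq[OF _ assms] by (simp add: len_def)
qed

lemma e_le_length: "w \<in> lists X \<Longrightarrow> e (weval \<rho> w) \<le> length w"
proof (induction w rule: list.induct)
  case (Cons a w)
  then show ?case using e_step[of a "weval \<rho> w"] by simp
qed (simp add: e_1)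

section \<open>Reduced words\<close>

definition reduced :: "'a list \<Rightarrow> 'h \<Rightarrow> bool" where
  "reduced w v \<longleftrightarrow> w \<in> lists X \<and> weval \<rho> w = v \<and> e v = length w"

lemma rho_cancel: "a \<in> X \<Longrightarrow> \<rho> a * (\<rho> a * w) = w"
  using rho_inv[of a] by (simp flip: mult.assoc)

lemma e_drop: "a \<in> X \<Longrightarrow> e (\<rho> a * w) < e w \<Longrightarrow> e w = Suc (e (\<rho> a * w))"
  using e_step[of a "\<rho> a * w"] rho_cancel[of a w] by simp

lemma reduced_Cons:
  assumes "reduced (a # w) v" "v \<in> N"
  shows "a \<in> X" "e (\<rho> a * v) < e v" "reduced w (\<rho> a * v)" "\<rho> a * v \<in> N"
proof -
  show a: "a \<in> X" using assms by (simp add: reduced_def)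
  have w: "w \<in> lists X" "weval \<rho> w = \<rho> a * v" "e v = Suc (length w)"
    using assms rho_cancel[OF a] by (auto simp: reduced_def)
  then show *: "e (\<rho> a * v) < e v" using e_le_length[of w] by simp
  show "reduced w (\<rho> a * v)" using w e_drop[OF a *] by (simp add: reduced_def)
  show "\<rho> a * v \<in> N" using N_closed assms a * by blast
qed

lemma reduced_suffix:
  "reduced (u @ w) v \<Longrightarrow> v \<in> N \<Longrightarrow> reduced w (weval \<rho> w) \<and> weval \<rho> w \<in> N"
proof (induction u arbitrary: v)
  case Nil
  then show ?case by (auto simp: reduced_def)
next
  case (Cons a u)
  then show ?case using reduced_Cons[of a "u @ w" v] by simp
qed

lemma descends_reduced:
  "v \<in> N \<Longrightarrow> u \<in> lists X \<Longrightarrow> descends \<rho> e v u \<Longrightarrow>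
    inverse (weval \<rho> u) * v \<in> N \<and> (reduced y (inverse (weval \<rho> u) * v) \<longrightarrow> reduced (u @ y) v)"
proof (induction u arbitrary: v)
  case (Cons a u)
  have a: "a \<in> X" "e (\<rho> a * v) < e v" using Cons.prems by auto
  have inv: "inverse (\<rho> a) = \<rho> a" using inverse_unique'[OF rho_inv[OF a(1)]] .
  have *: "inverse (weval \<rho> u) * (\<rho> a * v) \<in> N \<and>
      (reduced y (inverse (weval \<rho> u) * (\<rho> a * v)) \<longrightarrow> reduced (u @ y) (\<rho> a * v))"
    using Cons N_closed[OF _ a] by simp
  then show ?case using a e_drop[OF a] rho_cancel[OF a(1)]
    by (auto simp: inv_mult inv mult.assoc reduced_def)
qed (simp add: grp.inverse_neutral)

lemma ex_reduced: "v \<in> N \<Longrightarrow> \<exists>w. reduced w v"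
proof (induction "e v" arbitrary: v rule: less_induct)
  case less
  show ?case
  proof (cases "v = 1")
    case True
    then show ?thesis using e_1 by (intro exI[of _ "[]"]) (simp add: reduced_def)
  next
    case False
    then obtain a where a: "a \<in> X" "e (\<rho> a * v) < e v" using N_descent less.prems by blast
    then obtain w where "reduced w (\<rho> a * v)" using less.hyps N_closed less.prems by blast
    then have "reduced (a # w) v" using e_drop[OF a] rho_cancel[OF a(1)] a(1)
      by (simp add: reduced_def)
    then show ?thesis ..
  qed
qed

text \<open>Matsumoto's argument: for reduced words starting with \<open>a\<close> and
  \<open>b\<close>, \<open>lcm_words\<close> supplies two reduced words of \<open>v\<close> with the
  same value, one starting with \<open>a\<close> and one with \<open>b\<close>. Each given word
  agrees with the one sharing its first letter, by induction on the tails.\<close>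

lemma reduced_unique:
  "reduced u v \<Longrightarrow> reduced u' v \<Longrightarrow> v \<in> N \<Longrightarrow> weval \<iota> u = weval \<iota> u'"
proof (induction "length u" arbitrary: u u' v)
  case 0
  then show ?case by (auto simp: reduced_def)
next
  case (Suc l)
  have "length u' = length u" using Suc.prems by (simp add: reduced_def)
  then obtain a u1 b u2 where u: "u = a # u1" "u' = b # u2" using Suc.hyps(2)
    by (metis length_Suc_conv)
  have a: "a \<in> X" "e (\<rho> a * v) < e v" "reduced u1 (\<rho> a * v)" "\<rho> a * v \<in> N"
    and b: "b \<in> X" "e (\<rho> b * v) < e v" "reduced u2 (\<rho> b * v)" "\<rho> b * v \<in> N"
    using reduced_Cons Suc.prems u by blast+
  obtain x y where xy: "x \<in> lists X" "y \<in> lists X" "weval \<iota> (a # x) = weval \<iota> (b # y)"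
    "descends \<rho> e v (a # x)" "descends \<rho> e v (b # y)"
    using lcm_words[OF a(1) b(1)] a(2) b(2) Suc.prems(3) by blast
  have ax: "a # x \<in> lists X" "b # y \<in> lists X" using xy a b by auto
  have "weval \<rho> (a # x) = weval \<rho> (b # y)" using rho_eq[OF ax xy(3)] .
  moreover obtain z where "reduced z (inverse (weval \<rho> (a # x)) * v)"
    using ex_reduced descends_reduced[OF Suc.prems(3) ax(1) xy(4)] by blast
  ultimately have "reduced ((a # x) @ z) v" "reduced ((b # y) @ z) v"
    using descends_reduced[OF Suc.prems(3) ax(1) xy(4)] descends_reduced[OF Suc.prems(3) ax(2) xy(5)]
    by auto
  then have "reduced (x @ z) (\<rho> a * v)" "reduced (y @ z) (\<rho> b * v)"
    using reduced_Cons(3)[of a "x @ z" v] reduced_Cons(3)[of b "y @ z" v] Suc.prems(3) by auto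
  moreover have "length u1 = l" "length u2 = l" using Suc.hyps(2) u \<open>length u' = length u\<close> by auto
  ultimately have "weval \<iota> u1 = weval \<iota> (x @ z)" "weval \<iota> u2 = weval \<iota> (y @ z)"
    using Suc.hyps(1) a b by metis+
  then show ?case using xy(3) u by (simp flip: mult.assoc)
qed

lemma reduced_dw: "reduced dw c"
  using dw by (simp add: reduced_def)

text \<open>For a reduced word \<open>y\<close> of \<open>\<rho> a * c\<close>, both
  \<open>a y\<close> and \<open>y b\<close> are reduced words of \<open>c\<close>, so both evaluate
  to \<open>D\<close>.\<close>

lemma conj_atom:
  assumes ab: "a \<in> X" "b \<in> X" "\<rho> a * c = c * \<rho> b"
  shows "\<iota> a * D = D * \<iota> b"
proof -
  have "\<rho> a * c \<in> N" using N_closed dw(3) ab(1) dw_descends by blast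
  then obtain y where y: "reduced y (\<rho> a * c)" using ex_reduced by blast
  have e: "e c = Suc (e (\<rho> a * c))" using e_drop[OF ab(1) dw_descends[OF ab(1)]] .
  have "reduced (a # y) c" using y e ab(1) rho_cancel[OF ab(1), of c] by (auto simp: reduced_def)
  then have 1: "D = \<iota> a * weval \<iota> y" using reduced_unique[OF reduced_dw _ dw(3)] by simp
  have "\<rho> a * c * \<rho> b = c" using ab(3) rho_cancel[OF ab(1), of c] by (metis mult.assoc)
  then have "reduced (y @ [b]) c" using y e ab(2) by (auto simp: reduced_def)
  then have "D = weval \<iota> y * \<iota> b" using reduced_unique[OF reduced_dw _ dw(3)] by fastforce
  then show ?thesis using 1 by (metis mult.assoc)
qed

sublocale positive_cone P D len
proof
  show "1 \<in> P" using weval_P[of "[]"] by simp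
  show "D \<in> P" using dw by simp
  have cases: "\<exists>w. w \<in> lists X \<and> x = weval \<iota> w" if "x \<in> P" for x using that by (auto simp: P_def)
  {
    fix x y assume "x \<in> P" "y \<in> P"
    then obtain u v where w: "u \<in> lists X" "x = weval \<iota> u" "v \<in> lists X" "y = weval \<iota> v"
      using cases by blast
    then show "x * y \<in> P" "len (x * y) = len x + len y"
      using weval_P[of "u @ v"] len_weval[of "u @ v"] len_weval[of u] len_weval[of v] by auto
  }
  {
    fix x assume "x \<in> P" "len x = 0"
    then show "x = 1" using cases[of x] len_weval by fastforce
  }
  {
    fix x assume "x \<in> P"
    have "w \<in> lists X \<Longrightarrow> \<exists>v\<in>lists X. weval \<iota> w * D = D * weval \<iota> v" for w
    proof (induction w rule: list.induct)
      case (Cons a w)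
      then obtain v where v: "v \<in> lists X" "weval \<iota> w * D = D * weval \<iota> v" by auto
      obtain b where b: "b \<in> X" "\<rho> a * c = c * \<rho> b" using dw_conj[of a] Cons.prems by auto
      have "\<iota> a * D = D * \<iota> b" using conj_atom b Cons by simp
      then have "weval \<iota> (a # w) * D = D * weval \<iota> (b # v)"
        using v by (simp add: mult.assoc) (simp flip: mult.assoc)
      then show ?case using b v by (metis Cons_in_lists_iff)
    qed (auto intro: bexI[of _ "[]"])
    moreover obtain w where "w \<in> lists X" "x = weval \<iota> w" using cases \<open>x \<in> P\<close> by blast
    ultimately obtain v where "v \<in> lists X" "x * D = D * weval \<iota> v" by blast
    then show "inverse D * x * D \<in> P" by (simp add: mult.assoc inv_cancel)
  }
  {
    fix x assume "x \<in> P"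
    have "w \<in> lists X \<Longrightarrow> \<exists>v\<in>lists X. weval \<iota> v * D = D * weval \<iota> w" for w
    proof (induction w rule: list.induct)
      case (Cons a w)
      then obtain v where v: "v \<in> lists X" "weval \<iota> v * D = D * weval \<iota> w" by auto
      obtain b where b: "b \<in> X" "\<rho> b * c = c * \<rho> a" using dw_conj'[of a] Cons.prems by auto
      have "\<iota> b * D = D * \<iota> a" using conj_atom b Cons by simp
      then have "weval \<iota> (b # v) * D = D * weval \<iota> (a # w)"
        using v by (simp add: mult.assoc) (simp flip: mult.assoc)
      then show ?case using b v by (metis Cons_in_lists_iff)
    qed (auto intro: bexI[of _ "[]"])
    moreover obtain w where "w \<in> lists X" "x = weval \<iota> w" using cases \<open>x \<in> P\<close> by blast
    ultimately obtain v where v: "v \<in> lists X" "weval \<iota> v * D = D * x" by blast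
    then have "D * x * inverse D = weval \<iota> v" by (metis mult.assoc mult_1_right right_inv)
    then show "D * x * inverse D \<in> P" using v by simp
  }
qed

notation le (infix "\<preceq>" 50)

text \<open>A word of a simple element is the tail of some word of \<open>D\<close>; that word has
  length \<open>e c\<close> and is therefore reduced, and tails of reduced words are reduced.
  Conjugation by \<open>D\<close> puts the complementary factor on the left.\<close>

lemma simple_reduced:
  assumes "weval \<iota> w \<in> simples" "w \<in> lists X"
  shows "reduced w (weval \<rho> w)" "weval \<rho> w \<in> N"
proof -
  have "inverse (weval \<iota> w) * D \<in> P" using assms by (simp add: simples_def le_def)
  then have "D * (inverse (weval \<iota> w) * D) * inverse D \<in> P" by (rule conj_D)
  then have "D * inverse (weval \<iota> w) \<in> P" by (simp add: grp_simps)
  then obtain u where u: "u \<in> lists X" "D * inverse (weval \<iota> w) = weval \<iota> u" by (auto simp: P_def)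
  then have eq: "weval \<iota> (u @ w) = D" by (metis left_inv mult.assoc mult_1_right weval_append)
  have uw: "u @ w \<in> lists X" using u assms by simp
  have "reduced (u @ w) c"
    using rho_eq[OF uw dw(1) eq] length_eq[OF uw dw(1) eq] uw dw(4) by (simp add: reduced_def)
  then show "reduced w (weval \<rho> w)" "weval \<rho> w \<in> N" using reduced_suffix dw(3) by blast+
qed

lemma descends_simple:
  assumes "u \<in> lists X" "descends \<rho> e c u"
  shows "weval \<iota> u \<in> simples"
proof -
  obtain y where "reduced y (inverse (weval \<rho> u) * c)"
    using ex_reduced descends_reduced[OF dw(3) assms] by blast
  then have "reduced (u @ y) c" "y \<in> lists X"
    using descends_reduced[OF dw(3) assms] by (auto simp: reduced_def)
  then have "D = weval \<iota> u * weval \<iota> y" using reduced_unique[OF reduced_dw _ dw(3)] by fastforce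
  then have "weval \<iota> u \<preceq> D" using \<open>y \<in> lists X\<close> by (metis le_mult weval_P)
  then show ?thesis using assms by (simp add: simples_def)
qed

sublocale germ P D len X R \<iota>
proof
  show "P = weval \<iota> ` lists X" by (rule P_def)
  show "u \<in> lists X \<Longrightarrow> v \<in> lists X \<Longrightarrow> weval \<iota> u = weval \<iota> v \<Longrightarrow>
      word_eq (X \<times> UNIV) (signed_rels X R) (positive_word u) (positive_word v)" for u v
    by (rule faithful)
  show "(u, v) \<in> R \<Longrightarrow> u \<in> lists X \<and> v \<in> lists X \<and> weval \<iota> u = weval \<iota> v" for u v
    using rel_lists rel_weval by blast
  show "(u, v) \<in> R \<Longrightarrow> weval \<iota> u \<in> simples" for u v
    using rel_descends rel_lists descends_simple by blast
  show "a \<in> X \<Longrightarrow> \<iota> a \<in> simples" for a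
    using descends_simple[of "[a]"] dw_descends by simp
  show "a \<in> X \<Longrightarrow> \<iota> a \<noteq> 1" for a
    using len_weval[of "[a]"] len_weval[of "[]"] by auto
  show "D \<noteq> 1" using len_weval[OF dw(1)] len_weval[of "[]"] dw(2) by auto
  fix a b assume ab: "a \<in> X" "b \<in> X"
  obtain u v where uv: "u \<in> lists X" "v \<in> lists X" "weval \<iota> (a # u) = weval \<iota> (b # v)"
      "\<And>w. w \<in> N \<Longrightarrow> e (\<rho> a * w) < e w \<Longrightarrow> e (\<rho> b * w) < e w \<Longrightarrow> descends \<rho> e w (a # u)"
    using lcm_words[OF ab] by blast
  have au: "a # u \<in> lists X" using ab uv by simp
  let ?m = "weval \<iota> (a # u)"
  have "?m \<preceq> x" if x: "x \<in> simples" "\<iota> a \<preceq> x" "\<iota> b \<preceq> x" for x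
  proof -
    have word: "\<exists>w\<in>lists X. x = weval \<iota> (s # w)" if "s \<in> X" "\<iota> s \<preceq> x" for s
      using that(2) by (elim leE) (auto simp: P_def)
    obtain w1 where w1: "w1 \<in> lists X" "x = weval \<iota> (a # w1)" using word[OF ab(1) x(2)] by blast
    obtain w2 where w2: "w2 \<in> lists X" "x = weval \<iota> (b # w2)" using word[OF ab(2) x(3)] by blast
    have l: "a # w1 \<in> lists X" "b # w2 \<in> lists X" using ab w1 w2 by auto
    define w where "w = weval \<rho> (a # w1)"
    have "weval \<iota> (a # w1) = weval \<iota> (b # w2)" using w1(2) w2(2) by (rule subst)
    then have eq: "w = weval \<rho> (b # w2)" unfolding w_def using rho_eq l by blast
    have r1: "reduced (a # w1) w" "w \<in> N" unfolding w_def using simple_reduced[OF _ l(1)] x w1(2) by auto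
    have r2: "reduced (b # w2) w" unfolding eq using simple_reduced[OF _ l(2)] x w2(2) by auto
    \<comment> \<open>Both \<open>a\<close> and \<open>b\<close> begin a reduced word of
      \<open>w\<close>, so by \<open>lcm_words\<close> the whole common multiple does. Completed to
      a reduced word, it has the value \<open>x\<close> by uniqueness, hence \<open>?m\<close>
      divides \<open>x\<close>.\<close>
    have d: "descends \<rho> e w (a # u)"
      using uv(4)[OF r1(2)] reduced_Cons(2)[OF r1] reduced_Cons(2)[OF r2 r1(2)] by blast
    obtain y where "reduced y (inverse (weval \<rho> (a # u)) * w)"
      using ex_reduced descends_reduced[OF r1(2) au d] by blast
    then have y: "reduced ((a # u) @ y) w" "y \<in> lists X"
      using descends_reduced[OF r1(2) au d] by (auto simp: reduced_def)
    then have "x = ?m * weval \<iota> y" using reduced_unique[OF r1(1) y(1) r1(2)] w1(2)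
      by (simp add: mult.assoc)
    then show ?thesis using y by simp
  qed
  moreover have "\<iota> a \<preceq> ?m" using uv(1) by simp
  moreover have "\<iota> b \<preceq> ?m" unfolding uv(3) using uv(2) by simp
  moreover have "?m \<in> P" using au by (rule weval_P)
  ultimately show "\<exists>m\<in>P. \<iota> a \<preceq> m \<and> \<iota> b \<preceq> m \<and> (\<forall>x\<in>simples. \<iota> a \<preceq> x \<longrightarrow> \<iota> b \<preceq> x \<longrightarrow> m \<preceq> x)"
    by blast
qed

sublocale garside P D len
  by (rule garside)

lemma signed_fractions: "w \<in> lists (X \<times> UNIV) \<Longrightarrow> weval (sgn_ext \<iota>) w \<in> fractions"
proof (induction w rule: list.induct)
  case (Cons x w)
  then have "sgn_ext \<iota> x \<in> fractions"
    using P_fractions[OF atom_P[of "fst x"]] by (auto simp: sgn_ext_def)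
  then show ?case using Cons by simp
qed (simp add: P_fractions)

end

section \<open>The Artin presentation\<close>

fun perm_of :: "gen \<Rightarrow> nat bij" where
  "perm_of (Sigma i) = mk_bij (transpose i (i + 1))"
| "perm_of (Band t s) = mk_bij (transpose t s)"

lemma app_perm_of [simp]:
  "app (perm_of (Sigma i)) x = transpose i (i + 1) x"
  "app (perm_of (Band t s)) x = transpose t s x"
  by (simp_all add: app_mk_bij)

declare perm_of.simps [simp del]

lemma perm_of_square [simp]: "perm_of a * perm_of a = 1"
  by (rule bij_eqI) (cases a; simp)

lemma inverse_perm_of [simp]: "inverse (perm_of a) = perm_of a"
  by (rule inverse_unique') simp

section \<open>Inversions of permutations\<close>

definition inversions :: "nat \<Rightarrow> (nat \<Rightarrow> nat) \<Rightarrow> (nat \<times> nat) set" where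
  "inversions n f = {(i, j). 1 \<le> i \<and> i < j \<and> j \<le> n \<and> f j < f i}"

text \<open>The inverse is used because generators multiply from the left: this exchanges two
  adjacent arguments of the inverse permutation.\<close>

definition inv_number :: "nat \<Rightarrow> nat bij \<Rightarrow> nat" where
  "inv_number n w = card (inversions n (app (inverse w)))"

definition perms_upto :: "nat \<Rightarrow> nat bij set" where
  "perms_upto n = {w. \<forall>k. k \<notin> {1..n} \<longrightarrow> app w k = k}"

lemma finite_inversions: "finite (inversions n f)"
  by (rule finite_subset[of _ "{1..n} \<times> {1..n}"]) (auto simp: inversions_def)

lemma transpose_adjacent_less:
  "p < q \<Longrightarrow> (p, q) \<noteq> (i, Suc i) \<Longrightarrow> transpose i (Suc i) p < transpose i (Suc i) q"
  by (auto simp: transpose_def)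

text \<open>Exchanging \<open>i\<close> and \<open>Suc i\<close> keeps the order of every other
  pair, so it matches the inversions apart from this one pair.\<close>

lemma card_inversions_adjacent:
  assumes "1 \<le> i" "Suc i \<le> n"
  shows "card (inversions n (\<lambda>k. f (transpose i (Suc i) k)) - {(i, Suc i)}) = card (inversions n f - {(i, Suc i)})"
proof -
  let ?s = "transpose i (Suc i)"
  have *: "map_prod ?s ?s ` (inversions n (\<lambda>k. g (?s k)) - {(i, Suc i)}) \<subseteq> inversions n g - {(i, Suc i)}" for g :: "nat \<Rightarrow> nat"
  proof
    fix x assume "x \<in> map_prod ?s ?s ` (inversions n (\<lambda>k. g (?s k)) - {(i, Suc i)})"
    then obtain p q where x: "x = (?s p, ?s q)" "1 \<le> p" "p < q" "q \<le> n" "g (?s q) < g (?s p)" "(p, q) \<noteq> (i, Suc i)"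
      by (auto simp: inversions_def)
    moreover have "?s p < ?s q" using transpose_adjacent_less x by blast
    moreover have "1 \<le> ?s p" "?s q \<le> n" using x assms by (auto simp: transpose_def)
    moreover have "(?s p, ?s q) \<noteq> (i, Suc i)" using x by (auto simp: transpose_def split: if_splits)
    ultimately show "x \<in> inversions n g - {(i, Suc i)}" by (auto simp: inversions_def)
  qed
  have "bij_betw (map_prod ?s ?s) (inversions n (\<lambda>k. f (?s k)) - {(i, Suc i)}) (inversions n f - {(i, Suc i)})"
    by (rule bij_betw_byWitness[of _ "map_prod ?s ?s"])
      (use *[of f] *[of "\<lambda>k. f (?s k)"] in \<open>auto simp: comp_def\<close>)
  then show ?thesis by (rule bij_betw_same_card)
qed

lemma inv_number_Sigma:
  assumes "1 \<le> i" "Suc i \<le> n"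
  shows "inv_number n (perm_of (Sigma i) * w) \<le> inv_number n w + 1"
    and "inv_number n (perm_of (Sigma i) * w) < inv_number n w \<longleftrightarrow>
      app (inverse w) (Suc i) < app (inverse w) i"
proof -
  let ?f = "app (inverse w)" let ?s = "transpose i (Suc i)"
  have f': "app (inverse (perm_of (Sigma i) * w)) = (\<lambda>k. ?f (?s k))"
    by (auto simp: inv_mult)
  let ?I = "inversions n ?f" let ?J = "inversions n (\<lambda>k. ?f (?s k))"
  have eq: "card (?J - {(i, Suc i)}) = card (?I - {(i, Suc i)})"
    by (rule card_inversions_adjacent[OF assms])
  have I: "(i, Suc i) \<in> ?I \<longleftrightarrow> ?f (Suc i) < ?f i" using assms by (auto simp: inversions_def)
  have J: "(i, Suc i) \<in> ?J \<longleftrightarrow> ?f i < ?f (Suc i)" using assms by (auto simp: inversions_def)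
  have ne: "?f i \<noteq> ?f (Suc i)" by simp
  have c: "card K = (if (i, Suc i) \<in> K then 1 else 0) + card (K - {(i, Suc i)})"
    if "finite K" for K :: "(nat \<times> nat) set"
  proof (cases "(i, Suc i) \<in> K")
    case True
    then show ?thesis using card.remove[OF that True] by (metis plus_1_eq_Suc)
  qed simp
  have "card ?I = (if ?f (Suc i) < ?f i then 1 else 0) + card (?I - {(i, Suc i)})"
    "card ?J = (if ?f i < ?f (Suc i) then 1 else 0) + card (?I - {(i, Suc i)})"
    using c[OF finite_inversions[of n ?f]] c[OF finite_inversions[of n "\<lambda>k. ?f (?s k)"]] eq I J by auto
  then show "inv_number n (perm_of (Sigma i) * w) \<le> inv_number n w + 1"
    "inv_number n (perm_of (Sigma i) * w) < inv_number n w \<longleftrightarrow> ?f (Suc i) < ?f i"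
    using ne unfolding inv_number_def f' by auto
qed

lemma inverse_perms_upto: "w \<in> perms_upto n \<Longrightarrow> k \<notin> {1..n} \<Longrightarrow> app (inverse w) k = k"
  by (simp add: perms_upto_def app_inverse_eq)

lemma inverse_perms_upto_in:
  assumes "w \<in> perms_upto n" "k \<in> {1..n}" shows "app (inverse w) k \<in> {1..n}"
proof (rule ccontr)
  assume "app (inverse w) k \<notin> {1..n}"
  then have "app (inverse w) (app (inverse w) k) = app (inverse w) k"
    by (rule inverse_perms_upto[OF assms(1)])
  then show False using assms \<open>app (inverse w) k \<notin> {1..n}\<close> by simp
qed

text \<open>An increasing map of \<open>{1..n}\<close> into itself satisfies
  \<open>k \<le> f k\<close> by induction from below and \<open>f k \<le> k\<close> by induction
  from above.\<close>

lemma increasing_perm_trivial: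
  assumes w: "w \<in> perms_upto n"
    and inc: "\<And>i. 1 \<le> i \<Longrightarrow> Suc i \<le> n \<Longrightarrow> app (inverse w) i < app (inverse w) (Suc i)"
  shows "w = 1"
proof -
  let ?f = "app (inverse w)"
  have lower: "1 \<le> k \<Longrightarrow> k \<le> n \<Longrightarrow> k \<le> ?f k" for k
  proof (induction k rule: nat_induct_at_least)
    case base
    then show ?case using inverse_perms_upto_in[OF w, of 1] by simp
  next
    case (Suc k)
    then show ?case using inc[of k] by simp
  qed
  have upper: "d < n \<Longrightarrow> ?f (n - d) \<le> n - d" for d
  proof (induction d)
    case 0
    then show ?case using inverse_perms_upto_in[OF w, of n] by simp
  next
    case (Suc d)
    then have "?f (n - Suc d) < ?f (n - d)" using inc[of "n - Suc d"] by (simp add: Suc_diff_Suc)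
    then show ?case using Suc by simp
  qed
  have "?f k = k" for k
  proof (cases "k \<in> {1..n}")
    case True
    then show ?thesis using lower[of k] upper[of "n - k"] by simp
  next
    case False
    then show ?thesis by (rule inverse_perms_upto[OF w])
  qed
  then show "w = 1" by (intro bij_eqI) (metis app_1 app_inverse(2))
qed

section \<open>The fundamental word of the Artin presentation\<close>

lemma fundamental_word_Old_Suc:
  assumes "n \<ge> 1"
  shows "fundamental_word Old (Suc n) = map Sigma [1..<Suc n] @ fundamental_word Old n"
  using assms by simp

lemma app_ascending_word:
  "app (weval perm_of (map Sigma [1..<Suc k])) x =
    (if x = k + 1 then 1 else if 1 \<le> x \<and> x \<le> k then x + 1 else x)"
proof (induction k arbitrary: x)
  case (Suc k)
  have "[1..<Suc (Suc k)] = [1..<Suc k] @ [Suc k]" by simp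
  then have "app (weval perm_of (map Sigma [1..<Suc (Suc k)])) x
      = app (weval perm_of (map Sigma [1..<Suc k])) (transpose (Suc k) (Suc (Suc k)) x)"
    by (simp del: upt_Suc)
  then show ?case using Suc by (auto simp: transpose_def simp del: upt_Suc)
qed auto

lemma app_fundamental_Old:
  assumes "n \<ge> 1"
  shows "app (weval perm_of (fundamental_word Old n)) x = (if 1 \<le> x \<and> x \<le> n then n + 1 - x else x)"
  using assms
proof (induction n arbitrary: x rule: nat_induct_at_least)
  case (Suc n)
  then show ?case
    unfolding fundamental_word_Old_Suc[OF Suc.hyps] weval_append app_mult app_ascending_word Suc.IH
    by auto
qed auto

lemma length_fundamental_Old:
  "n \<ge> 1 \<Longrightarrow> length (fundamental_word Old n) = card {(i, j). 1 \<le> i \<and> i < j \<and> j \<le> n}"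
proof (induction n rule: nat_induct_at_least)
  case base
  have "{(i, j). 1 \<le> i \<and> i < j \<and> j \<le> 1} = ({} :: (nat \<times> nat) set)" by auto
  then show ?case by (subst \<open>_ = {}\<close>) simp
next
  case (Suc n)
  have fin: "finite {(i, j). 1 \<le> i \<and> i < j \<and> j \<le> n}"
    by (rule finite_subset[of _ "{1..n} \<times> {1..n}"]) auto
  have "{(i, j). 1 \<le> i \<and> i < j \<and> j \<le> Suc n} = {(i, j). 1 \<le> i \<and> i < j \<and> j \<le> n} \<union> {1..n} \<times> {Suc n}"
    by (auto simp: le_Suc_eq)
  then have "card {(i, j). 1 \<le> i \<and> i < j \<and> j \<le> Suc n}
      = card ({(i, j). 1 \<le> i \<and> i < j \<and> j \<le> n} \<union> {1..n} \<times> {Suc n})"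
    by (rule arg_cong)
  also have "\<dots> = card {(i, j). 1 \<le> i \<and> i < j \<and> j \<le> n} + card ({1..n} \<times> {Suc n})"
    by (rule card_Un_disjoint[OF fin]) auto
  finally have "card {(i, j). 1 \<le> i \<and> i < j \<and> j \<le> Suc n} = card {(i, j). 1 \<le> i \<and> i < j \<and> j \<le> n} + n"
    by simp
  then show ?case using Suc fundamental_word_Old_Suc[OF Suc.hyps] by simp
qed

lemma double_length_fundamental_Old: "n \<ge> 1 \<Longrightarrow> 2 * length (fundamental_word Old n) = n\<^sup>2 - n"
proof (induction n rule: nat_induct_at_least)
  case (Suc n)
  have "n \<le> n\<^sup>2" by (simp add: power2_eq_square)
  then show ?case using Suc fundamental_word_Old_Suc[OF Suc.hyps] by (simp add: power2_eq_square)
qed simp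

lemma fundamental_Old_lists: "fundamental_word Old n \<in> lists (gens Old n)"
  by (auto; linarith)

declare fundamental_word.simps [simp del]

lemma descends_Sigma_commuting:
  assumes "i \<in> {1..n - 1}" "j \<in> {1..n - 1}" "\<bar>int i - int j\<bar> > 1"
    and "inv_number n (perm_of (Sigma i) * w) < inv_number n w"
    and "inv_number n (perm_of (Sigma j) * w) < inv_number n w"
  shows "descends perm_of (inv_number n) w [Sigma i, Sigma j]"
proof -
  have "1 \<le> i" "Suc i \<le> n" "1 \<le> j" "Suc j \<le> n" using assms by auto
  then show ?thesis using assms(3-) by (auto simp: inv_number_Sigma inv_mult transpose_def)
qed

lemma descends_Sigma_adjacent:
  assumes "i \<in> {1..n - 1}" "j \<in> {1..n - 1}" "\<bar>int i - int j\<bar> = 1"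
    and "inv_number n (perm_of (Sigma i) * w) < inv_number n w"
    and "inv_number n (perm_of (Sigma j) * w) < inv_number n w"
  shows "descends perm_of (inv_number n) w [Sigma i, Sigma j, Sigma i]"
proof -
  have *: "1 \<le> i" "Suc i \<le> n" "1 \<le> j" "Suc j \<le> n" using assms by auto
  consider "j = Suc i" | "i = Suc j" using assms(3) by linarith
  then show ?thesis
    by cases (use * assms(4-) in \<open>auto simp: inv_number_Sigma inv_mult transpose_def\<close>)
qed

lemma braid_model_Old:
  fixes \<iota> :: "gen \<Rightarrow> 'g::mult_group"
  assumes n: "n \<ge> 2"
    and presents: "\<And>u v. u \<in> lists (gens Old n \<times> UNIV) \<Longrightarrow> v \<in> lists (gens Old n \<times> UNIV) \<Longrightarrow>
      weval (sgn_ext \<iota>) u = weval (sgn_ext \<iota>) v \<longleftrightarrow>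
      word_eq (gens Old n \<times> UNIV) (signed_rels (gens Old n) (rels Old n)) u v"
    and iota_rel: "\<And>u v. (u, v) \<in> rels Old n \<Longrightarrow> weval \<iota> u = weval \<iota> v"
  shows "braid_model (gens Old n) (rels Old n) \<iota> perm_of (inv_number n) (perms_upto n) (fundamental_word Old n)"
proof -
  let ?c = "weval perm_of (fundamental_word Old n)"
  have c: "app ?c x = (if 1 \<le> x \<and> x \<le> n then n + 1 - x else x)" for x
    using app_fundamental_Old n by simp
  have "?c * ?c = 1" by (rule bij_eqI) (auto simp: c)
  then have inv_c: "inverse ?c = ?c" by (rule inverse_unique')
  have down: "inv_number n (perm_of a * ?c) < inv_number n ?c" if "a \<in> gens Old n" for a
    using that by (auto simp: inv_number_Sigma inv_c c)
  have rel_cases: "(\<exists>i j. i \<in> {1..n - 1} \<and> j \<in> {1..n - 1} \<and>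
      (\<bar>int i - int j\<bar> > 1 \<and> u = [Sigma i, Sigma j] \<and> v = [Sigma j, Sigma i] \<or>
       \<bar>int i - int j\<bar> = 1 \<and> u = [Sigma i, Sigma j, Sigma i] \<and> v = [Sigma j, Sigma i, Sigma j]))"
    if "(u, v) \<in> rels Old n" for u v
    using that by auto
  have sig: "Sigma i \<in> gens Old n \<longleftrightarrow> i \<in> {1..n - 1}" for i by auto
  show ?thesis
  proof
    show "weval (sgn_ext \<iota>) x = weval (sgn_ext \<iota>) y \<longleftrightarrow>
      word_eq (gens Old n \<times> UNIV) (signed_rels (gens Old n) (rels Old n)) x y"
      if "x \<in> lists (gens Old n \<times> UNIV)" "y \<in> lists (gens Old n \<times> UNIV)" for x y
      using presents that by blast
    fix u v assume uv: "(u, v) \<in> rels Old n"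
    show "u \<in> lists (gens Old n) \<and> v \<in> lists (gens Old n) \<and> length u = length v"
      using rel_cases[OF uv] by auto
    show "weval perm_of u = weval perm_of v"
      using rel_cases[OF uv] by (intro bij_eqI) (auto simp: transpose_def)
    show "descends perm_of (inv_number n) ?c u"
      using rel_cases[OF uv] descends_Sigma_commuting[of _ n _ ?c] descends_Sigma_adjacent[of _ n _ ?c] down sig
      by blast
  next
    show "perm_of a * perm_of a = 1" if "a \<in> gens Old n" for a by simp
    have "inversions n (app 1) = {}" by (auto simp: inversions_def)
    then show "inv_number n 1 = 0"
      by (simp add: inv_number_def grp.inverse_neutral)
    show "inv_number n (perm_of a * w) \<le> inv_number n w + 1" if "a \<in> gens Old n" for a w
      using that inv_number_Sigma(1) by fastforce
    show "\<exists>a\<in>gens Old n. inv_number n (perm_of a * w) < inv_number n w"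
      if w: "w \<in> perms_upto n" "w \<noteq> 1" for w
    proof -
      obtain i where i: "1 \<le> i" "Suc i \<le> n" "\<not> app (inverse w) i < app (inverse w) (Suc i)"
        using increasing_perm_trivial w by blast
      then have "app (inverse w) (Suc i) < app (inverse w) i"
        by (metis app_inj less_irrefl_nat n_not_Suc_n nat_neq_iff)
      then have "inv_number n (perm_of (Sigma i) * w) < inv_number n w"
        using i inv_number_Sigma(2) by blast
      then show ?thesis using i by (intro bexI[of _ "Sigma i"]) auto
    qed
    show "perm_of a * w \<in> perms_upto n" if "w \<in> perms_upto n" "a \<in> gens Old n" for a w
      using that by (auto simp: perms_upto_def transpose_def)
    show "fundamental_word Old n \<in> lists (gens Old n)" by (rule fundamental_Old_lists)
    have len: "length (fundamental_word Old n) = card {(i, j). 1 \<le> i \<and> i < j \<and> j \<le> n}"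
      using length_fundamental_Old n by simp
    show "fundamental_word Old n \<noteq> []" using n by (cases n) (auto simp: fundamental_word.simps)
    show "?c \<in> perms_upto n" by (auto simp: perms_upto_def c)
    have "inversions n (app ?c) = {(i, j). 1 \<le> i \<and> i < j \<and> j \<le> n}"
      by (auto simp: inversions_def c)
    then show "inv_number n ?c = length (fundamental_word Old n)"
      by (simp only: inv_number_def inv_c len)
    show "inv_number n (perm_of a * ?c) < inv_number n ?c" if "a \<in> gens Old n" for a
      using down that .
    have conj: "perm_of (Sigma i) * ?c = ?c * perm_of (Sigma (n - i))" if "i \<in> {1..n - 1}" for i
    proof (rule bij_eqI)
      fix x
      consider "x = n - i" | "x = Suc (n - i)" | "x \<noteq> n - i" "x \<noteq> Suc (n - i)" by blast
      then show "app (perm_of (Sigma i) * ?c) x = app (?c * perm_of (Sigma (n - i))) x"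
      proof cases
        case 3
        then have "app ?c x \<noteq> i" "app ?c x \<noteq> Suc i" using that by (auto simp: c)
        then show ?thesis using 3 by (simp add: transpose_def)
      qed (use that in \<open>auto simp: c Suc_diff_le\<close>)
    qed
    show "\<exists>b\<in>gens Old n. perm_of a * ?c = ?c * perm_of b" if a: "a \<in> gens Old n" for a
    proof -
      obtain i where i: "a = Sigma i" "i \<in> {1..n - 1}" using a by auto
      then show ?thesis using conj[OF i(2)] by (intro bexI[of _ "Sigma (n - i)"]) auto
    qed
    show "\<exists>a\<in>gens Old n. perm_of a * ?c = ?c * perm_of b" if b: "b \<in> gens Old n" for b
    proof -
      obtain i where i: "b = Sigma i" "i \<in> {1..n - 1}" using b by auto
      then have "n - i \<in> {1..n - 1}" "n - (n - i) = i" by auto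
      then show ?thesis using conj[of "n - i"] i by (intro bexI[of _ "Sigma (n - i)"]) auto
    qed
  next
    fix a b assume "a \<in> gens Old n" "b \<in> gens Old n"
    then obtain i j where a: "a = Sigma i" "i \<in> {1..n - 1}" and b: "b = Sigma j" "j \<in> {1..n - 1}"
      by auto
    let ?goal = "\<lambda>u v. weval \<iota> (a # u) = weval \<iota> (b # v) \<and>
      (\<forall>w\<in>perms_upto n. inv_number n (perm_of a * w) < inv_number n w \<longrightarrow>
        inv_number n (perm_of b * w) < inv_number n w \<longrightarrow>
        descends perm_of (inv_number n) w (a # u) \<and> descends perm_of (inv_number n) w (b # v))"
    \<comment> \<open>The common multiples are \<open>a\<close> itself or the two sides of the
      defining relation of \<open>a\<close> and \<open>b\<close>: \<open>ab = ba\<close>,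
      respectively \<open>aba = bab\<close>.\<close>
    consider "i = j" | "\<bar>int i - int j\<bar> > 1" | "\<bar>int i - int j\<bar> = 1" by linarith
    then have "\<exists>u\<in>lists {a, b}. \<exists>v\<in>lists {a, b}. ?goal u v"
    proof cases
      case 1
      then show ?thesis using a b by (intro bexI[of _ "[]"]) auto
    next
      case 2
      have "([Sigma i, Sigma j], [Sigma j, Sigma i]) \<in> rels Old n" using a(2) b(2) 2 by auto
      from iota_rel[OF this] have "?goal [b] [a]"
        using descends_Sigma_commuting[of i n j] descends_Sigma_commuting[of j n i] a b 2
        by (simp add: abs_minus_commute)
      moreover have "[b] \<in> lists {a, b}" "[a] \<in> lists {a, b}" by auto
      ultimately show ?thesis by blast
    next
      case 3
      have "([Sigma i, Sigma j, Sigma i], [Sigma j, Sigma i, Sigma j]) \<in> rels Old n"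
        using a(2) b(2) 3 by auto
      from iota_rel[OF this] have "?goal [b, a] [a, b]"
        using descends_Sigma_adjacent[of i n j] descends_Sigma_adjacent[of j n i] a b 3
        by (simp add: abs_minus_commute)
      moreover have "[b, a] \<in> lists {a, b}" "[a, b] \<in> lists {a, b}" by auto
      ultimately show ?thesis by blast
    qed
    moreover have "lists {a, b} \<subseteq> lists (gens Old n)" using a b sig by (intro lists_mono) auto
    ultimately show "\<exists>u\<in>lists (gens Old n). \<exists>v\<in>lists (gens Old n). ?goal u v" by blast
  qed
qed

section \<open>The Birman-Ko-Lee presentation\<close>

text \<open>\<open>cycle_count n w\<close> is the number of cycles of \<open>w\<close> on \<open>{1..n}\<close>, obtained as the greatest number of
  colours of a \<open>w\<close>-invariant colouring.\<close>

definition colouring :: "nat bij \<Rightarrow> (nat \<Rightarrow> nat) \<Rightarrow> bool" where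
  "colouring w h \<longleftrightarrow> (\<forall>i. h (app w i) = h i)"

definition cycle_count :: "nat \<Rightarrow> nat bij \<Rightarrow> nat" where
  "cycle_count n w = Max ((\<lambda>h. card (h ` {1..n})) ` {h. colouring w h})"

text \<open>For permutations of \<open>{1..n}\<close> this is the reflection length, the least
  number of transpositions in a factorization.\<close>

definition abs_length :: "nat \<Rightarrow> nat bij \<Rightarrow> nat" where
  "abs_length n w = n - cycle_count n w"

lemma cycle_count:
  shows card_colouring: "colouring w h \<Longrightarrow> card (h ` {1..n}) \<le> cycle_count n w"
    and ex_colouring: "\<exists>h. colouring w h \<and> card (h ` {1..n}) = cycle_count n w"
    and cycle_count_le: "cycle_count n w \<le> n"
proof -
  let ?S = "(\<lambda>h. card (h ` {1..n})) ` {h. colouring w h}"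
  have le: "card (h ` {1..n}) \<le> n" for h :: "nat \<Rightarrow> nat"
    using card_image_le[of "{1..n}" h] by simp
  then have fin: "finite ?S" by (intro finite_subset[of ?S "{..n}"]) auto
  have "(\<lambda>_. 0) \<in> {h. colouring w h}" by (simp add: colouring_def)
  then have ne: "?S \<noteq> {}" by blast
  show "colouring w h \<Longrightarrow> card (h ` {1..n}) \<le> cycle_count n w"
    unfolding cycle_count_def using fin by (intro Max_ge) auto
  show "\<exists>h. colouring w h \<and> card (h ` {1..n}) = cycle_count n w"
    using Max_in[OF fin ne] unfolding cycle_count_def by force
  then show "cycle_count n w \<le> n" using le by metis
qed

lemma abs_length_less: "abs_length n v < abs_length n w \<longleftrightarrow> cycle_count n w < cycle_count n v"
  using cycle_count_le[of n v] cycle_count_le[of n w] by (auto simp: abs_length_def)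

text \<open>Identifying the colours of \<open>s\<close> and \<open>t\<close> keeps the invariance
  under \<open>w\<close> and adds that under the transposition, at the cost of at most one
  colour.\<close>

lemma colouring_merge:
  fixes s t n :: nat
  assumes "colouring w h"
  defines "h' \<equiv> (\<lambda>i. if h i = h t then h s else h i)"
  shows "colouring (perm_of (Band t s) * w) h'" "card (h ` {1..n}) \<le> card (h' ` {1..n}) + 1"
proof -
  show "colouring (perm_of (Band t s) * w) h'"
    using assms by (auto simp: colouring_def h'_def transpose_def)
  have "h ` {1..n} - {h t} \<subseteq> h' ` {1..n}" by (auto simp: h'_def)
  then have "card (h ` {1..n} - {h t}) \<le> card (h' ` {1..n})" by (intro card_mono) auto
  moreover have "card (h ` {1..n}) \<le> card (h ` {1..n} - {h t}) + 1"
    using diff_card_le_card_Diff[of "{h t}" "h ` {1..n}"] by simp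
  ultimately show "card (h ` {1..n}) \<le> card (h' ` {1..n}) + 1" by linarith
qed

lemma abs_length_step: "abs_length n (perm_of (Band t s) * w) \<le> abs_length n w + 1"
proof -
  obtain h where h: "colouring w h" "card (h ` {1..n}) = cycle_count n w" using ex_colouring by blast
  have "cycle_count n w \<le> cycle_count n (perm_of (Band t s) * w) + 1"
    using colouring_merge(2)[OF h(1), where t = t and s = s and n = n]
      card_colouring[OF colouring_merge(1)[OF h(1), where t = t and s = s], of n] h(2)
    by linarith
  then show ?thesis unfolding abs_length_def by linarith
qed

text \<open>\<open>w\<close> is the permutation below the fundamental braid that belongs to the noncrossing partition of
  \<open>{1..n}\<close> into the classes of \<open>E\<close>.\<close>

definition noncrossing :: "nat \<Rightarrow> nat bij \<Rightarrow> (nat \<Rightarrow> nat \<Rightarrow> bool) \<Rightarrow> bool" where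
  "noncrossing n w E \<longleftrightarrow>
    (\<forall>i. i \<notin> {1..n} \<longrightarrow> app w i = i) \<and>
    (\<forall>i\<in>{1..n}. E i i) \<and> (\<forall>i j. E i j \<longrightarrow> E j i) \<and> (\<forall>i j k. E i j \<longrightarrow> E j k \<longrightarrow> E i k) \<and>
    (\<forall>i j. E i j \<longrightarrow> i \<in> {1..n} \<and> j \<in> {1..n}) \<and>
    (\<forall>p q r s. p < q \<longrightarrow> q < r \<longrightarrow> r < s \<longrightarrow> E p r \<longrightarrow> E q s \<longrightarrow> E p q) \<and>
    (\<forall>i\<in>{1..n}. E i (app w i) \<and>
      (app w i < i \<longrightarrow> (\<forall>j. E i j \<longrightarrow> j \<le> app w i \<or> i \<le> j)) \<and>
      (i \<le> app w i \<longrightarrow> (\<forall>j. E i j \<longrightarrow> i \<le> j \<and> j \<le> app w i)))"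

text \<open>In a noncrossing permutation, \<open>w\<close> takes each element to the next smaller
  one of its class and the least to the greatest. Multiplying by the transposition of two elements
  \<open>s < t\<close> of a class cuts this cycle into the part in \<open>(s, t]\<close> and the
  rest.\<close>

definition split_rel :: "nat \<Rightarrow> nat \<Rightarrow> (nat \<Rightarrow> nat \<Rightarrow> bool) \<Rightarrow> nat \<Rightarrow> nat \<Rightarrow> bool" where
  "split_rel s t E i j \<longleftrightarrow> E i j \<and> (s < i \<and> i \<le> t \<longleftrightarrow> s < j \<and> j \<le> t)"

context
  fixes n w E
  assumes nc: "noncrossing n w E"
begin

lemma nc_props:
  shows nc_fix: "i \<notin> {1..n} \<Longrightarrow> app w i = i"
    and nc_refl: "i \<in> {1..n} \<Longrightarrow> E i i"
    and nc_sym: "E i j \<Longrightarrow> E j i"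
    and nc_trans: "E i j \<Longrightarrow> E j k \<Longrightarrow> E i k"
    and nc_range: "E i j \<Longrightarrow> i \<in> {1..n} \<and> j \<in> {1..n}"
    and nc_cross: "p < q \<Longrightarrow> q < r \<Longrightarrow> r < s \<Longrightarrow> E p r \<Longrightarrow> E q s \<Longrightarrow> E p q"
    and nc_app: "i \<in> {1..n} \<Longrightarrow> E i (app w i)"
    and nc_next: "app w i < i \<Longrightarrow> i \<in> {1..n} \<Longrightarrow> E i j \<Longrightarrow> j \<le> app w i \<or> i \<le> j"
    and nc_min: "i \<le> app w i \<Longrightarrow> i \<in> {1..n} \<Longrightarrow> E i j \<Longrightarrow> i \<le> j \<and> j \<le> app w i"
proof -
  note c0 = nc[unfolded noncrossing_def, THEN conjunct1]
  note c1 = nc[unfolded noncrossing_def, THEN conjunct2, THEN conjunct1]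
  note c2 = nc[unfolded noncrossing_def, THEN conjunct2, THEN conjunct2, THEN conjunct1]
  note c3 = nc[unfolded noncrossing_def, THEN conjunct2, THEN conjunct2, THEN conjunct2, THEN conjunct1]
  note c4 = nc[unfolded noncrossing_def, THEN conjunct2, THEN conjunct2, THEN conjunct2, THEN conjunct2, THEN conjunct1]
  note c5 = nc[unfolded noncrossing_def, THEN conjunct2, THEN conjunct2, THEN conjunct2, THEN conjunct2, THEN conjunct2, THEN conjunct1]
  note c6 = nc[unfolded noncrossing_def, THEN conjunct2, THEN conjunct2, THEN conjunct2, THEN conjunct2, THEN conjunct2, THEN conjunct2]
  show "i \<notin> {1..n} \<Longrightarrow> app w i = i" using c0 by blast
  show "i \<in> {1..n} \<Longrightarrow> E i i" using c1 by blast
  show "E i j \<Longrightarrow> E j i" using c2 by blast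
  show "E i j \<Longrightarrow> E j k \<Longrightarrow> E i k" using c3 by blast
  show "E i j \<Longrightarrow> i \<in> {1..n} \<and> j \<in> {1..n}" using c4 by blast
  show "p < q \<Longrightarrow> q < r \<Longrightarrow> r < s \<Longrightarrow> E p r \<Longrightarrow> E q s \<Longrightarrow> E p q" using c5 by blast
  show "i \<in> {1..n} \<Longrightarrow> E i (app w i)" using c6 by blast
  show "app w i < i \<Longrightarrow> i \<in> {1..n} \<Longrightarrow> E i j \<Longrightarrow> j \<le> app w i \<or> i \<le> j" using c6 by blast
  show "i \<le> app w i \<Longrightarrow> i \<in> {1..n} \<Longrightarrow> E i j \<Longrightarrow> i \<le> j \<and> j \<le> app w i" using c6 by blast
qed

text \<open>Starting at the larger of the two elements, \<open>w\<close> steps down through the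
  class and reaches the smaller one without jumping over it.\<close>

lemma nc_colouring: assumes h: "colouring w h" shows "E i j \<Longrightarrow> h i = h j"
proof -
  have *: "E i j \<Longrightarrow> j \<le> i \<Longrightarrow> h i = h j" for i j
  proof (induction i rule: less_induct)
    case (less i)
    show ?case
    proof (cases "j = i")
      case False
      have i: "i \<in> {1..n}" using nc_range less.prems by blast
      have lt: "app w i < i" using nc_min[of i j] i less.prems False by fastforce
      then have "j \<le> app w i" using nc_next[OF lt i less.prems(1)] less.prems False by simp
      moreover have "E (app w i) j" using nc_app[OF i] nc_sym nc_trans less.prems by blast
      ultimately have "h (app w i) = h j" using less.IH[OF lt] by blast
      then show ?thesis using h by (simp add: colouring_def)
    qed simp
  qed
  show "E i j \<Longrightarrow> h i = h j"
    using *[of i j] *[of j i] nc_sym[of i j] by (cases "j \<le> i") auto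
qed

lemma noncrossing_split:
  assumes "E s t" "s < t"
  shows "noncrossing n (perm_of (Band t s) * w) (split_rel s t E)"
proof -
  have st: "s \<in> {1..n}" "t \<in> {1..n}" using nc_range assms by auto
  have fix_out: "transpose t s (app w i) = i" if "i \<notin> {1..n}" for i
    using nc_fix[OF that] that st by (auto simp: transpose_def)
  have cross: "split_rel s t E p q"
    if "p < q" "q < r" "r < u" "split_rel s t E p r" "split_rel s t E q u" for p q r u
    using that nc_cross[of p q r u] unfolding split_rel_def by (smt (verit) le_trans less_imp_le less_le_trans le_less_trans)
  have step: "split_rel s t E i k \<and>
      (k < i \<longrightarrow> (\<forall>j. split_rel s t E i j \<longrightarrow> j \<le> k \<or> i \<le> j)) \<and>
      (i \<le> k \<longrightarrow> (\<forall>j. split_rel s t E i j \<longrightarrow> i \<le> j \<and> j \<le> k))"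
    if i: "i \<in> {1..n}" and k: "k = transpose t s (app w i)" for i k
  proof -
    \<comment> \<open>Only the preimages of \<open>s\<close> and \<open>t\<close> get a new image.
      The preimage of \<open>t\<close> skips the inner part and goes to \<open>s\<close>; that of
      \<open>s\<close> becomes the least element of the inner part and goes to its greatest,
      \<open>t\<close>.\<close>
    consider (t) "app w i = t" | (s) "app w i = s" | (other) "app w i \<noteq> t" "app w i \<noteq> s" by blast
    then show ?thesis
    proof cases
      case t
      then have ks: "k = s" using k by simp
      have E: "E i t" "E i s" using nc_app[OF i] t nc_sym nc_trans assms by blast+
      show ?thesis
      proof (cases "t < i")
        case True
        then show ?thesis using nc_next[of i] t i E assms ks unfolding split_rel_def by auto
      next
        case False
        then have "i \<le> s \<and> (\<forall>j. E i j \<longrightarrow> i \<le> j \<and> j \<le> t)" using nc_min[of i] t i E by auto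
        then show ?thesis using E assms ks unfolding split_rel_def by auto
      qed
    next
      case s
      then have kt: "k = t" using k by simp
      have E: "E i s" "E i t" using nc_app[OF i] s nc_trans assms by blast+
      have lt: "s < i" using nc_min[of i t] s i E assms by fastforce
      then have *: "j \<le> s \<or> i \<le> j" if "E i j" for j using nc_next[of i j] s i that by simp
      then have le: "i \<le> j" if "E i j" "s < j" for j using that by fastforce
      then have "i \<le> t" using E assms by simp
      then show ?thesis using E le lt kt assms unfolding split_rel_def by auto
    next
      case other
      then have k: "k = app w i" using k by (simp add: transpose_def)
      have E: "E i k" using nc_app[OF i] k by simp
      \<comment> \<open>A step into or out of the interval would, by noncrossing, put
        \<open>i\<close> and \<open>k\<close> into the class of \<open>s\<close> and
        \<open>t\<close>; then \<open>s\<close> or \<open>t\<close> contradicts that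
        \<open>k\<close> follows \<open>i\<close> in the cyclic order of the class.\<close>
      have "(s < i \<and> i \<le> t) = (s < k \<and> k \<le> t)"
      proof (cases "k < i")
        case True
        have nx: "j \<le> k \<or> i \<le> j" if "E i j" for j using nc_next[of i j] True k i that by simp
        have "\<not> (k < s \<and> s < i \<and> i \<le> t)"
          using nx[of s] nc_cross[of k s i t] E nc_sym nc_trans assms
          by (metis leD nat_less_le)
        moreover have "\<not> (s < k \<and> k < t \<and> t < i)"
          using nx[of t] nc_cross[of s k t i] E nc_sym nc_trans assms
          by (metis leD)
        ultimately show ?thesis using True other k by linarith
      next
        case False
        have mn: "i \<le> j \<and> j \<le> k" if "E i j" for j using nc_min[of i j] False k i that by simp
        have "\<not> (s < i \<and> i \<le> t \<and> t < k)"
          using mn[of s] nc_cross[of s i t k] E nc_sym nc_trans assms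
          by (metis leD nat_less_le)
        moreover have "\<not> (i \<le> s \<and> s < k \<and> k < t)"
          using mn[of t] nc_cross[of i s k t] E nc_sym nc_trans assms
          by (metis leD nat_less_le)
        ultimately show ?thesis using False other k by linarith
      qed
      then have "split_rel s t E i k" using E by (simp add: split_rel_def)
      moreover have "j \<le> k \<or> i \<le> j" if "k < i" "split_rel s t E i j" for j
        using nc_next[of i j] k i that by (simp add: split_rel_def)
      moreover have "i \<le> j \<and> j \<le> k" if "i \<le> k" "split_rel s t E i j" for j
        using nc_min[of i j] k i that by (simp add: split_rel_def)
      ultimately show ?thesis by blast
    qed
  qed
  show ?thesis
    unfolding noncrossing_def
  proof (intro conjI)
    let ?E = "split_rel s t E"
    show "\<forall>i. i \<notin> {1..n} \<longrightarrow> app (perm_of (Band t s) * w) i = i" using fix_out by simp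
    show "\<forall>i\<in>{1..n}. ?E i i" using nc_refl by (simp add: split_rel_def)
    show "\<forall>i j. ?E i j \<longrightarrow> ?E j i" using nc_sym unfolding split_rel_def by blast
    show "\<forall>i j k. ?E i j \<longrightarrow> ?E j k \<longrightarrow> ?E i k" using nc_trans unfolding split_rel_def by blast
    show "\<forall>i j. ?E i j \<longrightarrow> i \<in> {1..n} \<and> j \<in> {1..n}"
      using nc_range unfolding split_rel_def by blast
    show "\<forall>p q r s. p < q \<longrightarrow> q < r \<longrightarrow> r < s \<longrightarrow> ?E p r \<longrightarrow> ?E q s \<longrightarrow> ?E p q" using cross by blast
    show "\<forall>i\<in>{1..n}. ?E i (app (perm_of (Band t s) * w) i) \<and>
      (app (perm_of (Band t s) * w) i < i \<longrightarrow>
        (\<forall>j. ?E i j \<longrightarrow> j \<le> app (perm_of (Band t s) * w) i \<or> i \<le> j)) \<and>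
      (i \<le> app (perm_of (Band t s) * w) i \<longrightarrow>
        (\<forall>j. ?E i j \<longrightarrow> i \<le> j \<and> j \<le> app (perm_of (Band t s) * w) i))"
      using step by (metis app_mult app_perm_of(2))
  qed
qed

text \<open>A colouring that gives two classes the same colour can be improved: the class of
  \<open>t\<close> takes a fresh colour, and the old one survives at \<open>s\<close>.\<close>

lemma nc_refine:
  assumes h: "colouring w h" and t: "t \<in> {1..n}" and s: "s \<in> {1..n}" "\<not> E s t" and eq: "h s = h t"
  shows "card (h ` {1..n}) < cycle_count n w"
proof -
  obtain c where c: "c \<notin> h ` {1..n}" using ex_new_if_finite[of "h ` {1..n}"] by auto
  define h' where "h' i = (if E i t then c else h i)" for i
  have "E (app w i) t \<longleftrightarrow> E i t" for i
    using nc_app[of i] nc_fix[of i] nc_sym nc_trans by metis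
  then have "colouring w h'" using h by (simp add: colouring_def h'_def)
  moreover have "insert c (h ` {1..n}) \<subseteq> h' ` {1..n}"
  proof -
    have "c \<in> h' ` {1..n}" using t nc_refl[OF t] by (auto simp: h'_def image_iff)
    moreover have "h i \<in> h' ` {1..n}" if "i \<in> {1..n}" for i
    proof (cases "E i t")
      case True
      then have "h i = h' s" using nc_colouring[OF h] eq s by (simp add: h'_def)
      then show ?thesis using s by blast
    next
      case False
      then have "h i = h' i" by (simp add: h'_def)
      then show ?thesis using that by blast
    qed
    ultimately show ?thesis by blast
  qed
  then have "card (insert c (h ` {1..n})) \<le> card (h' ` {1..n})" by (intro card_mono) auto
  ultimately show ?thesis using card_colouring[of w h' n] c by simp
qed

end

text \<open>If the product has more cycles, merging the colours of \<open>s\<close> and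
  \<open>t\<close> in an optimal colouring of it leaves an optimal colouring of \<open>w\<close>, so
  by \<open>nc_refine\<close> the two lie in one class. Conversely, the part of their class in
  \<open>(s, t]\<close> can take a fresh colour.\<close>

lemma abs_length_descent:
  assumes nc: "noncrossing n w E" and st: "1 \<le> s" "s < t" "t \<le> n"
  shows "abs_length n (perm_of (Band t s) * w) < abs_length n w \<longleftrightarrow> E s t"
proof
  let ?w = "perm_of (Band t s) * w"
  {
    assume less: "abs_length n ?w < abs_length n w"
    obtain h where h: "colouring ?w h" "card (h ` {1..n}) = cycle_count n ?w" using ex_colouring by blast
    define h' where "h' = (\<lambda>i. if h i = h t then h s else h i)"
    have "perm_of (Band t s) * ?w = w" by (simp flip: mult.assoc)
    then have h': "colouring w h'" "cycle_count n ?w \<le> card (h' ` {1..n}) + 1"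
      using colouring_merge(1)[OF h(1), where t = t and s = s]
        colouring_merge(2)[OF h(1), where t = t and s = s and n = n] h(2)
      unfolding h'_def by simp_all
    have "h' s = h' t" by (simp add: h'_def)
    then show "E s t" using nc_refine[OF nc h'(1), of t s] h'(2) less st
      by (force simp: abs_length_less)
  }
  {
    assume E: "E s t"
    obtain h where h: "colouring w h" "card (h ` {1..n}) = cycle_count n w" using ex_colouring by blast
    obtain c where c: "c \<notin> h ` {1..n}" using ex_new_if_finite[of "h ` {1..n}"] by auto
    define h' where "h' i = (if E i t \<and> s < i \<and> i \<le> t then c else h i)" for i
    have nc': "noncrossing n ?w (split_rel s t E)" using noncrossing_split[OF nc E st(2)] .
    have "h' (app ?w i) = h' i" for i
    proof (cases "i \<in> {1..n}")
      case True
      then have "split_rel s t E i (app ?w i)" using nc_app[OF nc'] by blast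
      then have "E i (app ?w i)" "(s < i \<and> i \<le> t) = (s < app ?w i \<and> app ?w i \<le> t)"
        by (auto simp: split_rel_def)
      moreover from this have "E (app ?w i) t \<longleftrightarrow> E i t"
        using nc_sym[OF nc] nc_trans[OF nc] by blast
      ultimately show ?thesis using nc_colouring[OF nc h(1), of i "app ?w i"]
        by (simp add: h'_def)
    next
      case False
      then have "app ?w i = i" using nc_fix[OF nc'] by blast
      then show ?thesis by simp
    qed
    then have "colouring ?w h'" by (simp add: colouring_def)
    moreover have "insert c (h ` {1..n}) \<subseteq> h' ` {1..n}"
    proof -
      have "c = h' t" using st nc_refl[OF nc, of t] by (simp add: h'_def)
      moreover have "h i \<in> h' ` {1..n}" if "i \<in> {1..n}" for i
      proof (cases "E i t \<and> s < i \<and> i \<le> t")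
        case True
        then have "h i = h s" using nc_colouring[OF nc h(1)] E by metis
        then have "h i = h' s" by (simp add: h'_def)
        then show ?thesis using st by auto
      next
        case False
        then have "h i = h' i" by (auto simp: h'_def)
        then show ?thesis using that by blast
      qed
      ultimately show ?thesis using st by auto
    qed
    then have "card (insert c (h ` {1..n})) \<le> card (h' ` {1..n})" by (intro card_mono) auto
    ultimately show "abs_length n ?w < abs_length n w"
      using card_colouring[of ?w h' n] c h(2) by (simp add: abs_length_less)
  }
qed

text \<open>The counterpart of \<open>descends\<close> on partitions. It no longer mentions
  permutations or lengths, so for concrete words it can be checked by unfolding
  \<open>split_rel\<close>.\<close>

fun splits :: "(nat \<Rightarrow> nat \<Rightarrow> bool) \<Rightarrow> gen list \<Rightarrow> bool" where
  "splits E [] = True"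
| "splits E (Band t s # u) = (s < t \<and> E s t \<and> splits (split_rel s t E) u)"
| "splits E (Sigma i # u) = False"

lemma splits_descends:
  "noncrossing n w E \<Longrightarrow> splits E u \<Longrightarrow> descends perm_of (abs_length n) w u"
proof (induction E u arbitrary: w rule: splits.induct)
  case (2 E t s u)
  then have "1 \<le> s" "s < t" "t \<le> n" using nc_range[OF 2(2), of s t] by auto
  then show ?case using 2 abs_length_descent[OF 2(2)] noncrossing_split[OF 2(2)] by simp
qed auto

section \<open>Chords, triangles and crossing pairs\<close>

lemma chords_disjoint_iff:
  fixes s t q r :: nat
  assumes "s < t" "q < r"
  shows "(int t - int r) * (int t - int q) * (int s - int r) * (int s - int q) > 0 \<longleftrightarrow>
    t < q \<or> r < s \<or> (s < q \<and> r < t) \<or> (q < s \<and> t < r)"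
  unfolding zero_less_mult_iff mult_less_0_iff using assms by presburger

lemma fundamental_word_New_Suc:
  "n \<ge> 1 \<Longrightarrow> fundamental_word New (Suc n) = Band (Suc n) n # fundamental_word New n"
  by (simp add: fundamental_word.simps)

lemma app_fundamental_New:
  assumes "n \<ge> 1"
  shows "app (weval perm_of (fundamental_word New n)) x =
    (if x = 1 then n else if 1 \<le> x \<and> x \<le> n then x - 1 else x)"
  using assms
proof (induction n arbitrary: x rule: nat_induct_at_least)
  case base
  then show ?case by (simp add: fundamental_word.simps)
next
  case (Suc n)
  show ?case
    unfolding fundamental_word_New_Suc[OF Suc.hyps] weval_simps app_mult app_perm_of Suc.IH
    using Suc.hyps by (auto simp: transpose_def)
qed

lemma length_fundamental_New: "length (fundamental_word New n) = n - 1"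
  by (simp add: fundamental_word.simps)

lemma fundamental_New_lists: "fundamental_word New n \<in> lists (gens New n)"
  by (auto simp: fundamental_word.simps; linarith)

lemma noncrossing_fundamental:
  assumes "n \<ge> 1"
  shows "noncrossing n (weval perm_of (fundamental_word New n)) (\<lambda>i j. i \<in> {1..n} \<and> j \<in> {1..n})"
  unfolding noncrossing_def app_fundamental_New[OF assms] using assms by auto

lemma splits_triangle:
  assumes nc: "noncrossing n w E" and rst: "r < s" "s < t" and E: "E r s" "E s t"
  shows "splits E [Band t s, Band s r]" "splits E [Band t r, Band t s]" "splits E [Band s r, Band t r]"
proof -
  have "E r t" "E s r" "E t s" "E t r" using E nc_sym[OF nc] nc_trans[OF nc] by blast+
  then show "splits E [Band t s, Band s r]" "splits E [Band t r, Band t s]" "splits E [Band s r, Band t r]"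
    using rst E by (auto simp: split_rel_def)
qed

lemma splits_disjoint:
  assumes "s < t" "q < r" "t < q \<or> r < s \<or> (s < q \<and> r < t) \<or> (q < s \<and> t < r)" "E s t" "E q r"
  shows "splits E [Band t s, Band r q]"
  using assms by (auto simp: split_rel_def)

text \<open>Noncrossing forces the four endpoints into one class, and either word separates all four
  of them. These words are the common multiples used for crossing generators.\<close>

lemma splits_crossing:
  assumes nc: "noncrossing n w E" and qrst: "q < s" "s < r" "r < t" and E: "E s t" "E q r"
  shows "splits E [Band t s, Band t r, Band s q]" "splits E [Band r q, Band r s, Band t q]"
proof -
  have "E q s" using nc_cross[OF nc qrst E(2,1)] .
  then have all: "E r t" "E q t" "E s r" "E q s" using E nc_sym[OF nc] nc_trans[OF nc] by blast+
  show "splits E [Band t s, Band t r, Band s q]" "splits E [Band r q, Band r s, Band t q]"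
    using all E qrst by (auto simp: split_rel_def)
qed

lemma braid_model_New:
  fixes \<iota> :: "gen \<Rightarrow> 'g::mult_group"
  assumes n: "n \<ge> 2"
    and presents: "\<And>u v. u \<in> lists (gens New n \<times> UNIV) \<Longrightarrow> v \<in> lists (gens New n \<times> UNIV) \<Longrightarrow>
      weval (sgn_ext \<iota>) u = weval (sgn_ext \<iota>) v \<longleftrightarrow>
      word_eq (gens New n \<times> UNIV) (signed_rels (gens New n) (rels New n)) u v"
    and iota_rel: "\<And>u v. (u, v) \<in> rels New n \<Longrightarrow> weval \<iota> u = weval \<iota> v"
  shows "braid_model (gens New n) (rels New n) \<iota> perm_of (abs_length n) {w. \<exists>E. noncrossing n w E}
    (fundamental_word New n)"
proof -
  let ?X = "gens New n"
  let ?c = "weval perm_of (fundamental_word New n)"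
  let ?F = "\<lambda>i j. i \<in> {1..n} \<and> j \<in> {1..n}"
  let ?N = "{w. \<exists>E. noncrossing n w E}"
  have c: "app ?c x = (if x = 1 then n else if 1 \<le> x \<and> x \<le> n then x - 1 else x)" for x
    using app_fundamental_New n by simp
  have ncc: "noncrossing n ?c ?F" using noncrossing_fundamental n by simp
  have gen_cases: "\<exists>t s. a = Band t s \<and> 1 \<le> s \<and> s < t \<and> t \<le> n" if "a \<in> ?X" for a
    using that by auto
  have gen: "Band t s \<in> ?X" if "1 \<le> s" "s < t" "t \<le> n" for t s using that by auto
  have down: "abs_length n (perm_of a * ?c) < abs_length n ?c" if "a \<in> ?X" for a
    using gen_cases[OF that] abs_length_descent[OF ncc] by auto
  have comm: "([Band t s, Band r q], [Band r q, Band t s]) \<in> rels New n"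
    if "1 \<le> s" "s < t" "t \<le> n" "1 \<le> q" "q < r" "r \<le> n"
      "t < q \<or> r < s \<or> (s < q \<and> r < t) \<or> (q < s \<and> t < r)" for t s r q
    using that chords_disjoint_iff[of s t q r] by auto
  have tri: "([Band t s, Band s r], [Band t r, Band t s]) \<in> rels New n"
      "([Band t r, Band t s], [Band s r, Band t r]) \<in> rels New n"
    if "1 \<le> r" "r < s" "s < t" "t \<le> n" for t s r
    using that by auto
  have rel_cases: "(\<exists>t s r q. 1 \<le> s \<and> s < t \<and> t \<le> n \<and> 1 \<le> q \<and> q < r \<and> r \<le> n \<and>
        (t < q \<or> r < s \<or> (s < q \<and> r < t) \<or> (q < s \<and> t < r)) \<and>
        u = [Band t s, Band r q] \<and> v = [Band r q, Band t s]) \<or>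
      (\<exists>t s r. 1 \<le> r \<and> r < s \<and> s < t \<and> t \<le> n \<and>
        (u = [Band t s, Band s r] \<and> v = [Band t r, Band t s] \<or>
         u = [Band t r, Band t s] \<and> v = [Band s r, Band t r]))"
    if uv: "(u, v) \<in> rels New n" for u v
  proof -
    from uv consider t s r q where "t \<le> n" "s < t" "1 \<le> s" "r \<le> n" "q < r" "1 \<le> q"
        "(int t - int r) * (int t - int q) * (int s - int r) * (int s - int q) > 0"
        "u = [Band t s, Band r q]" "v = [Band r q, Band t s]"
      | t s r where "t \<le> n" "s < t" "r < s" "1 \<le> r"
         "u = [Band t s, Band s r] \<and> v = [Band t r, Band t s] \<or>
          u = [Band t r, Band t s] \<and> v = [Band s r, Band t r]"
      by auto
    then show ?thesis
    proof cases
      case 1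
      then show ?thesis using chords_disjoint_iff[of s t q r] by blast
    next
      case 2
      then show ?thesis by blast
    qed
  qed
  have iota_tri: "\<iota> (Band t s) * \<iota> (Band s r) = \<iota> (Band t r) * \<iota> (Band t s)"
      "\<iota> (Band t r) * \<iota> (Band t s) = \<iota> (Band s r) * \<iota> (Band t r)"
    if "1 \<le> r" "r < s" "s < t" "t \<le> n" for t s r
    using iota_rel[OF tri(1)[OF that]] iota_rel[OF tri(2)[OF that]] by simp_all
  \<comment> \<open>The relations of the triangles \<open>s < r < t\<close>,
    \<open>q < s < r\<close> and \<open>q < r < t\<close>, together with the commutation of the
    nested chords from \<open>q\<close> to \<open>t\<close> and from \<open>s\<close> to
    \<open>r\<close>, suffice.\<close>
  have crossing: "\<iota> (Band t s) * (\<iota> (Band t r) * \<iota> (Band s q)) = \<iota> (Band r q) * (\<iota> (Band r s) * \<iota> (Band t q))"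
    if *: "1 \<le> q" "q < s" "s < r" "r < t" "t \<le> n" for t s r q
  proof -
    have "\<iota> (Band t s) * (\<iota> (Band t r) * \<iota> (Band s q)) = \<iota> (Band t r) * (\<iota> (Band r s) * \<iota> (Band s q))"
      using iota_tri[of s r t] * by (simp flip: mult.assoc)
    also have "\<dots> = \<iota> (Band t r) * \<iota> (Band r q) * \<iota> (Band r s)"
      using iota_tri[of q s r] * by (simp add: mult.assoc)
    also have "\<dots> = \<iota> (Band r q) * (\<iota> (Band t q) * \<iota> (Band r s))"
      using iota_tri[of q r t] * by (simp add: mult.assoc)
    also have "\<iota> (Band t q) * \<iota> (Band r s) = \<iota> (Band r s) * \<iota> (Band t q)"
      using iota_rel[OF comm[of q t s r]] * by simp
    finally show ?thesis .
  qed
  \<comment> \<open>The common multiple condition of \<open>braid_model\<close>. It is symmetric, so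
    triangles and crossings are treated in one order of the two chords only.\<close>
  define L where "L a b \<longleftrightarrow> (\<exists>u\<in>lists ?X. \<exists>v\<in>lists ?X. weval \<iota> (a # u) = weval \<iota> (b # v) \<and>
      (\<forall>w\<in>?N. abs_length n (perm_of a * w) < abs_length n w \<longrightarrow>
        abs_length n (perm_of b * w) < abs_length n w \<longrightarrow>
        descends perm_of (abs_length n) w (a # u) \<and> descends perm_of (abs_length n) w (b # v)))" for a b
  have L_sym: "L b a" if "L a b" for a b
    using that unfolding L_def by metis
  have LI: "L (Band t s) (Band r q)"
    if "1 \<le> s" "s < t" "t \<le> n" "1 \<le> q" "q < r" "r \<le> n" "u \<in> lists ?X" "v \<in> lists ?X"
      "weval \<iota> (Band t s # u) = weval \<iota> (Band r q # v)"
      "\<And>w E. noncrossing n w E \<Longrightarrow> E s t \<Longrightarrow> E q r \<Longrightarrow> splits E (Band t s # u) \<and> splits E (Band r q # v)"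
    for t s r q u v
    unfolding L_def
  proof (rule bexI[of _ u], rule bexI[of _ v], intro conjI ballI impI)
    fix w assume w: "w \<in> ?N" "abs_length n (perm_of (Band t s) * w) < abs_length n w"
      "abs_length n (perm_of (Band r q) * w) < abs_length n w"
    then obtain E where E: "noncrossing n w E" by blast
    then have "E s t" "E q r" using w abs_length_descent[OF E] that by auto
    then have sp: "splits E (Band t s # u)" "splits E (Band r q # v)" using that(10) E by auto
    show "descends perm_of (abs_length n) w (Band t s # u)" by (rule splits_descends[OF E sp(1)])
    show "descends perm_of (abs_length n) w (Band r q # v)" by (rule splits_descends[OF E sp(2)])
  qed (use that in auto)
  have L_refl: "L (Band t s) (Band t s)" if "1 \<le> s" "s < t" "t \<le> n" for t s
    by (rule LI[of s t s t "[]" "[]"]) (use that in auto)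
  have L_comm: "L (Band t s) (Band r q)"
    if *: "1 \<le> s" "s < t" "t \<le> n" "1 \<le> q" "q < r" "r \<le> n"
      "t < q \<or> r < s \<or> (s < q \<and> r < t) \<or> (q < s \<and> t < r)" for t s r q
  proof (rule LI[of s t q r "[Band r q]" "[Band t s]"])
    show "weval \<iota> [Band t s, Band r q] = weval \<iota> [Band r q, Band t s]" using iota_rel[OF comm[OF *]] .
    show "splits E [Band t s, Band r q] \<and> splits E [Band r q, Band t s]" if "E s t" "E q r" for E
      using splits_disjoint[of s t q r E] splits_disjoint[of q r s t E] * that by auto
  qed (use * in auto)
  have L_tri: "L (Band t s) (Band t r)" "L (Band t r) (Band s r)" "L (Band t s) (Band s r)"
    if *: "1 \<le> r" "r < s" "s < t" "t \<le> n" for t s r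
  proof -
    show "L (Band t s) (Band t r)"
    proof (rule LI[of s t r t "[Band s r]" "[Band t s]"])
      fix w E assume nc: "noncrossing n w E" and E: "E s t" "E r t"
      then have "E r s" using nc_sym[OF nc] nc_trans[OF nc] by blast
      then show "splits E [Band t s, Band s r] \<and> splits E [Band t r, Band t s]"
        using splits_triangle[OF nc *(2,3)] E by blast
    qed (use * iota_tri[OF *] in auto)
    show "L (Band t r) (Band s r)"
    proof (rule LI[of r t r s "[Band t s]" "[Band t r]"])
      fix w E assume nc: "noncrossing n w E" and E: "E r t" "E r s"
      then have "E s t" using nc_sym[OF nc] nc_trans[OF nc] by blast
      then show "splits E [Band t r, Band t s] \<and> splits E [Band s r, Band t r]"
        using splits_triangle[OF nc *(2,3)] E by blast
    qed (use * iota_tri[OF *] in auto)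
    show "L (Band t s) (Band s r)"
    proof (rule LI[of s t r s "[Band s r]" "[Band t r]"])
      fix w E assume nc: "noncrossing n w E" and E: "E s t" "E r s"
      then show "splits E [Band t s, Band s r] \<and> splits E [Band s r, Band t r]"
        using splits_triangle[OF nc *(2,3)] by blast
    qed (use * iota_tri[OF *] in auto)
  qed
  have L_cross: "L (Band t s) (Band r q)"
    if *: "1 \<le> q" "q < s" "s < r" "r < t" "t \<le> n" for t s r q
  proof (rule LI[of s t q r "[Band t r, Band s q]" "[Band r s, Band t q]"])
    fix w E assume nc: "noncrossing n w E" and E: "E s t" "E q r"
    show "splits E [Band t s, Band t r, Band s q] \<and> splits E [Band r q, Band r s, Band t q]"
      using splits_crossing[OF nc *(2-4) E] by blast
  qed (use * crossing[OF *] in auto)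
  have L_all: "L (Band t s) (Band r q)"
    if *: "1 \<le> s" "s < t" "t \<le> n" "1 \<le> q" "q < r" "r \<le> n" for t s r q
  proof (cases t r rule: linorder_cases)
    case less
    consider "t < q" | "t = q" | "q < t" by (rule linorder_cases)
    then show ?thesis
    proof cases
      case 1
      then show ?thesis using L_comm * by simp
    next
      case 2
      then show ?thesis using L_sym[OF L_tri(3)[of s t r]] * less by simp
    next
      case 3
      consider "s < q" | "s = q" | "q < s" by (rule linorder_cases)
      then show ?thesis
      proof cases
        case 1
        then show ?thesis using L_sym[OF L_cross[of s q t r]] * less 3 by simp
      next
        case 2
        then show ?thesis using L_sym[OF L_tri(2)[of s t r]] * less by simp
      next
        case 3
        then show ?thesis using L_comm * less by simp
      qed
    qed
  next
    case equal
    consider "s < q" | "s = q" | "q < s" by (rule linorder_cases)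
    then show ?thesis
    proof cases
      case 1
      then show ?thesis using L_sym[OF L_tri(1)[of s q t]] * equal by simp
    next
      case 2
      then show ?thesis using L_refl * equal by simp
    next
      case 3
      then show ?thesis using L_tri(1)[of q s t] * equal by simp
    qed
  next
    case greater
    consider "r < s" | "r = s" | "s < r" by (rule linorder_cases)
    then show ?thesis
    proof cases
      case 1
      then show ?thesis using L_comm * by simp
    next
      case 2
      then show ?thesis using L_tri(3)[of q s t] * by simp
    next
      case 3
      consider "s < q" | "s = q" | "q < s" by (rule linorder_cases)
      then show ?thesis
      proof cases
        case 1
        then show ?thesis using L_comm * greater by simp
      next
        case 2
        then show ?thesis using L_tri(2)[of s r t] * greater by simp
      next
        case 3
        then show ?thesis using L_cross[of q s r t] * greater \<open>s < r\<close> by simp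
      qed
    qed
  qed
  show ?thesis
  proof
    show "weval (sgn_ext \<iota>) x = weval (sgn_ext \<iota>) y \<longleftrightarrow>
      word_eq (?X \<times> UNIV) (signed_rels ?X (rels New n)) x y"
      if "x \<in> lists (?X \<times> UNIV)" "y \<in> lists (?X \<times> UNIV)" for x y
      using presents that by blast
    fix u v assume uv: "(u, v) \<in> rels New n"
    show "u \<in> lists ?X \<and> v \<in> lists ?X \<and> length u = length v"
      using rel_cases[OF uv] by auto
    show "weval perm_of u = weval perm_of v"
      using rel_cases[OF uv] by (intro bij_eqI) (auto simp: transpose_def)
    from rel_cases[OF uv] have "splits ?F u"
    proof
      assume "\<exists>t s r q. 1 \<le> s \<and> s < t \<and> t \<le> n \<and> 1 \<le> q \<and> q < r \<and> r \<le> n \<and>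
        (t < q \<or> r < s \<or> (s < q \<and> r < t) \<or> (q < s \<and> t < r)) \<and>
        u = [Band t s, Band r q] \<and> v = [Band r q, Band t s]"
      then obtain t s r q where "1 \<le> s" "s < t" "t \<le> n" "1 \<le> q" "q < r" "r \<le> n"
        "t < q \<or> r < s \<or> (s < q \<and> r < t) \<or> (q < s \<and> t < r)" "u = [Band t s, Band r q]"
        by blast
      then show "splits ?F u" using splits_disjoint[of s t q r ?F] by simp
    next
      assume "\<exists>t s r. 1 \<le> r \<and> r < s \<and> s < t \<and> t \<le> n \<and>
        (u = [Band t s, Band s r] \<and> v = [Band t r, Band t s] \<or>
         u = [Band t r, Band t s] \<and> v = [Band s r, Band t r])"
      then obtain t s r where "1 \<le> r" "r < s" "s < t" "t \<le> n"
        "u = [Band t s, Band s r] \<or> u = [Band t r, Band t s]"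
        by blast
      then show "splits ?F u" using splits_triangle[OF ncc, of r s t] by auto
    qed
    then show "descends perm_of (abs_length n) ?c u" by (rule splits_descends[OF ncc])
  next
    show "perm_of a * perm_of a = 1" if "a \<in> ?X" for a by simp
    have "card ((\<lambda>i. i) ` {1..n}) \<le> cycle_count n 1"
      by (rule card_colouring) (simp add: colouring_def)
    then show "abs_length n 1 = 0" by (simp add: abs_length_def)
    show "abs_length n (perm_of a * w) \<le> abs_length n w + 1" if "a \<in> ?X" for a w
      using gen_cases[OF that] abs_length_step by blast
    show "\<exists>a\<in>?X. abs_length n (perm_of a * w) < abs_length n w" if w: "w \<in> ?N" "w \<noteq> 1" for w
    proof -
      obtain E where nc: "noncrossing n w E" using w by blast
      obtain i where i: "app w i \<noteq> i" using w(2) bij_eqI[of w 1] by auto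
      then have "i \<in> {1..n}" using nc_fix[OF nc] by blast
      then have "E i (app w i)" by (rule nc_app[OF nc])
      then obtain s t where st: "E s t" "s < t" using i nc_sym[OF nc] by (metis nat_neq_iff)
      then have "1 \<le> s" "t \<le> n" using nc_range[OF nc] by auto
      then show ?thesis using st abs_length_descent[OF nc] gen by blast
    qed
    show "perm_of a * w \<in> ?N" if aw: "w \<in> ?N" "a \<in> ?X" "abs_length n (perm_of a * w) < abs_length n w" for a w
    proof -
      obtain E where nc: "noncrossing n w E" using aw by blast
      obtain t s where a: "a = Band t s" "1 \<le> s" "s < t" "t \<le> n" using gen_cases[OF aw(2)] by blast
      then have "E s t" using abs_length_descent[OF nc] aw by blast
      then show ?thesis using noncrossing_split[OF nc _ a(3)] a(1) by blast
    qed
    show "fundamental_word New n \<in> lists ?X" by (rule fundamental_New_lists)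
    show "fundamental_word New n \<noteq> []" using length_fundamental_New[of n] n by auto
    show "?c \<in> ?N" using ncc by blast
    \<comment> \<open>All of \<open>{1..n}\<close> is a single class, so an invariant colouring is
      constant there.\<close>
    have "cycle_count n ?c = 1"
    proof -
      obtain h where h: "colouring ?c h" "card (h ` {1..n}) = cycle_count n ?c" using ex_colouring by blast
      have "h i = h 1" if "i \<in> {1..n}" for i
        using nc_colouring[OF ncc h(1), of i 1] that n by simp
      moreover have "1 \<in> {1..n}" using n by simp
      ultimately have "h ` {1..n} = {h 1}" by blast
      then show ?thesis using h(2) by simp
    qed
    then show "abs_length n ?c = length (fundamental_word New n)"
      by (simp add: abs_length_def length_fundamental_New)
    show "abs_length n (perm_of a * ?c) < abs_length n ?c" if "a \<in> ?X" for a
      using down that .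
    \<comment> \<open>Commuting past \<open>?c\<close> shifts both indices up by one modulo
      \<open>n\<close>. For \<open>t = n\<close> the shifted index is \<open>1\<close>, and it moves
      to the second place because the larger index comes first.\<close>
    have conj: "perm_of (Band t s) * ?c = ?c * perm_of b" if st: "1 \<le> s" "s < t" "t \<le> n"
      and b: "b = (if t = n then Band (s + 1) 1 else Band (t + 1) (s + 1))" for t s b
    proof (rule bij_eqI)
      fix x
      define t' where "t' = (if t = n then 1 else t + 1)"
      have c': "app ?c t' = t" "app ?c (s + 1) = s" using st by (auto simp: c t'_def)
      have b': "app (perm_of b) x = transpose t' (s + 1) x" for x
        using st by (auto simp: b t'_def transpose_def)
      have "transpose t s (app ?c x) = app ?c (transpose t' (s + 1) x)"
      proof -
        consider "x = t'" | "x = s + 1" | "x \<noteq> t'" "x \<noteq> s + 1" by blast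
        then show ?thesis
        proof cases
          case 3
          then have "app ?c x \<noteq> t" "app ?c x \<noteq> s" using c' app_inj[of ?c x] by metis+
          then show ?thesis using 3 by (simp add: transpose_def)
        qed (simp_all only: c' transpose_apply_first transpose_apply_second)
      qed
      then show "app (perm_of (Band t s) * ?c) x = app (?c * perm_of b) x" by (simp add: b')
    qed
    show "\<exists>b\<in>?X. perm_of a * ?c = ?c * perm_of b" if a: "a \<in> ?X" for a
    proof -
      obtain t s where ts: "a = Band t s" "1 \<le> s" "s < t" "t \<le> n" using gen_cases[OF a] by blast
      show ?thesis
      proof (cases "t = n")
        case True
        then have "perm_of a * ?c = ?c * perm_of (Band (s + 1) 1)"
          unfolding ts(1) by (intro conj ts(2-4)) simp
        moreover have "Band (s + 1) 1 \<in> ?X" using ts by (intro gen) auto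
        ultimately show ?thesis by blast
      next
        case False
        then have "perm_of a * ?c = ?c * perm_of (Band (t + 1) (s + 1))"
          unfolding ts(1) by (intro conj ts(2-4)) simp
        moreover have "Band (t + 1) (s + 1) \<in> ?X" using ts False by (intro gen) auto
        ultimately show ?thesis by blast
      qed
    qed
    show "\<exists>a\<in>?X. perm_of a * ?c = ?c * perm_of b" if b: "b \<in> ?X" for b
    proof -
      obtain r q where rq: "b = Band r q" "1 \<le> q" "q < r" "r \<le> n" using gen_cases[OF b] by blast
      show ?thesis
      proof (cases "q = 1")
        case True
        then have "perm_of (Band n (r - 1)) * ?c = ?c * perm_of b"
          using rq by (intro conj) auto
        moreover have "Band n (r - 1) \<in> ?X" using rq True by (intro gen) auto
        ultimately show ?thesis by blast
      next
        case False
        then have "perm_of (Band (r - 1) (q - 1)) * ?c = ?c * perm_of b"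
          using rq by (intro conj) auto
        moreover have "Band (r - 1) (q - 1) \<in> ?X" using rq False by (intro gen) auto
        ultimately show ?thesis by blast
      qed
    qed
    fix a b assume ab: "a \<in> ?X" "b \<in> ?X"
    then have "L a b" using gen_cases L_all by blast
    then show "\<exists>u\<in>lists ?X. \<exists>v\<in>lists ?X. weval \<iota> (a # u) = weval \<iota> (b # v) \<and>
      (\<forall>w\<in>?N. abs_length n (perm_of a * w) < abs_length n w \<longrightarrow>
        abs_length n (perm_of b * w) < abs_length n w \<longrightarrow>
        descends perm_of (abs_length n) w (a # u) \<and> descends perm_of (abs_length n) w (b # v))"
      by (simp only: L_def)
  qed
qed

section \<open>Presented groups\<close>

lemma word_eq_lists:
  assumes "word_eq Y S u v" "S \<subseteq> lists Y \<times> lists Y"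
  shows "u \<in> lists Y \<and> v \<in> lists Y"
  using assms(1) by induction (use assms(2) in auto)

lemma word_eq_append:
  assumes "word_eq Y S u v" "x \<in> lists Y" "y \<in> lists Y"
  shows "word_eq Y S (x @ u @ y) (x @ v @ y)"
  using assms
proof induction
  case (rel u v x' y')
  then show ?case using word_eq.rel[OF rel(1), of "x @ x'" Y "y' @ y"] by simp
next
  case (refl w)
  then show ?case by (intro word_eq.refl) simp
next
  case (sym v w)
  show ?case by (rule word_eq.sym) (rule sym.IH[OF sym.prems])
next
  case (trans u v w)
  show ?case by (rule word_eq.trans) (rule trans.IH[OF trans.prems])+
qed

lemma word_eq_append2:
  assumes "word_eq Y S u u'" "word_eq Y S v v'" "S \<subseteq> lists Y \<times> lists Y"
  shows "word_eq Y S (u @ v) (u' @ v')"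
proof -
  have l: "u \<in> lists Y" "u' \<in> lists Y" "v \<in> lists Y" "v' \<in> lists Y"
    using assms word_eq_lists by blast+
  have "word_eq Y S (u @ v) (u' @ v)" using word_eq_append[OF assms(1), of "[]" v] l by simp
  moreover have "word_eq Y S (u' @ v) (u' @ v')" using word_eq_append[OF assms(2), of u' "[]"] l by simp
  ultimately show ?thesis by (rule word_eq.trans)
qed

lemma word_class_eq_iff:
  assumes "v \<in> lists Y"
  shows "word_class Y S u = word_class Y S v \<longleftrightarrow> word_eq Y S u v"
  unfolding word_class_def using assms by (blast intro: word_eq.intros)

lemma mult_word_class:
  assumes "S \<subseteq> lists Y \<times> lists Y" "u \<in> lists Y" "v \<in> lists Y"
  shows "word_class Y S u \<otimes>\<^bsub>presented_monoid Y S\<^esub> word_class Y S v = word_class Y S (u @ v)"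
proof -
  have const: "word_class Y S (u' @ v') = word_class Y S (u @ v)"
    if "u' \<in> word_class Y S u" "v' \<in> word_class Y S v" for u' v'
  proof -
    have "word_eq Y S u u'" "word_eq Y S v v'" using that by (simp_all add: word_class_def)
    then have "word_eq Y S (u' @ v') (u @ v)"
      using word_eq_append2[OF _ _ assms(1)] word_eq.sym by blast
    moreover have "u @ v \<in> lists Y" using assms by simp
    ultimately show ?thesis by (simp add: word_class_eq_iff)
  qed
  moreover have "u \<in> word_class Y S u" "v \<in> word_class Y S v"
    using assms by (auto simp: word_class_def intro: word_eq.refl)
  ultimately have "(\<Union>u'\<in>word_class Y S u. \<Union>v'\<in>word_class Y S v. word_class Y S (u' @ v')) = word_class Y S (u @ v)"
    by - (rule SUP_eq_const, blast, rule SUP_eq_const, blast, rule const)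
  then show ?thesis by (simp add: presented_monoid_def)
qed

lemma signed_rels_lists:
  assumes "R \<subseteq> lists X \<times> lists X"
  shows "signed_rels X R \<subseteq> lists (X \<times> UNIV) \<times> lists (X \<times> UNIV)"
  using assms by (fastforce simp: signed_rels_def positive_word_def)

definition inverse_word :: "('a \<times> bool) list \<Rightarrow> ('a \<times> bool) list" where
  "inverse_word w = rev (map (\<lambda>(x, b). (x, \<not> b)) w)"

lemma inverse_word_cancel:
  "w \<in> lists (X \<times> UNIV) \<Longrightarrow> word_eq (X \<times> UNIV) (signed_rels X R) (inverse_word w @ w) []"
proof (induction w rule: list.induct)
  case Nil
  then show ?case by (simp add: inverse_word_def word_eq.refl)
next
  case (Cons x w)
  obtain y b where x: "x = (y, b)" by fastforce
  have iw: "inverse_word w \<in> lists (X \<times> UNIV)" "w \<in> lists (X \<times> UNIV)" "y \<in> X"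
    using Cons.prems x by (auto simp: inverse_word_def)
  have "([(y, \<not> b), (y, \<not> \<not> b)], []) \<in> signed_rels X R"
    using iw unfolding signed_rels_def by blast
  from word_eq.rel[OF this iw(1,2)]
  have "word_eq (X \<times> UNIV) (signed_rels X R) (inverse_word (x # w) @ (x # w)) (inverse_word w @ w)"
    by (simp add: x inverse_word_def)
  then show ?case using Cons.IH iw word_eq.trans by blast
qed

lemma presented_group_group:
  assumes R: "R \<subseteq> lists X \<times> lists X"
  shows "group (presented_group X R)"
proof -
  let ?Y = "X \<times> (UNIV :: bool set)" let ?S = "signed_rels X R" let ?G = "presented_group X R"
  note S = signed_rels_lists[OF R]
  have carr: "carrier ?G = word_class ?Y ?S ` lists ?Y" "\<one>\<^bsub>?G\<^esub> = word_class ?Y ?S []"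
    by (simp_all add: presented_group_def presented_monoid_def)
  have mult: "word_class ?Y ?S u \<otimes>\<^bsub>?G\<^esub> word_class ?Y ?S v = word_class ?Y ?S (u @ v)"
    if "u \<in> lists ?Y" "v \<in> lists ?Y" for u v
    using mult_word_class[OF S that] by (simp add: presented_group_def)
  show ?thesis
  proof (rule groupI)
    fix x y assume "x \<in> carrier ?G" "y \<in> carrier ?G"
    then obtain u v where uv: "u \<in> lists ?Y" "x = word_class ?Y ?S u" "v \<in> lists ?Y" "y = word_class ?Y ?S v"
      unfolding carr by blast
    then have "u @ v \<in> lists ?Y" by simp
    then show "x \<otimes>\<^bsub>?G\<^esub> y \<in> carrier ?G" unfolding uv mult[OF uv(1,3)] carr by (rule imageI)
  next
    have "[] \<in> lists ?Y" by simp
    then show "\<one>\<^bsub>?G\<^esub> \<in> carrier ?G" unfolding carr by (rule imageI)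
  next
    fix x y z assume "x \<in> carrier ?G" "y \<in> carrier ?G" "z \<in> carrier ?G"
    then obtain u v w where uv: "u \<in> lists ?Y" "x = word_class ?Y ?S u" "v \<in> lists ?Y" "y = word_class ?Y ?S v"
      "w \<in> lists ?Y" "z = word_class ?Y ?S w"
      unfolding carr by blast
    then have "u @ v \<in> lists ?Y" "v @ w \<in> lists ?Y" by simp_all
    then show "x \<otimes>\<^bsub>?G\<^esub> y \<otimes>\<^bsub>?G\<^esub> z = x \<otimes>\<^bsub>?G\<^esub> (y \<otimes>\<^bsub>?G\<^esub> z)"
      unfolding uv mult[OF uv(1,3)] mult[OF uv(3,5)]
      using mult[of "u @ v" w] mult[of u "v @ w"] uv(1,5) by simp
  next
    fix x assume "x \<in> carrier ?G"
    then obtain u where u: "u \<in> lists ?Y" "x = word_class ?Y ?S u" unfolding carr by blast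
    have "[] \<in> lists ?Y" by simp
    then show "\<one>\<^bsub>?G\<^esub> \<otimes>\<^bsub>?G\<^esub> x = x" unfolding carr u using mult[of "[]" u] u(1) by simp
  next
    fix x assume "x \<in> carrier ?G"
    then obtain w where w: "w \<in> lists ?Y" "x = word_class ?Y ?S w" unfolding carr by blast
    have iw: "inverse_word w \<in> lists ?Y" using w(1) by (auto simp: inverse_word_def)
    have "[] \<in> lists ?Y" by simp
    then have "word_class ?Y ?S (inverse_word w @ w) = \<one>\<^bsub>?G\<^esub>"
      unfolding carr using inverse_word_cancel[OF w(1), of R] by (simp only: word_class_eq_iff)
    then have "word_class ?Y ?S (inverse_word w) \<otimes>\<^bsub>?G\<^esub> x = \<one>\<^bsub>?G\<^esub>"
      unfolding w(2) mult[OF iw w(1)] .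
    moreover have "word_class ?Y ?S (inverse_word w) \<in> carrier ?G" unfolding carr using iw by (rule imageI)
    ultimately show "\<exists>y\<in>carrier ?G. y \<otimes>\<^bsub>?G\<^esub> x = \<one>\<^bsub>?G\<^esub>" by blast
  qed
qed

lemma word_eq_positive:
  assumes "word_eq X R u v"
  shows "word_eq (X \<times> UNIV) (signed_rels X R) (positive_word u) (positive_word v)"
  using assms
proof induction
  case (rel u v x y)
  have "(positive_word u, positive_word v) \<in> signed_rels X R" using rel by (auto simp: signed_rels_def)
  moreover have "positive_word x \<in> lists (X \<times> UNIV)" "positive_word y \<in> lists (X \<times> UNIV)"
    using rel by (auto simp: positive_word_def)
  ultimately show ?case using word_eq.rel[of "positive_word u" "positive_word v" "signed_rels X R"]
    by (simp add: positive_word_def)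
next
  case (refl w)
  then show ?case by (intro word_eq.refl) (auto simp: positive_word_def)
next
  case (sym v w)
  show ?case using sym.IH by (rule word_eq.sym)
next
  case (trans u v w)
  show ?case using trans.IH by (rule word_eq.trans)
qed

lemma monoid_to_group_class:
  assumes R: "R \<subseteq> lists X \<times> lists X" and w: "w \<in> lists X"
  shows "monoid_to_group X R (word_class X R w) = word_class (X \<times> UNIV) (signed_rels X R) (positive_word w)"
proof -
  have const: "word_class (X \<times> UNIV) (signed_rels X R) (positive_word v) =
      word_class (X \<times> UNIV) (signed_rels X R) (positive_word w)" if "v \<in> word_class X R w" for v
  proof -
    have "word_eq X R w v" using that by (simp add: word_class_def)
    then have "word_eq (X \<times> UNIV) (signed_rels X R) (positive_word v) (positive_word w)"
      using word_eq_positive word_eq.sym by blast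
    moreover have "positive_word w \<in> lists (X \<times> UNIV)" using w by (auto simp: positive_word_def)
    ultimately show ?thesis by (simp add: word_class_eq_iff)
  qed
  have "w \<in> word_class X R w" using w by (auto simp: word_class_def intro: word_eq.refl)
  then have "word_class X R w \<noteq> {}" by blast
  then show ?thesis unfolding monoid_to_group_def by (rule SUP_eq_const) (rule const)
qed

section \<open>The regular representation\<close>

text \<open>It turns the group on a carrier set into a group inside a type.\<close>

definition regular :: "('a, 'b) monoid_scheme \<Rightarrow> 'a \<Rightarrow> 'a bij" where
  "regular G g = mk_bij (\<lambda>x. if x \<in> carrier G then g \<otimes>\<^bsub>G\<^esub> x else x)"

context group
begin

lemma app_regular:
  assumes "g \<in> carrier G"
  shows "app (regular G g) x = (if x \<in> carrier G then g \<otimes> x else x)"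
proof -
  have "bij (\<lambda>x. if x \<in> carrier G then g \<otimes> x else x)"
    by (rule o_bij[of "\<lambda>x. if x \<in> carrier G then inv g \<otimes> x else x"])
      (use assms in \<open>auto simp: fun_eq_iff m_assoc[symmetric]\<close>)
  then show ?thesis by (simp add: regular_def app_mk_bij)
qed

lemma regular_mult: "g \<in> carrier G \<Longrightarrow> h \<in> carrier G \<Longrightarrow> regular G (g \<otimes> h) = regular G g * regular G h"
  by (rule bij_eqI) (simp add: app_regular m_assoc)

lemma regular_one [simp]: "regular G \<one> = 1"
  by (rule bij_eqI) (simp add: app_regular)

lemma regular_inv: "g \<in> carrier G \<Longrightarrow> regular G (inv g) = inverse (regular G g)"
  using regular_mult[of g "inv g"] inverse_unique'[of "regular G g" "regular G (inv g)"] by simp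

lemma regular_inj:
  assumes "g \<in> carrier G" "h \<in> carrier G"
  shows "regular G g = regular G h \<longleftrightarrow> g = h"
proof
  assume "regular G g = regular G h"
  then have "app (regular G g) \<one> = app (regular G h) \<one>" by simp
  then show "g = h" using assms by (simp add: app_regular)
qed simp

lemma regular_int_pow:
  assumes "g \<in> carrier G" shows "regular G (g [^] (k :: int)) = zpow (regular G g) k"
proof (induction k rule: int_induct[where k = 0])
  case (step1 i)
  have "g [^] (i + 1) = g \<otimes> g [^] i"
    using int_pow_mult[OF assms, of 1 i] assms by (simp add: add.commute int_pow_1)
  then show ?case using step1 assms by (simp add: zpow_Suc regular_mult)
next
  case (step2 i)
  have "g [^] i = g \<otimes> g [^] (i - 1)"
    using int_pow_mult[OF assms, of 1 "i - 1"] assms by (simp add: int_pow_1)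
  then have "zpow (regular G g) i = regular G g * regular G (g [^] (i - 1))"
    using step2 assms by (simp add: regular_mult)
  then show ?case by (simp add: zpow_pred inv_cancel)
qed simp

lemma regular_foldr:
  "set xs \<subseteq> carrier G \<Longrightarrow> foldr (\<otimes>) xs \<one> \<in> carrier G \<and>
    regular G (foldr (\<otimes>) xs \<one>) = prod_list (map (regular G) xs)"
  by (induction xs) (auto simp: regular_mult)

end

section \<open>Transfer to the braid group\<close>

lemma rels_lists: "rels p n \<subseteq> lists (gens p n) \<times> lists (gens p n)"
  by (cases p) auto

definition iota :: "presentation \<Rightarrow> nat \<Rightarrow> gen \<Rightarrow> braid bij" where
  "iota p n x = regular (braid_group p n)
     (word_class (gens p n \<times> UNIV) (signed_rels (gens p n) (rels p n)) [(x, True)])"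

definition model_length :: "presentation \<Rightarrow> nat \<Rightarrow> nat bij \<Rightarrow> nat" where
  "model_length p n = (case p of Old \<Rightarrow> inv_number n | New \<Rightarrow> abs_length n)"

definition model_set :: "presentation \<Rightarrow> nat \<Rightarrow> nat bij set" where
  "model_set p n = (case p of Old \<Rightarrow> perms_upto n | New \<Rightarrow> {w. \<exists>E. noncrossing n w E})"

locale braid_presentation =
  fixes p :: presentation and n :: nat
  assumes n: "n \<ge> 2"
begin

abbreviation "X \<equiv> gens p n"
abbreviation "R \<equiv> rels p n"
abbreviation "G \<equiv> braid_group p n"
abbreviation "cls \<equiv> word_class (X \<times> UNIV) (signed_rels X R)"
abbreviation "\<phi> \<equiv> regular G"

sublocale G: group G
  unfolding braid_group_def by (rule presented_group_group[OF rels_lists])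

lemma carrier_G: "carrier G = cls ` lists (X \<times> UNIV)"
  by (simp add: braid_group_def presented_group_def presented_monoid_def)

lemma one_G: "\<one>\<^bsub>G\<^esub> = cls []"
  by (simp add: braid_group_def presented_group_def presented_monoid_def)

lemma cls_carrier: "w \<in> lists (X \<times> UNIV) \<Longrightarrow> cls w \<in> carrier G"
  unfolding carrier_G by (rule imageI)

lemma mult_cls: "u \<in> lists (X \<times> UNIV) \<Longrightarrow> v \<in> lists (X \<times> UNIV) \<Longrightarrow> cls u \<otimes>\<^bsub>G\<^esub> cls v = cls (u @ v)"
  unfolding braid_group_def presented_group_def
  by (rule mult_word_class[OF signed_rels_lists[OF rels_lists]])

lemma phi_letter: assumes "x \<in> X" shows "\<phi> (cls [(x, b)]) = sgn_ext (iota p n) (x, b)"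
proof (cases b)
  case True
  then show ?thesis by (simp add: sgn_ext_def iota_def)
next
  case False
  have l: "[(x, True)] \<in> lists (X \<times> UNIV)" "[(x, False)] \<in> lists (X \<times> UNIV)" using assms by auto
  have "([(x, True), (x, \<not> True)], []) \<in> signed_rels X R"
    using assms unfolding signed_rels_def by blast
  from word_eq.rel[OF this, of "[]" "X \<times> UNIV" "[]"]
  have "word_eq (X \<times> UNIV) (signed_rels X R) [(x, True), (x, False)] []" by simp
  then have "cls [(x, True), (x, False)] = \<one>\<^bsub>G\<^esub>"
    unfolding one_G by (subst word_class_eq_iff) auto
  then have "cls [(x, True)] \<otimes>\<^bsub>G\<^esub> cls [(x, False)] = \<one>\<^bsub>G\<^esub>" using mult_cls[OF l] by simp
  then have "\<phi> (cls [(x, True)]) * \<phi> (cls [(x, False)]) = 1"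
    using G.regular_mult[OF cls_carrier cls_carrier, OF l] by simp
  then show ?thesis using False inverse_unique'[of "\<phi> (cls [(x, True)])" "\<phi> (cls [(x, False)])"]
    by (simp add: sgn_ext_def iota_def)
qed

lemma phi_cls: "w \<in> lists (X \<times> UNIV) \<Longrightarrow> \<phi> (cls w) = weval (sgn_ext (iota p n)) w"
proof (induction w rule: list.induct)
  case Nil
  then show ?case by (simp flip: one_G)
next
  case (Cons a w)
  obtain x b where a: "a = (x, b)" by fastforce
  have l: "[a] \<in> lists (X \<times> UNIV)" "w \<in> lists (X \<times> UNIV)" "x \<in> X" using Cons.prems a by auto
  have "\<phi> (cls (a # w)) = \<phi> (cls [a]) * \<phi> (cls w)"
    using mult_cls[OF l(1,2)] G.regular_mult[OF cls_carrier cls_carrier, OF l(1,2)] by simp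
  then show ?case using phi_letter[OF l(3)] Cons.IH[OF l(2)] a by simp
qed

text \<open>Equality of words is equality of their classes, and the regular representation is
  faithful.\<close>

lemma presents:
  assumes "u \<in> lists (X \<times> UNIV)" "v \<in> lists (X \<times> UNIV)"
  shows "weval (sgn_ext (iota p n)) u = weval (sgn_ext (iota p n)) v \<longleftrightarrow>
    word_eq (X \<times> UNIV) (signed_rels X R) u v"
proof -
  have "weval (sgn_ext (iota p n)) u = weval (sgn_ext (iota p n)) v \<longleftrightarrow> cls u = cls v"
    unfolding phi_cls[OF assms(1), symmetric] phi_cls[OF assms(2), symmetric]
    by (rule G.regular_inj) (use cls_carrier assms in blast)+
  then show ?thesis using word_class_eq_iff[OF assms(2)] by metis
qed

lemma iota_rel: assumes "(u, v) \<in> R" shows "weval (iota p n) u = weval (iota p n) v"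
proof -
  have l: "u \<in> lists X" "v \<in> lists X" using rels_lists assms by blast+
  have "(positive_word u, positive_word v) \<in> signed_rels X R"
    using assms unfolding signed_rels_def by blast
  from word_eq.rel[OF this, of "[]" "X \<times> UNIV" "[]"]
  have "word_eq (X \<times> UNIV) (signed_rels X R) (positive_word u) (positive_word v)" by simp
  then show ?thesis using presents[OF positive_word_lists positive_word_lists, OF l] by simp
qed

lemma model: "braid_model X R (iota p n) perm_of (model_length p n) (model_set p n) (fundamental_word p n)"
proof (cases p)
  case Old
  show ?thesis using braid_model_Old[OF n, of "iota p n"] presents iota_rel
    unfolding Old by (simp add: model_length_def model_set_def)
next
  case New
  show ?thesis using braid_model_New[OF n, of "iota p n"] presents iota_rel
    unfolding New by (simp add: model_length_def model_set_def)
qed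

sublocale M: braid_model X R "iota p n" perm_of "model_length p n" "model_set p n" "fundamental_word p n"
  by (rule model)

abbreviation "C \<equiv> carrier G"
abbreviation "\<Delta> \<equiv> fundamental_braid p n"

lemma phi_inj: "g \<in> C \<Longrightarrow> h \<in> C \<Longrightarrow> \<phi> g = \<phi> h \<longleftrightarrow> g = h"
  by (rule G.regular_inj)

lemma phi_fractions: "g \<in> C \<Longrightarrow> \<phi> g \<in> M.fractions"
  unfolding carrier_G using M.signed_fractions phi_cls by force

lemma braid_of_word_eq: "w \<in> lists X \<Longrightarrow> braid_of_word p n w = cls (positive_word w)"
  unfolding braid_of_word_def by (rule monoid_to_group_class[OF rels_lists])

lemma braid_of_word: "w \<in> lists X \<Longrightarrow> braid_of_word p n w \<in> C \<and> \<phi> (braid_of_word p n w) = weval (iota p n) w"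
  using cls_carrier[OF positive_word_lists] phi_cls[OF positive_word_lists, of w]
  by (simp only: braid_of_word_eq weval_sgn_positive simp_thms)

lemma positive_braids_eq: "positive_braids p n = braid_of_word p n ` lists X"
  by (simp add: positive_braids_def braid_monoid_def presented_monoid_def image_image braid_of_word_def)

lemma positive_braids_C: "g \<in> positive_braids p n \<Longrightarrow> g \<in> C"
  unfolding positive_braids_eq using braid_of_word by blast

lemma phi_positive: "\<phi> ` positive_braids p n = M.P"
  unfolding positive_braids_eq M.P_def image_image using braid_of_word by (intro image_cong) auto

lemma positive_iff: "g \<in> C \<Longrightarrow> g \<in> positive_braids p n \<longleftrightarrow> \<phi> g \<in> M.P"
  using phi_positive phi_inj positive_braids_C by (metis (no_types, lifting) imageE imageI)

lemma fundamental: "\<Delta> \<in> C" "\<phi> \<Delta> = M.D"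
  using braid_of_word[OF M.dw(1)] by (auto simp: fundamental_braid_def)

lemma le_iff: assumes "V \<in> C" "W \<in> C" shows "braid_le p n V W \<longleftrightarrow> M.le (\<phi> V) (\<phi> W)"
proof
  assume "braid_le p n V W"
  then obtain P where P: "P \<in> positive_braids p n" "W = V \<otimes>\<^bsub>G\<^esub> P" by (auto simp: braid_le_def)
  then show "M.le (\<phi> V) (\<phi> W)"
    using positive_braids_C[OF P(1)] positive_iff[of P] assms by (simp add: G.regular_mult)
next
  assume le: "M.le (\<phi> V) (\<phi> W)"
  define P where "P = inv\<^bsub>G\<^esub> V \<otimes>\<^bsub>G\<^esub> W"
  have P: "P \<in> C" "W = V \<otimes>\<^bsub>G\<^esub> P" using assms by (simp_all add: P_def G.m_assoc[symmetric])
  have "\<phi> P \<in> M.P" using le assms by (simp add: P_def G.regular_mult G.regular_inv M.le_def)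
  then show "braid_le p n V W" using P positive_iff unfolding braid_le_def by blast
qed

section \<open>Simple factors and normal forms in the braid group\<close>

lemma canonical_C: "A \<in> canonical_factors p n \<Longrightarrow> A \<in> C"
  by (auto simp: canonical_factors_def positive_braids_C)

lemma canonical_iff: assumes "A \<in> C" shows "A \<in> canonical_factors p n \<longleftrightarrow> \<phi> A \<in> M.simples"
proof -
  have "A \<in> canonical_factors p n \<longleftrightarrow> A \<in> positive_braids p n \<and> braid_le p n A \<Delta>"
    by (auto simp: canonical_factors_def braid_le_def)
  then show ?thesis using assms fundamental positive_iff le_iff by (simp add: M.simples_def)
qed

lemma phi_canonical: "\<phi> ` canonical_factors p n = M.simples"
proof
  show "\<phi> ` canonical_factors p n \<subseteq> M.simples" using canonical_C canonical_iff by blast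
  show "M.simples \<subseteq> \<phi> ` canonical_factors p n"
  proof
    fix a assume a: "a \<in> M.simples"
    then obtain A where "A \<in> positive_braids p n" "a = \<phi> A"
      using phi_positive M.simplesD(1) by blast
    then show "a \<in> \<phi> ` canonical_factors p n" using a canonical_iff positive_braids_C by blast
  qed
qed

lemma proper_iff: "A \<in> C \<Longrightarrow> A \<in> proper_factors p n \<longleftrightarrow> \<phi> A \<in> M.proper"
  using canonical_iff phi_inj[of A \<Delta>] phi_inj[of A "\<one>\<^bsub>G\<^esub>"] fundamental
  by (simp add: proper_factors_def M.proper_def)

lemma proper_C: "A \<in> proper_factors p n \<Longrightarrow> A \<in> C"
  by (simp add: proper_factors_def canonical_C)

text \<open>Once \<open>P'\<close> is quantified away, an equation \<open>A B = A' P'\<close> says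
  that \<open>A'\<close> divides \<open>A B\<close>; and the regular representation maps the
  canonical factors onto \<open>M.simples\<close>.\<close>

lemma left_greedy_iff:
  assumes "A \<in> canonical_factors p n" "B \<in> canonical_factors p n"
  shows "left_greedy p n A B \<longleftrightarrow> M.greedy_pair (\<phi> A) (\<phi> B)"
proof -
  have C: "A \<in> C" "B \<in> C" "A \<otimes>\<^bsub>G\<^esub> B \<in> C" and P: "B \<in> positive_braids p n"
    using assms canonical_C by (auto simp: canonical_factors_def)
  have "left_greedy p n A B \<longleftrightarrow> (\<forall>A'\<in>canonical_factors p n. braid_le p n A' (A \<otimes>\<^bsub>G\<^esub> B) \<longrightarrow> braid_le p n A' A)"
    using assms P by (auto simp: left_greedy_def braid_le_def)
  also have "\<dots> \<longleftrightarrow> (\<forall>A'\<in>canonical_factors p n. M.le (\<phi> A') (\<phi> A * \<phi> B) \<longrightarrow> M.le (\<phi> A') (\<phi> A))"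
    using canonical_C C by (simp add: le_iff G.regular_mult)
  also have "\<dots> \<longleftrightarrow> M.greedy_pair (\<phi> A) (\<phi> B)"
    unfolding M.greedy_pair_def phi_canonical[symmetric] by blast
  finally show ?thesis .
qed

lemma braid_prod:
  "set As \<subseteq> C \<Longrightarrow> braid_prod p n As \<in> C \<and> \<phi> (braid_prod p n As) = prod_list (map \<phi> As)"
  unfolding braid_prod_def by (rule G.regular_foldr)

lemma phi_pow: "\<Delta> [^]\<^bsub>G\<^esub> (u :: int) \<in> C \<and> \<phi> (\<Delta> [^]\<^bsub>G\<^esub> u) = zpow M.D u"
  using fundamental by (simp add: G.regular_int_pow)

lemma phi_pow_prod:
  assumes "set As \<subseteq> C"
  shows "\<Delta> [^]\<^bsub>G\<^esub> (u :: int) \<otimes>\<^bsub>G\<^esub> braid_prod p n As \<in> C"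
    and "\<phi> (\<Delta> [^]\<^bsub>G\<^esub> u \<otimes>\<^bsub>G\<^esub> braid_prod p n As) = zpow M.D u * prod_list (map \<phi> As)"
  using phi_pow[of u] braid_prod[OF assms] by (simp_all add: G.regular_mult)

lemma is_normal_form_iff:
  assumes "W \<in> C" "set As \<subseteq> C"
  shows "is_normal_form p n W (u, As) \<longleftrightarrow> M.is_nf (\<phi> W) (u, map \<phi> As)"
proof (cases "set As \<subseteq> proper_factors p n")
  case True
  then have "set (map \<phi> As) \<subseteq> M.proper" using proper_iff assms by auto
  moreover have "W = \<Delta> [^]\<^bsub>G\<^esub> u \<otimes>\<^bsub>G\<^esub> braid_prod p n As \<longleftrightarrow> \<phi> W = zpow M.D u * prod_list (map \<phi> As)"
    using phi_inj[OF assms(1) phi_pow_prod(1)[OF assms(2), of u]] phi_pow_prod(2)[OF assms(2), of u] by metis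
  moreover have "(\<forall>i. Suc i < length As \<longrightarrow> left_greedy p n (As ! i) (As ! Suc i)) \<longleftrightarrow> M.greedy (map \<phi> As)"
  proof -
    have "As ! i \<in> canonical_factors p n" if "i < length As" for i
      using subsetD[OF True nth_mem[OF that]] by (simp add: proper_factors_def)
    then show ?thesis by (simp add: M.greedy_nth left_greedy_iff)
  qed
  ultimately show ?thesis using True by (simp add: is_normal_form_def M.is_nf_def)
next
  case False
  then have "\<not> set (map \<phi> As) \<subseteq> M.proper" using proper_iff assms by auto
  then show ?thesis using False by (simp add: is_normal_form_def M.is_nf_def)
qed

text \<open>The factors of the abstract normal form are simple, hence images of canonical factors,
  and injectivity carries uniqueness back. So the \<open>THE\<close> in \<open>normal_form\<close>
  denotes what it should.\<close>

lemma normal_form: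
  assumes "W \<in> C"
  obtains u As where "normal_form p n W = (u, As)" "set As \<subseteq> C" "M.nf (\<phi> W) = (u, map \<phi> As)"
proof -
  obtain u Bs where nf: "M.is_nf (\<phi> W) (u, Bs)" using M.nf_exists[OF phi_fractions[OF assms]] by blast
  then have "set Bs \<subseteq> \<phi> ` canonical_factors p n"
    unfolding phi_canonical by (auto simp: M.is_nf_def M.proper_def)
  then have "set Bs \<subseteq> \<phi> ` C" using canonical_C by blast
  define As where "As = map (inv_into C \<phi>) Bs"
  have As: "set As \<subseteq> C" "Bs = map \<phi> As"
    using \<open>set Bs \<subseteq> \<phi> ` C\<close> inv_into_into[of _ \<phi> C] f_inv_into_f[of _ \<phi> C]
    by (auto simp: As_def intro!: map_idI[symmetric])
  have "normal_form p n W = (u, As)" unfolding normal_form_def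
  proof (rule the_equality)
    show "is_normal_form p n W (u, As)" using nf As is_normal_form_iff[OF assms] by simp
    fix x assume x: "is_normal_form p n W x"
    obtain v Bs' where v: "x = (v, Bs')" by fastforce
    then have C: "set Bs' \<subseteq> C" using x proper_C by (auto simp: is_normal_form_def)
    then have "M.is_nf (\<phi> W) (v, map \<phi> Bs')" using x v is_normal_form_iff[OF assms] by simp
    then have "u = v" "map \<phi> As = map \<phi> Bs'" using M.nf_unique[OF nf] As by auto
    moreover have "inj_on \<phi> C" using phi_inj by (auto simp: inj_on_def)
    ultimately show "x = (u, As)" using map_inj_on[of \<phi> As Bs'] As C v
      by (metis Un_least inj_on_subset)
  qed
  then show ?thesis using that As M.nf_eq[OF nf] by blast
qed

lemma inf_eq: "W \<in> C \<Longrightarrow> braid_inf p n W = M.ginf (\<phi> W)"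
  by (elim normal_form) (simp add: braid_inf_def M.ginf_def)

lemma sup_eq: "W \<in> C \<Longrightarrow> braid_sup p n W = M.gsup (\<phi> W)"
  by (elim normal_form) (simp add: braid_sup_def M.gsup_def)

text \<open>Integer powers of \<open>tau\<close> are taken in \<open>AutoGroup\<close>, so
  \<open>tau\<close> must be a bijective homomorphism that is also extensional, that is,
  \<open>undefined\<close> outside the carrier.\<close>

lemma tau_hom: "tau p n \<in> auto G"
proof -
  have tau: "tau p n a = inv\<^bsub>G\<^esub> \<Delta> \<otimes>\<^bsub>G\<^esub> a \<otimes>\<^bsub>G\<^esub> \<Delta>" if "a \<in> C" for a
    using that by (simp add: tau_def Let_def)
  have cancel: "\<Delta> \<otimes>\<^bsub>G\<^esub> (inv\<^bsub>G\<^esub> \<Delta> \<otimes>\<^bsub>G\<^esub> z) = z" "inv\<^bsub>G\<^esub> \<Delta> \<otimes>\<^bsub>G\<^esub> (\<Delta> \<otimes>\<^bsub>G\<^esub> z) = z" if "z \<in> C" for z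
    using that fundamental(1) by (simp_all flip: G.m_assoc)
  have hom: "tau p n \<in> hom G G"
    using fundamental(1) by (intro homI) (simp_all add: tau G.m_assoc cancel)
  have "bij_betw (tau p n) C C"
    by (rule bij_betw_byWitness[of _ "\<lambda>a. \<Delta> \<otimes>\<^bsub>G\<^esub> a \<otimes>\<^bsub>G\<^esub> inv\<^bsub>G\<^esub> \<Delta>"])
      (use fundamental(1) in \<open>auto simp: tau G.m_assoc cancel\<close>)
  moreover have "tau p n \<in> extensional C" by (simp add: tau_def Let_def)
  ultimately show ?thesis using hom by (simp add: auto_def Bij_def)
qed

text \<open>One step of the power is one conjugation by \<open>D\<close>, in either direction. This
  matches the rotated factor in \<open>cycling\<close> and \<open>decycling\<close> with the one in
  \<open>gcycling\<close> and \<open>gdecycling\<close>.\<close>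

lemma tau_pow:
  assumes "a \<in> C"
  shows "tau_pow p n u a \<in> C \<and> \<phi> (tau_pow p n u a) = zpow M.D (- u) * \<phi> a * zpow M.D u"
proof -
  let ?A = "AutoGroup G"
  interpret A: group ?A by (rule G.AutoGroup)
  have t: "tau p n \<in> carrier ?A" using tau_hom by (simp add: AutoGroup_def)
  have pow: "tau_pow p n k \<in> Bij C" for k
    using A.int_pow_closed[OF t, of k] by (simp add: AutoGroup_def tau_pow_def auto_def)
  have closed: "tau_pow p n k a \<in> C" if "a \<in> C" for k a
    using pow[of k] that by (auto simp: Bij_def bij_betw_def)
  have "tau_pow p n (k + 1) = tau p n \<otimes>\<^bsub>?A\<^esub> tau_pow p n k" for k :: int
    using A.int_pow_mult[OF t, of 1 k] t by (simp add: tau_pow_def add.commute A.int_pow_1)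
  then have "tau_pow p n (k + 1) a = tau p n (tau_pow p n k a)" for k
    using pow[of k] tau_hom assms
    by (simp add: AutoGroup_def BijGroup_def compose_def auto_def)
  then have step: "\<phi> (tau_pow p n (k + 1) a) = inverse M.D * \<phi> (tau_pow p n k a) * M.D" for k
    using closed[OF assms] fundamental by (simp add: tau_def Let_def G.regular_mult G.regular_inv)
  have "\<phi> (tau_pow p n u a) = zpow M.D (- u) * \<phi> a * zpow M.D u"
  proof (induction u rule: int_induct[where k = 0])
    case base
    have "tau_pow p n 0 = \<one>\<^bsub>?A\<^esub>" by (simp add: tau_pow_def)
    then show ?case using assms by (simp add: AutoGroup_def BijGroup_def)
  next
    case (step1 i)
    have "zpow M.D (- (i + 1)) = inverse M.D * zpow M.D (- i)"
      using zpow_pred[of M.D "- i"] by simp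
    moreover have "zpow M.D (i + 1) = zpow M.D i * M.D" by (simp add: zpow_Suc zpow_comm)
    ultimately show ?case using step[of i] step1 by (simp only: mult.assoc)
  next
    case (step2 i)
    have "\<phi> (tau_pow p n (i - 1) a) = M.D * \<phi> (tau_pow p n i a) * inverse M.D"
      using step[of "i - 1"] by (simp add: grp_simps)
    moreover have "zpow M.D (- (i - 1)) = M.D * zpow M.D (- i)"
      using zpow_Suc[of M.D "- i"] by simp
    moreover have "zpow M.D (i - 1) = zpow M.D i * inverse M.D"
      using zpow_add[of M.D i "- 1"] by (simp add: zpow_minus_1)
    ultimately show ?case using step2 by (simp only: mult.assoc)
  qed
  then show ?thesis using closed assms by blast
qed

lemma cycling_eq: assumes "W \<in> C" shows "cycling p n W \<in> C \<and> \<phi> (cycling p n W) = M.gcycling (\<phi> W)"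
proof -
  obtain u As where nf: "normal_form p n W = (u, As)" "set As \<subseteq> C" "M.nf (\<phi> W) = (u, map \<phi> As)"
    using normal_form[OF assms] .
  show ?thesis
  proof (cases As)
    case Nil
    then show ?thesis using nf assms by (simp add: cycling_def M.gcycling_def)
  next
    case (Cons A As')
    have t: "tau_pow p n (- u) A \<in> C" "\<phi> (tau_pow p n (- u) A) = zpow M.D u * \<phi> A * zpow M.D (- u)"
      using tau_pow[of A "- u"] nf Cons by auto
    have "set (As' @ [tau_pow p n (- u) A]) \<subseteq> C" using t nf Cons by auto
    from phi_pow_prod[OF this, of u] show ?thesis
      using nf Cons t by (simp add: cycling_def M.gcycling_def)
  qed
qed

lemma decycling_eq: assumes "W \<in> C" shows "decycling p n W \<in> C \<and> \<phi> (decycling p n W) = M.gdecycling (\<phi> W)"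
proof -
  obtain u As where nf: "normal_form p n W = (u, As)" "set As \<subseteq> C" "M.nf (\<phi> W) = (u, map \<phi> As)"
    using normal_form[OF assms] .
  show ?thesis
  proof (cases "As = []")
    case True
    then show ?thesis using nf assms by (simp add: decycling_def M.gdecycling_def)
  next
    case False
    have t: "tau_pow p n u (last As) \<in> C" "\<phi> (tau_pow p n u (last As)) = zpow M.D (- u) * \<phi> (last As) * zpow M.D u"
      using tau_pow[of "last As" u] subsetD[OF nf(2) last_in_set[OF False]] by auto
    have "set (tau_pow p n u (last As) # butlast As) \<subseteq> C" using t nf by (auto dest: in_set_butlastD)
    from phi_pow_prod[OF this, of u] show ?thesis
      using nf False t by (simp add: decycling_def M.gdecycling_def last_map map_butlast)
  qed
qed

lemma funpow_cycling:
  assumes "W \<in> C" shows "(cycling p n ^^ m) W \<in> C \<and> \<phi> ((cycling p n ^^ m) W) = (M.gcycling ^^ m) (\<phi> W)"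
  by (induction m) (use assms cycling_eq in auto)

lemma funpow_decycling:
  assumes "W \<in> C" shows "(decycling p n ^^ m) W \<in> C \<and> \<phi> ((decycling p n ^^ m) W) = (M.gdecycling ^^ m) (\<phi> W)"
  by (induction m) (use assms decycling_eq in auto)

lemma length_fundamental: "braid_length p n \<Delta> = length (fundamental_word p n)" "M.len M.D = length (fundamental_word p n)"
proof -
  show "M.len M.D = length (fundamental_word p n)" by (rule M.len_weval[OF M.dw(1)])
  show "braid_length p n \<Delta> = length (fundamental_word p n)"
    unfolding braid_length_def
  proof (rule the_equality)
    show "\<exists>w\<in>lists X. braid_of_word p n w = \<Delta> \<and> length w = length (fundamental_word p n)"
      using M.dw(1) fundamental_braid_def by blast
    fix l assume "\<exists>w\<in>lists X. braid_of_word p n w = \<Delta> \<and> length w = l"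
    then obtain w where w: "w \<in> lists X" "braid_of_word p n w = \<Delta>" "length w = l" by blast
    then have "weval (iota p n) w = M.D" using braid_of_word[OF w(1)] fundamental by simp
    then show "l = length (fundamental_word p n)" using M.length_eq[OF w(1) M.dw(1)] w(3) by simp
  qed
qed

lemma phi_conj: "W \<in> C \<Longrightarrow> g \<in> C \<Longrightarrow> g \<otimes>\<^bsub>G\<^esub> W \<otimes>\<^bsub>G\<^esub> inv\<^bsub>G\<^esub> g \<in> C \<and>
    \<phi> (g \<otimes>\<^bsub>G\<^esub> W \<otimes>\<^bsub>G\<^esub> inv\<^bsub>G\<^esub> g) = \<phi> g * \<phi> W * inverse (\<phi> g)"
  by (simp add: G.regular_mult G.regular_inv)

lemma cycling_raises_inf:
  assumes W: "W \<in> C" and "V \<in> conj_class p n W" "\<not> braid_inf p n V \<le> braid_inf p n W"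
  shows "braid_inf p n W < braid_inf p n ((cycling p n ^^ (braid_length p n \<Delta> - 1)) W)"
proof -
  obtain g where g: "g \<in> C" "V = g \<otimes>\<^bsub>G\<^esub> W \<otimes>\<^bsub>G\<^esub> inv\<^bsub>G\<^esub> g" using assms by (auto simp: conj_class_def)
  have "M.ginf (\<phi> W) < M.ginf (\<phi> g * \<phi> W * inverse (\<phi> g))"
    using assms(3) inf_eq[OF W] inf_eq[of V] phi_conj[OF W g(1)] g(2) by simp
  then have "M.ginf (\<phi> W) < M.ginf ((M.gcycling ^^ (M.len M.D - 1)) (\<phi> W))"
    using M.cycling_raises_inf phi_fractions W g(1) by blast
  then show ?thesis
    using funpow_cycling[OF W] inf_eq W by (simp add: length_fundamental)
qed

lemma decycling_lowers_sup:
  assumes W: "W \<in> C" and "V \<in> conj_class p n W" "\<not> braid_sup p n W \<le> braid_sup p n V"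
  shows "braid_sup p n ((decycling p n ^^ (braid_length p n \<Delta> - 1)) W) < braid_sup p n W"
proof -
  obtain g where g: "g \<in> C" "V = g \<otimes>\<^bsub>G\<^esub> W \<otimes>\<^bsub>G\<^esub> inv\<^bsub>G\<^esub> g" using assms by (auto simp: conj_class_def)
  have "M.gsup (\<phi> g * \<phi> W * inverse (\<phi> g)) < M.gsup (\<phi> W)"
    using assms(3) sup_eq[OF W] sup_eq[of V] phi_conj[OF W g(1)] g(2) by simp
  then have "M.gsup ((M.gdecycling ^^ (M.len M.D - 1)) (\<phi> W)) < M.gsup (\<phi> W)"
    using M.decycling_lowers_sup phi_fractions W g(1) by blast
  then show ?thesis
    using funpow_decycling[OF W] sup_eq W by (simp add: length_fundamental)
qed

lemma length_fundamental_word: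
  "length (fundamental_word p n) - 1 = (case p of Old \<Rightarrow> (n\<^sup>2 - n) div 2 - 1 | New \<Rightarrow> n - 2)"
proof (cases p)
  case Old
  have "2 * length (fundamental_word Old n) = n\<^sup>2 - n" using double_length_fundamental_Old n by simp
  then have "length (fundamental_word Old n) = (n\<^sup>2 - n) div 2" by linarith
  then show ?thesis by (simp add: Old)
next
  case New
  then show ?thesis by (simp add: length_fundamental_New)
qed

end

theorem theorem1:
  fixes p :: presentation and n :: nat and W :: braid
  assumes "n \<ge> 2" and "W \<in> carrier (braid_group p n)"
  shows "(\<not> (\<forall>V \<in> conj_class p n W. braid_inf p n V \<le> braid_inf p n W) \<longrightarrow>
           braid_inf p n ((cycling p n ^^ (braid_length p n (fundamental_braid p n) - 1)) W)
             > braid_inf p n W)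
       \<and> (\<not> (\<forall>V \<in> conj_class p n W. braid_sup p n W \<le> braid_sup p n V) \<longrightarrow>
           braid_sup p n ((decycling p n ^^ (braid_length p n (fundamental_braid p n) - 1)) W)
             < braid_sup p n W)
       \<and> braid_length p n (fundamental_braid p n) - 1
           = (case p of Old \<Rightarrow> (n\<^sup>2 - n) div 2 - 1 | New \<Rightarrow> n - 2)"
proof -
  interpret braid_presentation p n by unfold_locales (rule assms(1))
  show ?thesis
    using cycling_raises_inf[OF assms(2)] decycling_lowers_sup[OF assms(2)] length_fundamental_word
      length_fundamental(1) by auto
qed

end
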